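(* Let $2\le h\le k'\le k<n$ be integers and let $V$ be an $h$-non-involutive $k$-dimensional distribution of planes of class $C^1$ in $\mathbb{R}^n$. Let $S$ be a submanifold of $\mathbb{R}^n$ of class $C^{1,1}$ and of dimension $k'$. Then the set $$\mathscr{C}(S,V):=\{q\in S:\ \mathrm{Tan}(S,q)\subseteq V(q)\},$$ where $\mathrm{Tan}(S,q)$ is the classical tangent space to $S$ at $q$, is $h$-purely unrectifiable.
   Context: A $k$-dimensional distribution of planes in $\mathbb{R}^n$ is a map $V:\mathbb{R}^n\to\mathrm{Gr}(n,k)$ (the Grassmannian of $k$-dimensional linear subspaces of $\mathbb{R}^n$). It is of class $C^r$ if there are vector fields $X_1,\dots,X_k$ of class $C^r$ on $\mathbb{R}^n$ with $V(x)=\mathrm{span}\{X_1(x),\dots,X_k(x)\}$ for every $x$. A vector field $Y$ is tangent to $V$ if $Y(x)\in V(x)$ for every $x$; a distribution $W$ is tangent to $V$ if it is spanned by vector fields tangent to $V$, i.e. $W(x)\subseteq V(x)$ for every $x$. These notions are also used locally, on open neighbourhoods of a point. A $C^1$ distribution $W$ is non-involutive at a point $x$ if there are $C^1$ vector fields $X,X'$ tangent to $W$ such that the Lie bracket $[X,X'](x)$ does not belong to $W(x)$. For $h\le k$, a $k$-dimensional $C^1$ distribution $V$ is $h$-non-involutive at $x$ if every $h$-dimensional distribution of class $C^1$ tangent to $V$ (defined near $x$) is non-involutive at $x$; $V$ is $h$-non-involutive if this holds at every point $x\in\mathbb{R}^n$. A set $E\subseteq\mathbb{R}^n$ ($\mathscr{H}^h$-measurable)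 is $h$-purely unrectifiable if for every compact set $K\subseteq\mathbb{R}^h$ and every Lipschitz map $f:K\to\mathbb{R}^n$ one has $\mathscr{H}^h(f(K)\cap E)=0$, where $\mathscr{H}^h$ is the $h$-dimensional Euclidean Hausdorff measure. *)

theory Defs
  imports "HOL-Analysis.Analysis"
begin

definition C1_on :: "'a::real_normed_vector set \<Rightarrow> ('a \<Rightarrow> 'b::real_normed_vector) \<Rightarrow> bool" where
  "C1_on U f \<longleftrightarrow>
     (\<exists>f' :: 'a \<Rightarrow> 'a \<Rightarrow>\<^sub>L 'b.
        (\<forall>x\<in>U. (f has_derivative blinfun_apply (f' x)) (at x)) \<and> continuous_on U f')"

definition C11_on :: "'a::real_normed_vector set \<Rightarrow> ('a \<Rightarrow> 'b::real_normed_vector) \<Rightarrow> bool" where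
  "C11_on U f \<longleftrightarrow>
     (\<exists>f' :: 'a \<Rightarrow> 'a \<Rightarrow>\<^sub>L 'b.
        (\<forall>x\<in>U. (f has_derivative blinfun_apply (f' x)) (at x)) \<and> (\<exists>L. L-lipschitz_on U f'))"


subsection \<open>Distributions of planes\<close>

text \<open>
  A distribution is a map from points to subsets of the space, of which only the values on the
  open domain \<open>U\<close> matter; \<open>U = UNIV\<close> gives the global notion.
\<close>

definition distribution_on :: "(real^'n) set \<Rightarrow> nat \<Rightarrow> (real^'n \<Rightarrow> (real^'n) set) \<Rightarrow> bool" where
  "distribution_on U k V \<longleftrightarrow> (\<forall>x\<in>U. subspace (V x) \<and> dim (V x) = k)"

definition C1_distribution_on :: "(real^'n) set \<Rightarrow> nat \<Rightarrow> (real^'n \<Rightarrow> (real^'n) set) \<Rightarrow> bool" where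
  "C1_distribution_on U k V \<longleftrightarrow>
     distribution_on U k V \<and>
     (\<exists>X :: nat \<Rightarrow> real^'n \<Rightarrow> real^'n.
        (\<forall>i<k. C1_on U (X i)) \<and> (\<forall>x\<in>U. V x = span ((\<lambda>i. X i x) ` {..<k})))"

definition field_tangent_on ::
  "(real^'n) set \<Rightarrow> (real^'n \<Rightarrow> real^'n) \<Rightarrow> (real^'n \<Rightarrow> (real^'n) set) \<Rightarrow> bool" where
  "field_tangent_on U Y V \<longleftrightarrow> (\<forall>x\<in>U. Y x \<in> V x)"

definition distribution_tangent_on ::
  "(real^'n) set \<Rightarrow> (real^'n \<Rightarrow> (real^'n) set) \<Rightarrow> (real^'n \<Rightarrow> (real^'n) set) \<Rightarrow> bool" where
  "distribution_tangent_on U W V \<longleftrightarrow> (\<forall>x\<in>U. W x \<subseteq> V x)"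

text \<open>
  For differentiable fields this is \<open>D Y(x) [X(x)] - D X(x) [Y(x)]\<close>, i.e. the bracket of the
  derivations given by \<open>X\<close> and \<open>Y\<close>.
\<close>

definition lie_bracket ::
  "(real^'n \<Rightarrow> real^'n) \<Rightarrow> (real^'n \<Rightarrow> real^'n) \<Rightarrow> real^'n \<Rightarrow> real^'n" where
  "lie_bracket X Y x =
     frechet_derivative Y (at x) (X x) - frechet_derivative X (at x) (Y x)"

definition non_involutive_at ::
  "(real^'n) set \<Rightarrow> (real^'n \<Rightarrow> (real^'n) set) \<Rightarrow> real^'n \<Rightarrow> bool" where
  "non_involutive_at U W x \<longleftrightarrow>
     (\<exists>X X'. C1_on U X \<and> C1_on U X' \<and> field_tangent_on U X W \<and> field_tangent_on U X' W \<and>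
             lie_bracket X X' x \<notin> W x)"

definition h_non_involutive_at ::
  "nat \<Rightarrow> (real^'n \<Rightarrow> (real^'n) set) \<Rightarrow> real^'n \<Rightarrow> bool" where
  "h_non_involutive_at h V x \<longleftrightarrow>
     (\<forall>U W. open U \<and> x \<in> U \<and> C1_distribution_on U h W \<and> distribution_tangent_on U W V
        \<longrightarrow> non_involutive_at U W x)"

definition h_non_involutive :: "nat \<Rightarrow> (real^'n \<Rightarrow> (real^'n) set) \<Rightarrow> bool" where
  "h_non_involutive h V \<longleftrightarrow> (\<forall>x. h_non_involutive_at h V x)"


subsection \<open>Submanifolds\<close>

text \<open>
  Embedded submanifolds without boundary, not necessarily closed: near each of its points, \<open>S\<close> is
  flattened onto a \<open>d\<close>-dimensional subspace by a diffeomorphism that is \<open>C\<^sup>1\<^sup>,\<^sup>1\<close> in both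
  directions. Because the neighbourhood \<open>U\<close> can be shrunk, it makes no difference whether the
  derivatives are taken to be Lipschitz or only locally Lipschitz.
\<close>

definition C11_submanifold :: "nat \<Rightarrow> (real^'n) set \<Rightarrow> bool" where
  "C11_submanifold d S \<longleftrightarrow>
     (\<forall>p\<in>S. \<exists>U U' \<phi> \<psi> L.
        open U \<and> p \<in> U \<and> open U' \<and> homeomorphism U U' \<phi> \<psi> \<and>
        C11_on U \<phi> \<and> C11_on U' \<psi> \<and>
        subspace (L :: (real^'n) set) \<and> dim L = d \<and> \<phi> ` (U \<inter> S) = U' \<inter> L)"

text \<open>Velocities at \<open>q\<close> of the \<open>C\<^sup>1\<close> curves in \<open>S\<close> through \<open>q\<close>.\<close>

definition tangent_space :: "(real^'n) set \<Rightarrow> real^'n \<Rightarrow> (real^'n) set" where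
  "tangent_space S q =
     {v. \<exists>(\<gamma> :: real \<Rightarrow> real^'n) \<epsilon>. \<epsilon> > 0 \<and> C1_on {-\<epsilon><..<\<epsilon>} \<gamma> \<and> \<gamma> ` {-\<epsilon><..<\<epsilon>} \<subseteq> S \<and>
           \<gamma> 0 = q \<and> (\<gamma> has_vector_derivative v) (at 0)}"

definition tangency_set :: "(real^'n) set \<Rightarrow> (real^'n \<Rightarrow> (real^'n) set) \<Rightarrow> (real^'n) set" where
  "tangency_set S V = {q \<in> S. tangent_space S q \<subseteq> V q}"


subsection \<open>Hausdorff measure and pure unrectifiability\<close>

text \<open>
  The weight \<open>\<omega>\<^sub>h (diam C / 2)\<^sup>h\<close>, with value \<open>0\<close> on the empty set also for \<open>h = 0\<close>.
  Covers consist of bounded sets because \<^const>\<open>diameter\<close> is meaningless on unbounded ones.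
\<close>

definition hausdorff_weight :: "nat \<Rightarrow> 'a::metric_space set \<Rightarrow> ennreal" where
  "hausdorff_weight h C =
     (if C = {} then 0 else ennreal (unit_ball_vol (real h) * (diameter C / 2) ^ h))"

definition hausdorff_premeasure :: "nat \<Rightarrow> real \<Rightarrow> 'a::metric_space set \<Rightarrow> ennreal" where
  "hausdorff_premeasure h \<delta> A =
     (INF C \<in> {C :: nat \<Rightarrow> 'a set. A \<subseteq> (\<Union>i. C i) \<and> (\<forall>i. bounded (C i) \<and> diameter (C i) \<le> \<delta>)}.
        \<Sum>i. hausdorff_weight h (C i))"

definition hausdorff_measure :: "nat \<Rightarrow> 'a::metric_space set \<Rightarrow> ennreal" where
  "hausdorff_measure h A = (SUP \<delta> \<in> {0<..}. hausdorff_premeasure h \<delta> A)"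

text \<open>
  \<^const>\<open>hausdorff_measure\<close> is an outer measure on all sets; measurability is in the sense of
  Caratheodory.
\<close>

definition hausdorff_measurable :: "nat \<Rightarrow> 'a::metric_space set \<Rightarrow> bool" where
  "hausdorff_measurable h E \<longleftrightarrow> E \<in> lambda_system UNIV (Pow UNIV) (hausdorff_measure h)"

text \<open>
  The dimension \<open>h\<close> is the cardinality of the index type \<open>'h\<close>, so that \<open>real^'h\<close> is the
  \<open>h\<close>-dimensional Euclidean space in which the compact sets \<open>K\<close> live.
\<close>

definition purely_unrectifiable :: "'h::finite itself \<Rightarrow> (real^'n) set \<Rightarrow> bool" where
  "purely_unrectifiable _ E \<longleftrightarrow>
     hausdorff_measurable CARD('h) E \<and>
     (\<forall>(K :: (real^'h) set) f. compact K \<and> (\<exists>L. L-lipschitz_on K f)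
        \<longrightarrow> hausdorff_measure CARD('h) (f ` K \<inter> E) = 0)"

end

theory Submission
  imports Defs
begin

text \<open>
  Write \<open>E\<close> for the tangency set. Suppose that a Lipschitz map \<open>f\<close> defined on a compact subset of
  \<open>\<real>\<^sup>h\<close> hits \<open>E\<close> in a set of positive \<open>h\<close>-dimensional measure, and extend \<open>f\<close> to all of \<open>\<real>\<^sup>h\<close>. In a
  chart, \<open>S\<close> is the image under a \<open>C\<^sup>1\<^sup>,\<^sup>1\<close> map \<open>\<psi>\<close> of a piece of a linear subspace \<open>L\<close>, and
  \<open>f = \<psi> \<circ> g\<close> with \<open>g\<close> Lipschitz. Both \<open>f\<close> and \<open>N = D\<psi> \<circ> g\<close> are Lipschitz on a piece of \<open>\<real>\<^sup>h\<close>, so by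
  Rademacher's theorem they are differentiable almost everywhere; this is where \<open>C\<^sup>1\<^sup>,\<^sup>1\<close> regularity
  enters. Null sets have Hausdorff-null Lipschitz images
  (\<open>hausdorff_null_lipschitz_image\<close>), and so does the set where \<open>Df\<close> is not injective
  (\<open>hausdorff_null_critical_values\<close>). Hence there is a point \<open>y\<close>, with \<open>f y \<in> E\<close>, at which \<open>f\<close> and \<open>N\<close>
  are differentiable, \<open>Df(y)\<close> is injective, and towards which points of \<open>A = f\<^sup>-\<^sup>1 E\<close> converge in every
  direction.

  At such a point the \<open>h\<close> vectors \<open>Df(y) b\<^sub>j\<close>, where \<open>b\<^sub>j\<close> is the standard basis, extend to an
  \<open>h\<close>-dimensional \<open>C\<^sup>1\<close> distribution tangent to \<open>V\<close> that is involutive at \<open>f y\<close>, contradicting the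
  hypothesis on \<open>V\<close> (\<open>tangency_forces_degeneracy\<close>). Indeed, put \<open>e\<^sub>j = Dg(y) b\<^sub>j\<close>. On \<open>A\<close> the fields
  \<open>z \<mapsto> N(z) e\<^sub>j\<close> take values in \<open>V(f z)\<close>. Writing them in a \<open>C\<^sup>1\<close> frame of \<open>V\<close> and replacing the
  coefficients by their first order expansion produces \<open>C\<^sup>1\<close> fields \<open>w\<^sub>j\<close> tangent to \<open>V\<close> with
  \<open>w\<^sub>j(f y) = Df(y) b\<^sub>j\<close> and \<open>Dw\<^sub>j(f y) (Df(y) t) = DN(y)[t] e\<^sub>j\<close>. Therefore
  \<open>[w\<^sub>i, w\<^sub>j](f y) = DN(y)[b\<^sub>i] e\<^sub>j - DN(y)[b\<^sub>j] e\<^sub>i\<close>, 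
  which is formally the antisymmetric part of the second derivative of \<open>\<psi>\<close> on the range of \<open>Dg(y)\<close>. The map \<open>\<psi>\<close> need not have a second derivative at \<open>g y\<close>, but the symmetry
  survives: it follows from evaluating, up to an error \<open>o(\<epsilon>\<^sup>2)\<close>, the vanishing integral of \<open>D\<psi>\<close> around
  the triangle with vertices \<open>g(y)\<close>, \<open>g(y + \<epsilon>t)\<close>, \<open>g(y + \<epsilon>s)\<close> (\<open>derivative_along_map_symmetric\<close>). So
  the brackets of the frame vanish at \<open>f y\<close>, and since the bracket is tensorial modulo the
  distribution, the span of the \<open>w\<^sub>j\<close> is involutive there (\<open>involutive_if_frame_commutes\<close>).

  Measurability of \<open>E\<close> is a separate matter: \<open>E\<close> is locally relatively closed in \<open>S\<close>, hence Borel, and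
  Borel sets are Caratheodory measurable because Hausdorff measure is additive on sets at positive
  distance (\<open>hausdorff_measurable_borel\<close>).

  Rademacher's theorem is proved by integrating difference quotients. On a line, a Lipschitz function
  is the integral of its difference quotient limit (\<open>lipschitz_real_integral\<close>, by
  Radon-Nikodym and Lebesgue differentiation). In \<open>\<real>\<^sup>h\<close>, at a common \<open>L\<^sup>1\<close> Lebesgue point of the \<open>h\<close> partial
  derivatives the increments of \<open>f\<close>, averaged over a small cube of base points, agree with the linear
  prediction up to a small error, and the Lipschitz bound removes the averaging.
\<close>

section \<open>Fine covers by cubes\<close>

abbreviation cube :: "'a::euclidean_space \<Rightarrow> real \<Rightarrow> 'a set" where
  "cube u s \<equiv> cbox u (u + s *\<^sub>R One)"

text \<open>
  The device that turns local estimates into global ones: an estimate valid on small cubes, where the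
  smallness may depend arbitrarily on a point inside, is summed over the cover. The cubes are dyadic with
  disjoint interiors, and keeping them inside \<open>T\<close> bounds their total volume.
\<close>

lemma fine_cube_cover:
  fixes A T :: "'a::euclidean_space set" and r :: "'a \<Rightarrow> real"
  assumes "bounded A" "open T" "A \<subseteq> T" and r: "\<And>x. x \<in> A \<Longrightarrow> 0 < r x"
  obtains Q :: "nat \<Rightarrow> 'a set" where
    "A \<subseteq> (\<Union>n. Q n)"
    "\<And>n. Q n \<noteq> {} \<Longrightarrow> \<exists>x\<in>A. \<exists>u s. 0 < s \<and> Q n = cube u s \<and> x \<in> Q n \<and> Q n \<subseteq> ball x (r x)"
    "(\<Sum>n. emeasure lborel (Q n)) \<le> emeasure lborel T"
proof -
  obtain c where c: "c > 0" "A \<subseteq> cbox (- c *\<^sub>R One) (c *\<^sub>R One)"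
  proof -
    obtain a where a: "A \<subseteq> cbox (-a) a" using bounded_subset_cbox_symmetric[OF assms(1)] .
    define c where "c = norm a + 1"
    have le: "\<bar>a \<bullet> i\<bar> \<le> c" if "i \<in> Basis" for i using Basis_le_norm[OF that, of a] by (simp add: c_def)
    have "cbox (-a) a \<subseteq> cbox (- c *\<^sub>R One) (c *\<^sub>R One)"
      unfolding subset_box using le by (auto simp: abs_le_iff)
    moreover have "c > 0" by (simp add: c_def add_nonneg_pos)
    ultimately show ?thesis using that a by blast
  qed
  define g where "g x = (if x \<in> A then ball x (r x) \<inter> T else ball x 1)" for x
  have "gauge g" using assms r by (auto simp: gauge_def g_def)
  moreover have "box (- c *\<^sub>R One) (c *\<^sub>R One) \<noteq> ({} :: 'a set)" using c by (simp add: box_ne_empty)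
  ultimately obtain D where D: "countable D"
    "\<And>K. K \<in> D \<Longrightarrow> interior K \<noteq> {} \<and> (\<exists>c d. K = cbox c d)"
    "pairwise (\<lambda>A B. interior A \<inter> interior B = {}) D"
    "\<And>K. K \<in> D \<Longrightarrow> \<exists>x \<in> A \<inter> K. K \<subseteq> g x"
    "\<And>u v. cbox u v \<in> D \<Longrightarrow> \<exists>n. \<forall>i \<in> Basis. v \<bullet> i - u \<bullet> i = ((c *\<^sub>R One) \<bullet> i - (- c *\<^sub>R One) \<bullet> i) / 2^n"
    "A \<subseteq> \<Union>D"
    using covering_lemma[OF c(2), of g] by (metis (no_types, lifting))
  have cube: "\<exists>u s. 0 < s \<and> K = cube u s" if "K \<in> D" for K
  proof -
    obtain u v where K: "K = cbox u v" using D(2) \<open>K \<in> D\<close> by blast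
    then obtain n where n: "\<forall>i \<in> Basis. v \<bullet> i - u \<bullet> i = ((c *\<^sub>R One) \<bullet> i - (- c *\<^sub>R One) \<bullet> i) / 2^n"
      using D(5) \<open>K \<in> D\<close> by blast
    have "v = u + (2 * c / 2^n) *\<^sub>R One"
    proof (rule euclidean_eqI)
      fix i :: 'a assume i: "i \<in> Basis"
      show "v \<bullet> i = (u + (2 * c / 2^n) *\<^sub>R One) \<bullet> i" using n[rule_format, OF i] i by (simp add: inner_add_left field_simps)
    qed
    then show ?thesis using K c by (intro exI[of _ u] exI[of _ "2 * c / 2^n"]) auto
  qed
  \<comment> \<open>The countable family is enumerated without repetition, padded with empty sets, so that volumes add up.\<close>
  define Q where "Q n = (if n \<in> to_nat_on D ` D then from_nat_into D n else {})" for n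
  have Qe: "Q (to_nat_on D K) = K" if "K \<in> D" for K
    unfolding Q_def using that from_nat_into_to_nat_on[OF D(1) that] by simp
  have QD: "Q n \<in> D" if "Q n \<noteq> {}" for n
  proof -
    have "n \<in> to_nat_on D ` D" using that by (metis Q_def)
    then show ?thesis by (metis Qe imageE)
  qed
  have em: "emeasure lborel K = emeasure lborel (interior K)" if "K \<in> D" for K
    using D(2)[OF that] by (auto simp: emeasure_lborel_cbox_eq emeasure_lborel_box_eq)
  have disj: "disjoint_family (\<lambda>n. interior (Q n))"
    unfolding disjoint_family_on_def
  proof safe
    fix m n x assume mn: "m \<noteq> n" and x: "x \<in> interior (Q m)" "x \<in> interior (Q n)"
    then have ne: "Q m \<noteq> {}" "Q n \<noteq> {}" by (metis empty_iff interior_empty)+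
    then have "Q m \<in> D" "Q n \<in> D" using QD by metis+
    moreover have "Q m \<noteq> Q n"
    proof
      assume eq: "Q m = Q n"
      from ne have "m \<in> to_nat_on D ` D" "n \<in> to_nat_on D ` D" by (auto simp: Q_def split: if_splits)
      then obtain K K' where "K \<in> D" "m = to_nat_on D K" "K' \<in> D" "n = to_nat_on D K'" by auto
      then show False using eq Qe mn by auto
    qed
    ultimately have "interior (Q m) \<inter> interior (Q n) = {}" using D(3) by (auto simp: pairwise_def)
    then show "x \<in> {}" using x by auto
  qed
  have "(\<Sum>n. emeasure lborel (Q n)) = (\<Sum>n. emeasure lborel (interior (Q n)))"
    by (rule suminf_cong) (metis QD em interior_empty)
  also have "\<dots> = emeasure lborel (\<Union>n. interior (Q n))"
    by (rule suminf_emeasure) (use disj in auto)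
  also have "\<dots> \<le> emeasure lborel T"
  proof (rule emeasure_mono)
    show "(\<Union>n. interior (Q n)) \<subseteq> T"
    proof safe
      fix n x assume x: "x \<in> interior (Q n)"
      then have "Q n \<in> D" by (metis QD empty_iff interior_empty)
      from D(4)[OF this] obtain z where "z \<in> A" "Q n \<subseteq> g z" by auto
      then show "x \<in> T" using x interior_subset by (fastforce simp: g_def)
    qed
  qed (use assms in auto)
  finally have sum: "(\<Sum>n. emeasure lborel (Q n)) \<le> emeasure lborel T" .
  show ?thesis
  proof (rule that[OF _ _ sum])
    show "A \<subseteq> (\<Union>n. Q n)" using D(6) Qe by fastforce
    show "\<exists>x\<in>A. \<exists>u s. 0 < s \<and> Q n = cube u s \<and> x \<in> Q n \<and> Q n \<subseteq> ball x (r x)"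
      if "Q n \<noteq> {}" for n
    proof -
      have Q: "Q n \<in> D" using QD that .
      from D(4)[OF Q] obtain z where "z \<in> A" "z \<in> Q n" "Q n \<subseteq> ball z (r z)" by (auto simp: g_def)
      then show ?thesis using cube[OF Q] by blast
    qed
  qed
qed

section \<open>Lipschitz functions on a line\<close>

text \<open>
  The derivative along \<open>v\<close> computed from the step sizes \<open>1/(n+1)\<close> only, so that for a continuous function it is
  visibly Borel. The value \<open>0\<close> where the limit fails to exist preserves the bound
  \<open>L * norm v\<close> for an \<open>L\<close>-Lipschitz function at every point.
\<close>

definition forward_derivative :: "('a::real_normed_vector \<Rightarrow> real) \<Rightarrow> 'a \<Rightarrow> 'a \<Rightarrow> real" where
  "forward_derivative f v x =
     (let X = \<lambda>n. real (Suc n) * (f (x + (1 / real (Suc n)) *\<^sub>R v) - f x)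
      in if Cauchy X then lim X else 0)"

lemma forward_derivative_eqI:
  assumes "(\<lambda>n. real (Suc n) * (f (x + (1 / real (Suc n)) *\<^sub>R v) - f x)) \<longlonglongrightarrow> l"
  shows "forward_derivative f v x = l"
  using assms unfolding forward_derivative_def Let_def by (auto simp: LIMSEQ_imp_Cauchy limI)

lemma abs_forward_derivative_le:
  assumes f: "L-lipschitz_on UNIV f"
  shows "\<bar>forward_derivative f v x\<bar> \<le> L * norm v"
proof -
  define X where "X = (\<lambda>n. real (Suc n) * (f (x + (1 / real (Suc n)) *\<^sub>R v) - f x))"
  have L0: "0 \<le> L" using f lipschitz_on_nonneg by blast
  show ?thesis
  proof (cases "Cauchy X")
    case True
    then have "X \<longlonglongrightarrow> lim X" by (simp add: Cauchy_convergent convergent_LIMSEQ_iff[symmetric])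
    moreover have "\<bar>X n\<bar> \<le> L * norm v" for n
    proof -
      have "\<bar>f (x + (1 / real (Suc n)) *\<^sub>R v) - f x\<bar> \<le> L * (norm v / real (Suc n))"
        using lipschitz_on_normD[OF f, of "x + (1 / real (Suc n)) *\<^sub>R v" x] by simp
      then show ?thesis
        by (simp add: X_def abs_mult pos_le_divide_eq mult.commute del: of_nat_Suc)
    qed
    ultimately have "\<bar>lim X\<bar> \<le> L * norm v"
      by (intro LIMSEQ_le_const2[OF tendsto_rabs]) auto
    then show ?thesis using True by (simp add: forward_derivative_def X_def)
  next
    case False
    then show ?thesis using L0 by (simp add: forward_derivative_def X_def)
  qed
qed

lemma measurable_forward_derivative:
  fixes f :: "'a::euclidean_space \<Rightarrow> real"
  assumes "L-lipschitz_on UNIV f"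
  shows "forward_derivative f v \<in> borel_measurable borel"
proof -
  have cont: "continuous_on UNIV f" using assms lipschitz_on_continuous_on by blast
  have [measurable]: "f \<in> borel_measurable borel" using cont by (rule borel_measurable_continuous_onI)
  have [measurable]: "(\<lambda>x. f (x + (1 / real (Suc n)) *\<^sub>R v)) \<in> borel_measurable borel" for n
    by (intro borel_measurable_continuous_onI continuous_on_compose2[OF cont] continuous_intros) auto
  show ?thesis unfolding forward_derivative_def[abs_def] Let_def by measurable
qed

text \<open>
  The increasing function \<open>F x = f x + L x\<close> has a Stieltjes measure bounded by \<open>2L\<close> times length on
  intervals, hence absolutely continuous. Its Radon-Nikodym density \<open>G\<close> integrates back to \<open>F\<close>, and
  by Lebesgue's differentiation theorem the difference quotients of \<open>F\<close> tend to \<open>G\<close> almost everywhere.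
\<close>

lemma lipschitz_real_integral:
  fixes f :: "real \<Rightarrow> real"
  assumes f: "L-lipschitz_on UNIV f" and "a \<le> b"
  shows "(forward_derivative f 1 has_integral (f b - f a)) {a..b}"
proof -
  define F where "F x = f x + L * x" for x
  have fL: "\<bar>f x - f y\<bar> \<le> L * \<bar>x - y\<bar>" for x y
    using lipschitz_on_normD[OF f, of x y] by simp
  have L0: "0 \<le> L" using f lipschitz_on_nonneg by blast
  have mono: "F x \<le> F y" if "x \<le> y" for x y
    using fL[of x y] that by (simp add: F_def algebra_simps abs_if split: if_splits)
  have Fle: "F y - F x \<le> 2 * L * (y - x)" if "x \<le> y" for x y
    using fL[of x y] that by (simp add: F_def algebra_simps abs_if split: if_splits)
  have contf: "continuous_on UNIV f" using f lipschitz_on_continuous_on by blast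
  have cont: "continuous_on UNIV F" unfolding F_def by (intro continuous_intros contf)
  define \<mu> where "\<mu> = interval_measure F"
  have \<mu>: "emeasure \<mu> {x..y} = ennreal (F y - F x)" if "x \<le> y" for x y
    unfolding \<mu>_def using emeasure_interval_measure_Icc[OF that mono cont] .
  have sets\<mu>[simp]: "sets \<mu> = sets borel" by (simp add: \<mu>_def)
  have ac: "absolutely_continuous lborel \<mu>"
    unfolding absolutely_continuous_def
  proof
    fix N :: "real set" assume N: "N \<in> null_sets lborel"
    have "N \<inter> {-real k..real k} \<in> null_sets \<mu>" for k
    proof -
      define B where "B = N \<inter> {-real k..real k}"
      have Bs: "B \<in> sets borel" using N by (auto simp: B_def null_sets_def)
      have B0: "emeasure lborel B = 0"
        using emeasure_mono[of B N lborel] null_setsD1[OF N] null_setsD2[OF N] by (simp add: B_def)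
      \<comment> \<open>Cover by small intervals of total length about \<open>e\<close>; each has measure at most \<open>2L\<close> times its length.\<close>
      have small: "emeasure \<mu> B \<le> ennreal (2 * L * e)" if "e > 0" for e
      proof -
        obtain U where U: "open U" "B \<subseteq> U" "emeasure lborel (U - B) < ennreal e"
          using outer_regular_lborel[OF Bs \<open>e > 0\<close>] .
        have "emeasure lborel U \<le> emeasure lborel (U - B) + emeasure lborel B"
          using emeasure_subadditive[of "U - B" lborel B] U Bs
          by (metis Un_Diff_cancel2 Un_absorb2 borel_open sets.Diff sets_lborel)
        then have Ue: "emeasure lborel U \<le> ennreal e" using U B0 by simp
        have "bounded B" by (rule bounded_subset[of "{-real k..real k}"]) (auto simp: B_def)
        from fine_cube_cover[OF this U(1,2), of "\<lambda>_. 1"] obtain Q where Q: "B \<subseteq> (\<Union>n. Q n)"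
          "\<And>n. Q n \<noteq> {} \<Longrightarrow> \<exists>x\<in>B. \<exists>u s. 0 < s \<and> Q n = cube u s \<and> x \<in> Q n \<and> Q n \<subseteq> ball x 1"
          "(\<Sum>n. emeasure lborel (Q n)) \<le> emeasure lborel U" by auto
        have Qn: "emeasure \<mu> (Q n) \<le> ennreal (2 * L) * emeasure lborel (Q n) \<and> Q n \<in> sets borel" for n
        proof (cases "Q n = {}")
          case False
          then obtain u s where "s > 0" "Q n = cube u s" using Q(2) by blast
          then have us: "s > 0" "Q n = {u..u + s}" by auto
          have "emeasure \<mu> (Q n) \<le> ennreal (2 * L * s)"
            using us \<mu>[of u "u + s"] Fle[of u "u + s"] by (simp add: ennreal_leI)
          also have "\<dots> = ennreal (2 * L) * emeasure lborel (Q n)"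
            using us L0 by (simp add: ennreal_mult)
          finally show ?thesis using us by simp
        qed auto
        have "emeasure \<mu> B \<le> emeasure \<mu> (\<Union>n. Q n)"
          by (rule emeasure_mono) (use Q(1) Qn in auto)
        also have "\<dots> \<le> (\<Sum>n. emeasure \<mu> (Q n))"
          by (rule emeasure_subadditive_countably) (use Qn in auto)
        also have "\<dots> \<le> (\<Sum>n. ennreal (2 * L) * emeasure lborel (Q n))"
          by (rule suminf_le) (use Qn in auto)
        also have "\<dots> = ennreal (2 * L) * (\<Sum>n. emeasure lborel (Q n))" by (rule ennreal_suminf_cmult)
        also have "\<dots> \<le> ennreal (2 * L) * ennreal e"
          using Q(3) Ue by (intro mult_left_mono) auto
        finally show ?thesis using L0 that by (simp add: ennreal_mult)
      qed
      have "emeasure \<mu> B \<le> 0 + ennreal e" if "e > 0" for e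
      proof -
        have "emeasure \<mu> B \<le> ennreal (2 * L * (e / (2 * L + 1)))"
          using small[of "e / (2 * L + 1)"] L0 that by simp
        also have "\<dots> \<le> ennreal e"
        proof (rule ennreal_leI)
          have "2 * L * (e / (2 * L + 1)) = e * (2 * L / (2 * L + 1))" by simp
          also have "\<dots> \<le> e * 1" using L0 that by (intro mult_left_mono) auto
          finally show "2 * L * (e / (2 * L + 1)) \<le> e" by simp
        qed
        finally show ?thesis by simp
      qed
      then have "emeasure \<mu> B \<le> 0" by (rule ennreal_le_epsilon)
      then have "emeasure \<mu> B = 0" by simp
      then have "B \<in> null_sets \<mu>" by (rule null_setsI) (simp add: Bs)
      then show ?thesis by (simp only: B_def)
    qed
    then have "(\<Union>k. N \<inter> {-real k..real k}) \<in> null_sets \<mu>" by (rule null_sets_UN)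
    moreover have "(\<Union>k. N \<inter> {-real k..real k}) = N"
    proof safe
      fix x assume "x \<in> N"
      obtain k where "\<bar>x\<bar> \<le> real k" using real_arch_simple by blast
      then show "x \<in> (\<Union>k. N \<inter> {-real k..real k})" using \<open>x \<in> N\<close> by (intro UN_I[of k]) (auto simp: abs_le_iff)
    qed
    ultimately show "N \<in> null_sets \<mu>" by simp
  qed
  have "\<exists>g \<in> borel_measurable lborel. density lborel g = \<mu>"
    by (rule sigma_finite_measure.Radon_Nikodym[OF sigma_finite_lborel ac]) simp
  then obtain g where g[measurable]: "g \<in> borel_measurable borel" and gd: "density lborel g = \<mu>" by auto
  have int: "(\<integral>\<^sup>+x. g x * indicator {x0..y0} x \<partial>lborel) = ennreal (F y0 - F x0)" if "x0 \<le> y0" for x0 y0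
    using emeasure_density[of g lborel "{x0..y0}"] \<mu>[OF that] by (simp add: gd)
  have "AE x in lborel. \<forall>k::nat. g x * indicator {-real k..real k} x \<noteq> \<infinity>"
    unfolding AE_all_countable
  proof
    fix k :: nat
    show "AE x in lborel. g x * indicator {-real k..real k} x \<noteq> \<infinity>"
      by (rule nn_integral_PInf_AE) (use int[of "-real k" "real k"] in auto)
  qed
  then have fin: "AE x in lborel. g x \<noteq> \<infinity>"
  proof eventually_elim
    case (elim x)
    obtain k where "\<bar>x\<bar> \<le> real k" using real_arch_simple by blast
    then show ?case using elim[rule_format, of k] by (auto simp: abs_le_iff)
  qed
  define G where "G x = enn2real (g x)" for x
  have [measurable]: "G \<in> borel_measurable borel" unfolding G_def by measurable
  have Gint: "(G has_integral (F y - F x)) {x..y}" if "x \<le> y" for x y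
  proof -
    have "(\<integral>\<^sup>+z. ennreal (G z * indicator {x..y} z) \<partial>lborel) = (\<integral>\<^sup>+z. g z * indicator {x..y} z \<partial>lborel)"
    proof (rule nn_integral_cong_AE, use fin in eventually_elim)
      fix z assume "g z \<noteq> \<infinity>"
      then show "ennreal (G z * indicator {x..y} z) = g z * indicator {x..y} z"
        by (auto simp: G_def indicator_def top.not_eq_extremum)
    qed
    also have "\<dots> = ennreal (F y - F x)" by (rule int[OF that])
    finally have "((\<lambda>z. G z * indicator {x..y} z) has_integral (F y - F x)) UNIV"
      using mono[OF that] by (intro nn_integral_has_integral) (auto simp: G_def)
    also have "(\<lambda>z. G z * indicator {x..y} z) = (\<lambda>z. if z \<in> {x..y} then G z else 0)" by auto
    finally show ?thesis by (simp only: has_integral_restrict_UNIV)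
  qed
  have "G integrable_on cbox x y" for x y
    using Gint[of x y] by (cases "x \<le> y") (auto simp: integrable_on_def)
  from integrable_ccontinuous_explicit[OF this] obtain N where N: "negligible N"
    "\<And>x e. \<lbrakk>x \<notin> N; 0 < e\<rbrakk> \<Longrightarrow>
       \<exists>d>0. \<forall>h. 0 < h \<and> h < d \<longrightarrow> norm (integral (cube x h) G /\<^sub>R h ^ DIM(real) - G x) < e"
    by metis
  have fd: "forward_derivative f 1 x = G x - L" if xN: "x \<notin> N" for x
  proof (rule forward_derivative_eqI, rule LIMSEQ_I)
    fix e :: real assume "e > 0"
    then obtain d where d: "d > 0"
      "\<And>h. \<lbrakk>0 < h; h < d\<rbrakk> \<Longrightarrow> norm (integral (cube x h) G /\<^sub>R h ^ DIM(real) - G x) < e"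
      using N(2)[OF xN] by blast
    obtain m where m: "1 / real (Suc m) < d" using \<open>d > 0\<close> nat_approx_posE by blast
    have "norm (real (Suc n) * (f (x + (1 / real (Suc n)) *\<^sub>R 1) - f x) - (G x - L)) < e" if "n \<ge> m" for n
    proof -
      define h where "h = 1 / real (Suc n)"
      have h: "0 < h" "h < d"
      proof -
        have "h \<le> 1 / real (Suc m)" using that by (simp add: h_def frac_le)
        then show "h < d" using m by simp
      qed (simp add: h_def)
      have "integral (cube x h) G = F (x + h) - F x"
        using Gint[of x "x + h"] h by (simp add: integral_unique)
      then have "norm ((F (x + h) - F x) / h - G x) < e" using d(2)[OF h] by (simp add: divide_inverse_commute)
      moreover have "(F (x + h) - F x) / h = (f (x + h) - f x) / h + L" using h by (simp add: F_def field_simps)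
      moreover have "(f (x + h) - f x) / h = real (Suc n) * (f (x + (1 / real (Suc n)) *\<^sub>R 1) - f x)"
        by (simp add: h_def del: of_nat_Suc)
      ultimately show ?thesis by (simp add: algebra_simps del: of_nat_Suc)
    qed
    then show "\<exists>no. \<forall>n\<ge>no. norm (real (Suc n) * (f (x + (1 / real (Suc n)) *\<^sub>R 1) - f x) - (G x - L)) < e" by blast
  qed
  have "((\<lambda>x. G x - L) has_integral (F b - F a - L * (b - a))) {a..b}"
    using Gint[OF \<open>a \<le> b\<close>] has_integral_const_real[of L a b] \<open>a \<le> b\<close>
    by (intro has_integral_diff) (auto simp: algebra_simps)
  then have "(forward_derivative f 1 has_integral (F b - F a - L * (b - a))) {a..b}"
    by (rule has_integral_spike[OF N(1), rotated]) (use fd in auto)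
  then show ?thesis by (simp add: F_def algebra_simps)
qed

lemma forward_derivative_along_line:
  "forward_derivative (\<lambda>t. f (x + t *\<^sub>R v)) 1 t = forward_derivative f v (x + t *\<^sub>R v)"
  by (simp add: forward_derivative_def algebra_simps)

text \<open>
  The estimate holds on every line, not just almost every line, because \<open>forward_derivative\<close> is defined
  pointwise. This is what makes Fubini's theorem harmless later on.
\<close>

lemma lipschitz_increment_le_nn_integral:
  fixes f :: "'a::euclidean_space \<Rightarrow> real"
  assumes f: "L-lipschitz_on UNIV f" and "a \<le> b"
  shows "ennreal \<bar>f (x + b *\<^sub>R v) - f (x + a *\<^sub>R v) - c * (b - a)\<bar>
    \<le> (\<integral>\<^sup>+\<tau>. ennreal \<bar>forward_derivative f v (x + \<tau> *\<^sub>R v) - c\<bar> * indicator {a..b} \<tau> \<partial>lborel)"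
proof -
  define p where "p t = f (x + t *\<^sub>R v)" for t
  define q where "q t = forward_derivative f v (x + t *\<^sub>R v) - c" for t
  have L0: "0 \<le> L" using f lipschitz_on_nonneg by blast
  have plip: "(L * norm v)-lipschitz_on UNIV p"
  proof (rule lipschitz_onI)
    fix s t :: real
    show "dist (p s) (p t) \<le> L * norm v * dist s t"
      using lipschitz_onD[OF f, of "x + s *\<^sub>R v" "x + t *\<^sub>R v"]
      by (simp add: p_def dist_norm flip: scaleR_left_diff_distrib) (simp add: mult_ac)
  qed (use L0 in auto)
  have [measurable]: "forward_derivative f v \<in> borel_measurable borel" by (rule measurable_forward_derivative[OF f])
  have [measurable]: "q \<in> borel_measurable borel" unfolding q_def by measurable
  have "forward_derivative p 1 = (\<lambda>t. forward_derivative f v (x + t *\<^sub>R v))"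
    unfolding p_def forward_derivative_along_line ..
  then have I: "((\<lambda>t. forward_derivative f v (x + t *\<^sub>R v)) has_integral (p b - p a)) {a..b}"
    using lipschitz_real_integral[OF plip \<open>a \<le> b\<close>] by simp
  then have hi: "(q has_integral (p b - p a - c * (b - a))) {a..b}"
    using has_integral_diff[OF I has_integral_const_real[of c a b]] \<open>a \<le> b\<close>
    unfolding q_def[abs_def] by (simp add: mult.commute)
  have qb: "\<bar>q t\<bar> \<le> L * norm v + \<bar>c\<bar>" for t
    using abs_forward_derivative_le[OF f, of v "x + t *\<^sub>R v"] unfolding q_def by linarith
  have fin: "(\<integral>\<^sup>+\<tau>. ennreal (\<bar>q \<tau>\<bar> * indicator {a..b} \<tau>) \<partial>lborel) < \<infinity>"
  proof -
    have "(\<integral>\<^sup>+\<tau>. ennreal (\<bar>q \<tau>\<bar> * indicator {a..b} \<tau>) \<partial>lborel)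
       \<le> (\<integral>\<^sup>+\<tau>. ennreal (L * norm v + \<bar>c\<bar>) * indicator {a..b} \<tau> \<partial>lborel)"
      using qb by (intro nn_integral_mono) (auto simp: indicator_def ennreal_leI)
    also have "\<dots> < \<infinity>" using \<open>a \<le> b\<close> L0 by (simp add: nn_integral_cmult ennreal_mult_less_top)
    finally show ?thesis .
  qed
  then obtain r where r: "0 \<le> r" "(\<integral>\<^sup>+\<tau>. ennreal (\<bar>q \<tau>\<bar> * indicator {a..b} \<tau>) \<partial>lborel) = ennreal r"
    by (cases "\<integral>\<^sup>+\<tau>. ennreal (\<bar>q \<tau>\<bar> * indicator {a..b} \<tau>) \<partial>lborel" rule: ennreal_cases) auto
  then have "((\<lambda>\<tau>. \<bar>q \<tau>\<bar> * indicator {a..b} \<tau>) has_integral r) UNIV"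
    by (intro nn_integral_has_integral) auto
  also have "(\<lambda>\<tau>. \<bar>q \<tau>\<bar> * indicator {a..b} \<tau>) = (\<lambda>\<tau>. if \<tau> \<in> {a..b} then \<bar>q \<tau>\<bar> else 0)" by auto
  finally have ha: "((\<lambda>\<tau>. \<bar>q \<tau>\<bar>) has_integral r) {a..b}" by (simp only: has_integral_restrict_UNIV)
  have up: "p b - p a - c * (b - a) \<le> r" by (rule has_integral_le[OF hi ha]) auto
  have dn: "- r \<le> p b - p a - c * (b - a)" by (rule has_integral_le[OF has_integral_neg[OF ha] hi]) auto
  have "\<bar>p b - p a - c * (b - a)\<bar> \<le> r" using up dn by linarith
  then have "ennreal \<bar>p b - p a - c * (b - a)\<bar> \<le> ennreal r" by (rule ennreal_leI)
  also have "ennreal r = (\<integral>\<^sup>+\<tau>. ennreal \<bar>q \<tau>\<bar> * indicator {a..b} \<tau> \<partial>lborel)"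
    unfolding r(2)[symmetric] by (intro nn_integral_cong) (auto simp: indicator_def)
  finally show ?thesis by (simp add: p_def q_def)
qed

section \<open>Lebesgue points\<close>

abbreviation centered_cube :: "'a::euclidean_space \<Rightarrow> real \<Rightarrow> 'a set" where
  "centered_cube x r \<equiv> cbox (x - r *\<^sub>R One) (x + r *\<^sub>R One)"

lemma nn_integral_lborel_translate:
  fixes g :: "'a::euclidean_space \<Rightarrow> ennreal"
  assumes [measurable]: "g \<in> borel_measurable borel"
  shows "(\<integral>\<^sup>+s. g (w + s) \<partial>lborel) = (\<integral>\<^sup>+z. g z \<partial>lborel)"
proof -
  have "(\<integral>\<^sup>+z. g z \<partial>lborel) = (\<integral>\<^sup>+z. g z \<partial>distr lborel borel ((+) w))"
    by (simp add: lborel_distr_plus)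
  also have "\<dots> = (\<integral>\<^sup>+s. g (w + s) \<partial>lborel)" by (rule nn_integral_distr) auto
  finally show ?thesis ..
qed

lemma bounded_borel_integral_cbox:
  fixes G :: "'a::euclidean_space \<Rightarrow> real"
  assumes [measurable]: "G \<in> borel_measurable borel" and G0: "\<And>x. 0 \<le> G x" and GM: "\<And>x. G x \<le> M"
  shows "G integrable_on cbox u v"
    and "(\<integral>\<^sup>+y. ennreal (G y) * indicator (cbox u v) y \<partial>lborel) = ennreal (integral (cbox u v) G)"
proof -
  have M0: "0 \<le> M" using G0 GM order_trans by blast
  have "(\<integral>\<^sup>+y. ennreal (G y * indicator (cbox u v) y) \<partial>lborel) \<le> (\<integral>\<^sup>+y. ennreal M * indicator (cbox u v) y \<partial>lborel)"
    using GM by (intro nn_integral_mono) (auto simp: indicator_def ennreal_leI)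
  also have "\<dots> < \<infinity>" by (simp add: nn_integral_cmult emeasure_lborel_cbox_eq ennreal_mult_less_top)
  finally obtain r where r: "0 \<le> r" "(\<integral>\<^sup>+y. ennreal (G y * indicator (cbox u v) y) \<partial>lborel) = ennreal r"
    by (cases "\<integral>\<^sup>+y. ennreal (G y * indicator (cbox u v) y) \<partial>lborel" rule: ennreal_cases) auto
  then have "((\<lambda>y. G y * indicator (cbox u v) y) has_integral r) UNIV"
    using G0 by (intro nn_integral_has_integral) auto
  also have "(\<lambda>y. G y * indicator (cbox u v) y) = (\<lambda>y. if y \<in> cbox u v then G y else 0)" by auto
  finally have h: "(G has_integral r) (cbox u v)" by (simp only: has_integral_restrict_UNIV)
  then show "G integrable_on cbox u v" by blast
  have "(\<integral>\<^sup>+y. ennreal (G y) * indicator (cbox u v) y \<partial>lborel) = (\<integral>\<^sup>+y. ennreal (G y * indicator (cbox u v) y) \<partial>lborel)"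
    by (intro nn_integral_cong) (auto simp: indicator_def)
  then show "(\<integral>\<^sup>+y. ennreal (G y) * indicator (cbox u v) y \<partial>lborel) = ennreal (integral (cbox u v) G)"
    using r h by (simp add: integral_unique)
qed

text \<open>
  \<open>integrable_ccontinuous_explicit\<close> differentiates integrals over cubes that have the base point as
  their lowest corner. A cube centred at \<open>x\<close> consists of \<open>2\<^sup>n\<close> cubes with a corner at \<open>x\<close>,
  one per orthant, and reflecting some of the coordinates turns each of them into that shape.
\<close>

lemma centered_cube_average_le:
  fixes G :: "'a::euclidean_space \<Rightarrow> real"
  assumes [measurable]: "G \<in> borel_measurable borel" and G0: "\<And>x. 0 \<le> G x" and GM: "\<And>x. G x \<le> M"
  obtains N where "negligible N"
    "\<And>x e. x \<notin> N \<Longrightarrow> 0 < e \<Longrightarrow> \<exists>d>0. \<forall>r. 0 < r \<and> r < d \<longrightarrow>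
       (\<integral>\<^sup>+y. ennreal (G y) * indicator (centered_cube x r) y \<partial>lborel)
         \<le> ennreal (2 ^ DIM('a) * r ^ DIM('a) * (G x + e))"
proof -
  \<comment> \<open>\<open>T s\<close> reflects the coordinates in \<open>s\<close>.\<close>
  define c :: "'a set \<Rightarrow> 'a \<Rightarrow> real" where "c s j = (if j \<in> s then -1 else 1)" for s j
  define T :: "'a set \<Rightarrow> 'a \<Rightarrow> 'a" where "T s x = (\<Sum>j\<in>Basis. (c s j * (x \<bullet> j)) *\<^sub>R j)" for s x
  have Tj: "T s x \<bullet> j = c s j * (x \<bullet> j)" if "j \<in> Basis" for s x j
    using that by (simp add: T_def)
  have cc: "c s j * c s j = 1" for s j by (simp add: c_def)
  have TT: "T s (T s x) = x" for s x
    by (rule euclidean_eqI) (simp add: Tj mult.assoc[symmetric] cc)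
  have linT: "linear (T s)" for s
    unfolding T_def by (rule linearI) (simp_all add: algebra_simps sum.distrib scaleR_sum_right)
  have [measurable]: "T s \<in> borel_measurable borel" for s
    unfolding T_def by measurable
  have distr: "distr lborel borel (T s) = (lborel :: 'a measure)" for s
  proof -
    have "lborel = density (distr lborel borel (\<lambda>x. 0 + (\<Sum>j\<in>Basis. (c s j * (x \<bullet> j)) *\<^sub>R j))) (\<lambda>_. (\<Prod>j\<in>(Basis :: 'a set). \<bar>c s j\<bar>))"
      by (rule lborel_affine_euclidean) (simp add: c_def)
    moreover have "(\<Prod>j\<in>(Basis :: 'a set). \<bar>c s j\<bar>) = 1" by (rule prod.neutral) (simp add: c_def)
    ultimately show ?thesis by (simp add: density_1 T_def[abs_def])
  qed
  have "\<exists>N. negligible N \<and> (\<forall>x e. x \<notin> N \<and> 0 < e \<longrightarrow> (\<exists>d>0. \<forall>h. 0 < h \<and> h < d \<longrightarrow>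
          norm (integral (cube x h) (\<lambda>y. G (T s y)) /\<^sub>R h ^ DIM('a) - G (T s x)) < e))" for s
  proof -
    have "(\<lambda>y. G (T s y)) integrable_on cbox a b" for a b
      using bounded_borel_integral_cbox(1)[of "\<lambda>y. G (T s y)" M] G0 GM by auto
    from integrable_ccontinuous_explicit[OF this] show ?thesis by (metis (no_types, lifting))
  qed
  then obtain N where N: "\<And>s. negligible (N s)"
    "\<And>s x e. x \<notin> N s \<Longrightarrow> 0 < e \<Longrightarrow> \<exists>d>0. \<forall>h. 0 < h \<and> h < d \<longrightarrow>
          norm (integral (cube x h) (\<lambda>y. G (T s y)) /\<^sub>R h ^ DIM('a) - G (T s x)) < e"
    by metis
  define P where "P = Pow (Basis :: 'a set)"
  have finP: "finite P" "card P = 2 ^ DIM('a)" "P \<noteq> {}" by (auto simp: P_def card_Pow)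
  show ?thesis
  proof
    show "negligible (\<Union>s\<in>P. T s ` N s)"
    proof (rule negligible_Union)
      show "finite ((\<lambda>s. T s ` N s) ` P)" using finP by simp
      show "negligible t" if "t \<in> (\<lambda>s. T s ` N s) ` P" for t
        using that negligible_differentiable_image_negligible[OF order_refl N(1) linear_imp_differentiable_on[OF linT]]
        by auto
    qed
    fix x e assume x: "x \<notin> (\<Union>s\<in>P. T s ` N s)" and e: "0 < (e::real)"
    have "\<exists>d>0. \<forall>h. 0 < h \<and> h < d \<longrightarrow>
          norm (integral (cube (T s x) h) (\<lambda>y. G (T s y)) /\<^sub>R h ^ DIM('a) - G x) < e"
      if "s \<in> P" for s
    proof -
      have "T s x \<notin> N s" using x that TT by (metis UN_I image_eqI)
      from N(2)[OF this e] show ?thesis by (simp add: TT)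
    qed
    then obtain d where d: "\<And>s. s \<in> P \<Longrightarrow> d s > 0"
      "\<And>s h. s \<in> P \<Longrightarrow> 0 < h \<Longrightarrow> h < d s \<Longrightarrow>
        norm (integral (cube (T s x) h) (\<lambda>y. G (T s y)) /\<^sub>R h ^ DIM('a) - G x) < e"
      by metis
    show "\<exists>d>0. \<forall>r. 0 < r \<and> r < d \<longrightarrow>
       (\<integral>\<^sup>+y. ennreal (G y) * indicator (centered_cube x r) y \<partial>lborel)
         \<le> ennreal (2 ^ DIM('a) * r ^ DIM('a) * (G x + e))"
    proof (intro exI[of _ "Min (d ` P)"] conjI allI impI)
      show "0 < Min (d ` P)" using finP d(1) by simp
      fix r assume r: "0 < r \<and> r < Min (d ` P)"
      define C where "C s = cube (T s x) r" for s
      have one: "(\<integral>\<^sup>+y. ennreal (G y) * indicator (C s) (T s y) \<partial>lborel) \<le> ennreal (r ^ DIM('a) * (G x + e))"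
        if s: "s \<in> P" for s
      proof -
        have "(\<integral>\<^sup>+y. ennreal (G y) * indicator (C s) (T s y) \<partial>lborel)
            = (\<integral>\<^sup>+y. ennreal (G y) * indicator (C s) (T s y) \<partial>distr lborel borel (T s))"
          by (simp add: distr)
        also have "\<dots> = (\<integral>\<^sup>+z. ennreal (G (T s z)) * indicator (C s) (T s (T s z)) \<partial>lborel)"
          unfolding C_def by (rule nn_integral_distr) auto
        also have "\<dots> = ennreal (integral (C s) (\<lambda>z. G (T s z)))"
          unfolding TT C_def by (rule bounded_borel_integral_cbox(2)[of _ M]) (use G0 GM in auto)
        also have "\<dots> \<le> ennreal (r ^ DIM('a) * (G x + e))"
        proof (rule ennreal_leI)
          have "r < d s" using r s finP by simp
          then have "norm (integral (C s) (\<lambda>y. G (T s y)) /\<^sub>R r ^ DIM('a) - G x) < e"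
            unfolding C_def using d(2)[OF s] r by blast
          then have "integral (C s) (\<lambda>y. G (T s y)) / r ^ DIM('a) < G x + e" by (simp add: divide_inverse_commute)
          then show "integral (C s) (\<lambda>z. G (T s z)) \<le> r ^ DIM('a) * (G x + e)"
            using r by (simp add: pos_divide_less_eq mult.commute less_imp_le)
        qed
        finally show ?thesis .
      qed
      have "(\<integral>\<^sup>+y. ennreal (G y) * indicator (centered_cube x r) y \<partial>lborel)
         \<le> (\<integral>\<^sup>+y. (\<Sum>s\<in>P. ennreal (G y) * indicator (C s) (T s y)) \<partial>lborel)"
      proof (rule nn_integral_mono)
        fix y
        show "ennreal (G y) * indicator (centered_cube x r) y
          \<le> (\<Sum>s\<in>P. ennreal (G y) * indicator (C s) (T s y))"
        proof (cases "y \<in> centered_cube x r")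
          case True
          define s where "s = {j\<in>Basis. y \<bullet> j < x \<bullet> j}"
          have sP: "s \<in> P" by (auto simp: s_def P_def)
          have "T s y \<in> C s"
            using True unfolding C_def mem_box by (auto simp: Tj c_def s_def inner_add_left inner_diff_left)
          then have "ennreal (G y) \<le> ennreal (G y) * indicator (C s) (T s y)" by simp
          also have "\<dots> \<le> (\<Sum>s\<in>P. ennreal (G y) * indicator (C s) (T s y))"
            by (rule member_le_sum[OF sP]) (use finP in auto)
          finally show ?thesis using True by simp
        qed simp
      qed
      also have "\<dots> = (\<Sum>s\<in>P. \<integral>\<^sup>+y. ennreal (G y) * indicator (C s) (T s y) \<partial>lborel)"
        unfolding C_def by (rule nn_integral_sum) measurable
      also have "\<dots> \<le> (\<Sum>s\<in>P. ennreal (r ^ DIM('a) * (G x + e)))" by (rule sum_mono[OF one])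
      also have "\<dots> = ennreal (2 ^ DIM('a) * r ^ DIM('a) * (G x + e))"
        using r G0[of x] e finP by (simp add: ennreal_mult[symmetric] ennreal_of_nat_eq_real_of_nat mult.assoc)
      finally show "(\<integral>\<^sup>+y. ennreal (G y) * indicator (centered_cube x r) y \<partial>lborel)
         \<le> ennreal (2 ^ DIM('a) * r ^ DIM('a) * (G x + e))" .
    qed
  qed
qed

lemma emeasure_centered_cube:
  fixes x :: "'a::euclidean_space"
  assumes "0 \<le> r"
  shows "emeasure lborel (centered_cube x r) = ennreal ((2 * r) ^ DIM('a))"
proof -
  show ?thesis using assms by (simp add: emeasure_lborel_cbox_eq inner_add_left inner_diff_left)
qed

text \<open>
  Apply the previous bound to \<open>\<bar>D - q\<bar>\<close> for all rational \<open>q\<close>, and at a given \<open>x\<close> choose \<open>q\<close> close to \<open>D x\<close>.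
\<close>

lemma L1_lebesgue_points:
  fixes D :: "'a::euclidean_space \<Rightarrow> real"
  assumes [measurable]: "D \<in> borel_measurable borel" and DM: "\<And>x. \<bar>D x\<bar> \<le> M"
  obtains N where "negligible N"
    "\<And>x e. x \<notin> N \<Longrightarrow> 0 < e \<Longrightarrow> \<exists>d>0. \<forall>r. 0 < r \<and> r < d \<longrightarrow>
       (\<integral>\<^sup>+y. ennreal \<bar>D y - D x\<bar> * indicator (centered_cube x r) y \<partial>lborel)
         \<le> ennreal (e * r ^ DIM('a))"
proof -
  define P where "P q N \<longleftrightarrow> negligible N \<and> (\<forall>x e. x \<notin> N \<and> 0 < e \<longrightarrow> (\<exists>d>0. \<forall>r. 0 < r \<and> r < d \<longrightarrow>
       (\<integral>\<^sup>+y. ennreal \<bar>D y - q\<bar> * indicator (centered_cube x r) y \<partial>lborel)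
         \<le> ennreal (2 ^ DIM('a) * r ^ DIM('a) * (\<bar>D x - q\<bar> + e))))" for q N
  have "\<exists>N. P q N" for q
  proof -
    have "\<bar>D x - q\<bar> \<le> M + \<bar>q\<bar>" for x using DM[of x] by linarith
    note bd = this
    have meas: "(\<lambda>x. \<bar>D x - q\<bar>) \<in> borel_measurable borel" by measurable
    show ?thesis
    proof (rule centered_cube_average_le[OF meas abs_ge_zero bd])
      fix N assume "negligible N" and N: "\<And>x e. x \<notin> N \<Longrightarrow> 0 < e \<Longrightarrow> \<exists>d>0. \<forall>r. 0 < r \<and> r < d \<longrightarrow>
       (\<integral>\<^sup>+y. ennreal \<bar>D y - q\<bar> * indicator (centered_cube x r) y \<partial>lborel)
         \<le> ennreal (2 ^ DIM('a) * r ^ DIM('a) * (\<bar>D x - q\<bar> + e))"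
      show ?thesis unfolding P_def by (intro exI[of _ N] conjI allI impI, fact, elim conjE, rule N)
    qed
  qed
  then obtain N where PN: "\<And>q. P q (N q)" by metis
  have N1: "negligible (N q)" for q using PN unfolding P_def by blast
  show ?thesis
  proof
    show "negligible (\<Union>q\<in>\<rat>. N q)"
      by (rule negligible_countable_Union) (auto simp: countable_rat N1)
    fix x e assume x: "x \<notin> (\<Union>q\<in>\<rat>. N q)" and e: "0 < (e::real)"
    define e' where "e' = e / (3 * 2 ^ DIM('a))"
    have e': "e' > 0" using e by (simp add: e'_def)
    obtain q where q: "q \<in> \<rat>" "D x - e' < q" "q < D x" using Rats_dense_in_real[of "D x - e'" "D x"] e' by auto
    then have qx: "\<bar>D x - q\<bar> \<le> e'" "\<bar>q - D x\<bar> \<le> e'" by auto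
    have "x \<notin> N q" using x q(1) by blast
    then have "\<exists>d>0. \<forall>r. 0 < r \<and> r < d \<longrightarrow>
       (\<integral>\<^sup>+y. ennreal \<bar>D y - q\<bar> * indicator (centered_cube x r) y \<partial>lborel)
         \<le> ennreal (2 ^ DIM('a) * r ^ DIM('a) * (\<bar>D x - q\<bar> + e'))"
      using PN[of q] e' unfolding P_def by blast
    then obtain d where d: "d > 0" "\<forall>r. 0 < r \<and> r < d \<longrightarrow>
       (\<integral>\<^sup>+y. ennreal \<bar>D y - q\<bar> * indicator (centered_cube x r) y \<partial>lborel)
         \<le> ennreal (2 ^ DIM('a) * r ^ DIM('a) * (\<bar>D x - q\<bar> + e'))" by blast
    show "\<exists>d>0. \<forall>r. 0 < r \<and> r < d \<longrightarrow>
       (\<integral>\<^sup>+y. ennreal \<bar>D y - D x\<bar> * indicator (centered_cube x r) y \<partial>lborel)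
         \<le> ennreal (e * r ^ DIM('a))"
    proof (intro exI[of _ d] conjI allI impI d(1))
      fix r assume r: "0 < r \<and> r < d"
      let ?I = "\<lambda>y. indicator (centered_cube x r) y :: ennreal"
      have "(\<integral>\<^sup>+y. ennreal \<bar>D y - D x\<bar> * ?I y \<partial>lborel)
         \<le> (\<integral>\<^sup>+y. ennreal \<bar>D y - q\<bar> * ?I y + ennreal e' * ?I y \<partial>lborel)"
      proof (rule nn_integral_mono)
        fix y
        have "\<bar>D y - D x\<bar> \<le> \<bar>D y - q\<bar> + e'" using qx by linarith
        then have "ennreal \<bar>D y - D x\<bar> \<le> ennreal \<bar>D y - q\<bar> + ennreal e'"
          using e' by (metis abs_ge_zero ennreal_leI ennreal_plus less_imp_le)
        then show "ennreal \<bar>D y - D x\<bar> * ?I y \<le> ennreal \<bar>D y - q\<bar> * ?I y + ennreal e' * ?I y"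
          by (auto simp: indicator_def)
      qed
      also have "\<dots> = (\<integral>\<^sup>+y. ennreal \<bar>D y - q\<bar> * ?I y \<partial>lborel) + (\<integral>\<^sup>+y. ennreal e' * ?I y \<partial>lborel)"
        by (rule nn_integral_add) auto
      also have "(\<integral>\<^sup>+y. ennreal e' * ?I y \<partial>lborel) = ennreal e' * ennreal ((2 * r) ^ DIM('a))"
        using r by (simp add: nn_integral_cmult emeasure_centered_cube)
      also have "(\<integral>\<^sup>+y. ennreal \<bar>D y - q\<bar> * ?I y \<partial>lborel) + ennreal e' * ennreal ((2 * r) ^ DIM('a))
         \<le> ennreal (2 ^ DIM('a) * r ^ DIM('a) * (\<bar>D x - q\<bar> + e')) + ennreal (e' * (2 * r) ^ DIM('a))"
        using d(2)[rule_format, OF r] r e' by (intro add_mono) (auto simp: ennreal_mult[symmetric])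
      also have "\<dots> = ennreal (2 ^ DIM('a) * r ^ DIM('a) * (\<bar>D x - q\<bar> + e') + e' * (2 * r) ^ DIM('a))"
        using e' r by (intro ennreal_plus[symmetric]) auto
      also have "\<dots> \<le> ennreal (e * r ^ DIM('a))"
      proof (rule ennreal_leI)
        have "2 ^ DIM('a) * r ^ DIM('a) * (\<bar>D x - q\<bar> + e') \<le> 2 ^ DIM('a) * r ^ DIM('a) * (e' + e')"
          using qx r by (intro mult_left_mono) auto
        moreover have "e = 3 * 2 ^ DIM('a) * e'" by (simp add: e'_def)
        ultimately show "2 ^ DIM('a) * r ^ DIM('a) * (\<bar>D x - q\<bar> + e') + e' * (2 * r) ^ DIM('a) \<le> e * r ^ DIM('a)"
          by (simp add: power_mult_distrib algebra_simps)
      qed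
      finally show "(\<integral>\<^sup>+y. ennreal \<bar>D y - D x\<bar> * ?I y \<partial>lborel) \<le> ennreal (e * r ^ DIM('a))" .
    qed
  qed
qed

text \<open>
  The increment over \<open>t\<close> is telescoped along the coordinates; the induction over the set \<open>F\<close> of
  coordinates already used spares an enumeration of the basis. In each step, averaging over \<open>s\<close> turns
  a line integral into a volume integral over a region inside the cube of radius \<open>2\<rho>\<close> about \<open>x\<close>.
\<close>

lemma averaged_increment_le:
  fixes f :: "'a::euclidean_space \<Rightarrow> real" and a :: "'a \<Rightarrow> real"
  assumes f: "L-lipschitz_on UNIV f" and "0 \<le> \<sigma>" "\<sigma> \<le> \<rho>" and t: "\<And>i. i \<in> Basis \<Longrightarrow> \<bar>t \<bullet> i\<bar> \<le> \<rho>"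
    and F: "F \<subseteq> Basis"
  shows "(\<integral>\<^sup>+s. ennreal \<bar>f (x + s + (\<Sum>i\<in>F. (t \<bullet> i) *\<^sub>R i)) - f (x + s) - (\<Sum>i\<in>F. a i * (t \<bullet> i))\<bar>
            * indicator (cbox 0 (\<sigma> *\<^sub>R One)) s \<partial>lborel)
     \<le> (\<Sum>i\<in>F. ennreal \<rho> * (\<integral>\<^sup>+y. ennreal \<bar>forward_derivative f i y - a i\<bar>
            * indicator (centered_cube x (2 * \<rho>)) y \<partial>lborel))"
  using finite_subset[OF F finite_Basis] F
proof (induction F rule: finite_induct)
  case empty
  then show ?case by simp
next
  case (insert j F)
  then have j: "j \<in> Basis" and F: "F \<subseteq> Basis" by auto
  have contf: "continuous_on UNIV f" using f lipschitz_on_continuous_on by blast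
  have [measurable]: "f \<in> borel_measurable borel" using contf by (rule borel_measurable_continuous_onI)
  have [measurable]: "forward_derivative f j \<in> borel_measurable borel" by (rule measurable_forward_derivative[OF f])
  define w where "w = (\<Sum>i\<in>F. (t \<bullet> i) *\<^sub>R i)"
  define b where "b = (\<Sum>i\<in>F. a i * (t \<bullet> i))"
  define lo where "lo = min 0 (t \<bullet> j)"
  define hi where "hi = max 0 (t \<bullet> j)"
  define D where "D y = ennreal \<bar>forward_derivative f j y - a j\<bar>" for y
  have [measurable]: "D \<in> borel_measurable borel" unfolding D_def by measurable
  define I where "I = (\<integral>\<^sup>+y. D y * indicator (centered_cube x (2 * \<rho>)) y \<partial>lborel)"
  let ?Q = "\<lambda>s. indicator (cbox 0 (\<sigma> *\<^sub>R One)) s :: ennreal"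
  have step: "ennreal \<bar>f (x + s + w + (t \<bullet> j) *\<^sub>R j) - f (x + s + w) - a j * (t \<bullet> j)\<bar>
      \<le> (\<integral>\<^sup>+\<tau>. D (x + s + w + \<tau> *\<^sub>R j) * indicator {lo..hi} \<tau> \<partial>lborel)" for s
  proof -
    have "\<bar>f (x + s + w + (t \<bullet> j) *\<^sub>R j) - f (x + s + w) - a j * (t \<bullet> j)\<bar>
        = \<bar>f (x + s + w + hi *\<^sub>R j) - f (x + s + w + lo *\<^sub>R j) - a j * (hi - lo)\<bar>"
      by (cases "0 \<le> t \<bullet> j") (auto simp: lo_def hi_def)
    moreover have "lo \<le> hi" by (simp add: lo_def hi_def)
    ultimately show ?thesis
      using lipschitz_increment_le_nn_integral[OF f \<open>lo \<le> hi\<close>, of "x + s + w" j "a j"] by (simp only: D_def)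
  qed
  have box: "z \<in> centered_cube x (2 * \<rho>)"
    if s: "s \<in> cbox 0 (\<sigma> *\<^sub>R One)" and \<tau>: "\<tau> \<in> {lo..hi}" and z: "z = x + s + w + \<tau> *\<^sub>R j" for s \<tau> z
    unfolding mem_box
  proof
    fix i :: 'a assume i: "i \<in> Basis"
    have wi: "w \<bullet> i = (if i \<in> F then t \<bullet> i else 0)"
    proof -
      have "w \<bullet> i = (\<Sum>k\<in>F. if k = i then t \<bullet> k else 0)"
        unfolding w_def inner_sum_left
        by (rule sum.cong) (use F i in \<open>auto simp: inner_Basis\<close>)
      then show ?thesis using insert(1) by (simp add: sum.delta')
    qed
    have "0 \<le> s \<bullet> i \<and> s \<bullet> i \<le> \<sigma>" using s i by (auto simp: mem_box)
    moreover have "\<bar>w \<bullet> i + \<tau> * (j \<bullet> i)\<bar> \<le> \<rho>"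
    proof (cases "i = j")
      case True
      have "\<bar>\<tau>\<bar> \<le> \<bar>t \<bullet> j\<bar>" using \<tau> by (auto simp: lo_def hi_def)
      then show ?thesis using True wi insert(2) j t[OF j] by auto
    next
      case False
      have "0 \<le> \<rho>" using assms by linarith
      then show ?thesis using False wi i j t[OF i] by (auto simp: inner_Basis)
    qed
    ultimately show "(x - (2 * \<rho>) *\<^sub>R One) \<bullet> i \<le> z \<bullet> i \<and> z \<bullet> i \<le> (x + (2 * \<rho>) *\<^sub>R One) \<bullet> i"
      using \<open>\<sigma> \<le> \<rho>\<close> i unfolding z by (simp add: inner_add_left inner_diff_left abs_le_iff)
  qed
  have meas2: "(\<lambda>(s, \<tau>). D (x + s + w + \<tau> *\<^sub>R j) * indicator {lo..hi} \<tau> * ?Q s) \<in> borel_measurable (lborel \<Otimes>\<^sub>M lborel)"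
    by measurable
  have "(\<integral>\<^sup>+s. ennreal \<bar>f (x + s + w + (t \<bullet> j) *\<^sub>R j) - f (x + s + w) - a j * (t \<bullet> j)\<bar> * ?Q s \<partial>lborel)
     \<le> (\<integral>\<^sup>+s. (\<integral>\<^sup>+\<tau>. D (x + s + w + \<tau> *\<^sub>R j) * indicator {lo..hi} \<tau> \<partial>lborel) * ?Q s \<partial>lborel)"
    by (intro nn_integral_mono mult_right_mono step) auto
  also have "\<dots> = (\<integral>\<^sup>+s. (\<integral>\<^sup>+\<tau>. D (x + s + w + \<tau> *\<^sub>R j) * indicator {lo..hi} \<tau> * ?Q s \<partial>lborel) \<partial>lborel)"
    by (intro nn_integral_cong nn_integral_multc[symmetric]) measurable
  also have "\<dots> = (\<integral>\<^sup>+\<tau>. (\<integral>\<^sup>+s. D (x + s + w + \<tau> *\<^sub>R j) * indicator {lo..hi} \<tau> * ?Q s \<partial>lborel) \<partial>lborel)"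
    using lborel_pair.Fubini'[OF meas2] by simp
  also have "\<dots> \<le> (\<integral>\<^sup>+\<tau>. I * indicator {lo..hi} \<tau> \<partial>lborel)"
  proof (rule nn_integral_mono)
    fix \<tau>
    show "(\<integral>\<^sup>+s. D (x + s + w + \<tau> *\<^sub>R j) * indicator {lo..hi} \<tau> * ?Q s \<partial>lborel) \<le> I * indicator {lo..hi} \<tau>"
    proof (cases "\<tau> \<in> {lo..hi}")
      case True
      let ?w = "x + w + \<tau> *\<^sub>R j"
      have "(\<integral>\<^sup>+s. D (x + s + w + \<tau> *\<^sub>R j) * indicator {lo..hi} \<tau> * ?Q s \<partial>lborel)
         \<le> (\<integral>\<^sup>+s. D (?w + s) * indicator (centered_cube x (2 * \<rho>)) (?w + s) \<partial>lborel)"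
      proof (rule nn_integral_mono)
        fix s
        have e: "x + s + w + \<tau> *\<^sub>R j = ?w + s" by simp
        show "D (x + s + w + \<tau> *\<^sub>R j) * indicator {lo..hi} \<tau> * ?Q s
          \<le> D (?w + s) * indicator (centered_cube x (2 * \<rho>)) (?w + s)"
        proof (cases "s \<in> cbox 0 (\<sigma> *\<^sub>R One)")
          case s: True
          have "?w + s \<in> centered_cube x (2 * \<rho>)"
            by (rule box[OF s True]) simp
          then show ?thesis using True s unfolding e by simp
        qed simp
      qed
      also have "\<dots> = I" unfolding I_def
        by (rule nn_integral_lborel_translate[where g = "\<lambda>y. D y * indicator (centered_cube x (2 * \<rho>)) y"]) measurable
      finally show ?thesis using True by simp
    qed simp
  qed
  also have "\<dots> = ennreal \<bar>t \<bullet> j\<bar> * I"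
    by (simp add: nn_integral_cmult_indicator lo_def hi_def mult.commute min_def max_def)
  also have "\<dots> \<le> ennreal \<rho> * I" using t[OF j] by (intro mult_right_mono ennreal_leI) auto
  finally have new: "(\<integral>\<^sup>+s. ennreal \<bar>f (x + s + w + (t \<bullet> j) *\<^sub>R j) - f (x + s + w) - a j * (t \<bullet> j)\<bar> * ?Q s \<partial>lborel) \<le> ennreal \<rho> * I" .
  have "(\<integral>\<^sup>+s. ennreal \<bar>f (x + s + (\<Sum>i\<in>insert j F. (t \<bullet> i) *\<^sub>R i)) - f (x + s) - (\<Sum>i\<in>insert j F. a i * (t \<bullet> i))\<bar> * ?Q s \<partial>lborel)
     \<le> (\<integral>\<^sup>+s. ennreal \<bar>f (x + s + w + (t \<bullet> j) *\<^sub>R j) - f (x + s + w) - a j * (t \<bullet> j)\<bar> * ?Q s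
            + ennreal \<bar>f (x + s + w) - f (x + s) - b\<bar> * ?Q s \<partial>lborel)"
  proof (rule nn_integral_mono)
    fix s
    have e: "x + s + (\<Sum>i\<in>insert j F. (t \<bullet> i) *\<^sub>R i) = x + s + w + (t \<bullet> j) *\<^sub>R j"
      using insert(1,2) by (simp add: w_def)
    have e2: "(\<Sum>i\<in>insert j F. a i * (t \<bullet> i)) = a j * (t \<bullet> j) + b" using insert(1,2) by (simp add: b_def)
    have "ennreal \<bar>f (x + s + w + (t \<bullet> j) *\<^sub>R j) - f (x + s) - (a j * (t \<bullet> j) + b)\<bar>
      \<le> ennreal (\<bar>f (x + s + w + (t \<bullet> j) *\<^sub>R j) - f (x + s + w) - a j * (t \<bullet> j)\<bar> + \<bar>f (x + s + w) - f (x + s) - b\<bar>)"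
      by (rule ennreal_leI) linarith
    then show "ennreal \<bar>f (x + s + (\<Sum>i\<in>insert j F. (t \<bullet> i) *\<^sub>R i)) - f (x + s) - (\<Sum>i\<in>insert j F. a i * (t \<bullet> i))\<bar> * ?Q s
      \<le> ennreal \<bar>f (x + s + w + (t \<bullet> j) *\<^sub>R j) - f (x + s + w) - a j * (t \<bullet> j)\<bar> * ?Q s
            + ennreal \<bar>f (x + s + w) - f (x + s) - b\<bar> * ?Q s"
      unfolding e e2 by (auto simp: indicator_def)
  qed
  also have "\<dots> = (\<integral>\<^sup>+s. ennreal \<bar>f (x + s + w + (t \<bullet> j) *\<^sub>R j) - f (x + s + w) - a j * (t \<bullet> j)\<bar> * ?Q s \<partial>lborel)
            + (\<integral>\<^sup>+s. ennreal \<bar>f (x + s + w) - f (x + s) - b\<bar> * ?Q s \<partial>lborel)"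
    by (rule nn_integral_add) measurable
  also have "\<dots> \<le> ennreal \<rho> * I + (\<Sum>i\<in>F. ennreal \<rho> * (\<integral>\<^sup>+y. ennreal \<bar>forward_derivative f i y - a i\<bar>
            * indicator (centered_cube x (2 * \<rho>)) y \<partial>lborel))"
    using new insert.IH[OF F] unfolding w_def b_def by (rule add_mono)
  also have "\<dots> = (\<Sum>i\<in>insert j F. ennreal \<rho> * (\<integral>\<^sup>+y. ennreal \<bar>forward_derivative f i y - a i\<bar>
            * indicator (centered_cube x (2 * \<rho>)) y \<partial>lborel))"
    using insert(1,2) by (simp add: I_def D_def)
  finally show ?case .
qed

section \<open>Rademacher's theorem\<close>

text \<open>
  Let \<open>x\<close> be a Lebesgue point of all partial derivatives and \<open>a\<close> the vector of their values there. For
  \<open>norm t = \<rho>\<close>, the averages over \<open>s\<close> in a cube of side \<open>\<sigma> = \<eta>\<rho>\<close> of \<open>f (x+s+t) - f (x+s) - a \<bullet> t\<close> are \<open>o(\<rho>)\<close> for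
  fixed \<open>\<eta>\<close>, while dropping \<open>s\<close> costs \<open>O(L\<eta>\<rho>)\<close>. The constant \<open>\<kappa>\<close> is the accuracy required at the
  Lebesgue point: the volume of the averaging cube is only \<open>(\<eta>/4)\<^sup>n\<close> times that of the cube of radius \<open>2\<rho>\<close>.
\<close>

theorem rademacher_real:
  fixes f :: "'a::euclidean_space \<Rightarrow> real"
  assumes f: "L-lipschitz_on UNIV f"
  shows "negligible {x. \<not> f differentiable (at x)}"
proof -
  define n where "n = DIM('a)"
  have n: "n \<ge> 1" by (simp add: n_def Suc_leI)
  have L0: "0 \<le> L" using f lipschitz_on_nonneg by blast
  define I where "I i x r = (\<integral>\<^sup>+y. ennreal \<bar>forward_derivative f i y - forward_derivative f i x\<bar>
       * indicator (centered_cube x r) y \<partial>lborel)" for i x r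
  define P where "P i N \<longleftrightarrow> negligible N \<and>
    (\<forall>x e. x \<notin> N \<and> 0 < e \<longrightarrow> (\<exists>d>0. \<forall>r. 0 < r \<and> r < d \<longrightarrow> I i x r \<le> ennreal (e * r ^ n)))" for i N
  have "\<exists>N. P i N" for i
  proof (rule L1_lebesgue_points[OF measurable_forward_derivative[OF f] abs_forward_derivative_le[OF f], of i])
    fix N assume "negligible N" and N: "\<And>x e. x \<notin> N \<Longrightarrow> 0 < e \<Longrightarrow> \<exists>d>0. \<forall>r. 0 < r \<and> r < d \<longrightarrow>
       (\<integral>\<^sup>+y. ennreal \<bar>forward_derivative f i y - forward_derivative f i x\<bar>
         * indicator (centered_cube x r) y \<partial>lborel) \<le> ennreal (e * r ^ DIM('a))"
    show ?thesis unfolding P_def I_def n_def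
      by (intro exI[of _ N] conjI allI impI, fact, elim conjE, rule N)
  qed
  then obtain N where PN: "\<And>i. P i (N i)" by metis
  have "f differentiable (at x)" if x: "x \<notin> (\<Union>i\<in>Basis. N i)" for x
  proof -
    define a where "a i = forward_derivative f i x" for i
    define f' where "f' t = (\<Sum>i\<in>Basis. a i * (t \<bullet> i))" for t
    have "(f has_derivative f') (at x)"
      unfolding has_derivative_at_alt
    proof (intro conjI allI impI)
      show "bounded_linear f'" unfolding f'_def
        by (intro bounded_linear_sum bounded_linear_const_mult bounded_linear_inner_left)
      fix e :: real assume e: "0 < e"
      define \<eta> where "\<eta> = min 1 (e / (4 * L * n + 4))"
      have \<eta>: "0 < \<eta>" "\<eta> \<le> 1" using e L0 by (auto simp: \<eta>_def add_nonneg_pos)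
      have \<eta>2: "2 * L * n * \<eta> \<le> e / 2"
      proof -
        have "2 * L * n * \<eta> \<le> 2 * L * n * (e / (4 * L * n + 4))"
          using L0 by (intro mult_left_mono) (auto simp: \<eta>_def)
        also have "\<dots> = (e / 2) * (4 * L * n / (4 * L * n + 4))" by simp
        also have "\<dots> \<le> (e / 2) * 1"
          using e L0 by (intro mult_left_mono) (auto simp: divide_le_eq add_nonneg_pos)
        finally show ?thesis by simp
      qed
      define \<kappa> where "\<kappa> = e * \<eta> ^ n / (2 * n * 2 ^ n)"
      have \<kappa>: "\<kappa> > 0" using e \<eta> n by (simp add: \<kappa>_def)
      have "\<exists>d>0. \<forall>r. 0 < r \<and> r < d \<longrightarrow> I i x r \<le> ennreal (\<kappa> * r ^ n)" if "i \<in> Basis" for i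
        using PN[of i] x that \<kappa> unfolding P_def by blast
      then obtain d where d: "\<And>i. i \<in> Basis \<Longrightarrow> d i > 0"
        "\<And>i r. i \<in> Basis \<Longrightarrow> 0 < r \<Longrightarrow> r < d i \<Longrightarrow> I i x r \<le> ennreal (\<kappa> * r ^ n)" by metis
      define \<delta> where "\<delta> = Min (d ` Basis) / 2"
      have \<delta>0: "\<delta> > 0" using d(1) by (simp add: \<delta>_def)
      have \<delta>1: "2 * \<rho> < d i" if "\<rho> < \<delta>" "i \<in> Basis" for \<rho> i
      proof -
        have "Min (d ` Basis) \<le> d i" by (rule Min_le) (use that in auto)
        moreover have "2 * \<rho> < Min (d ` Basis)" using that(1) unfolding \<delta>_def by linarith
        ultimately show ?thesis by linarith
      qed
      have "norm (f y - f x - f' (y - x)) \<le> e * norm (y - x)" if y: "norm (y - x) < \<delta>" for y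
      proof (cases "y = x")
        case True
        then show ?thesis by (simp add: f'_def)
      next
        case False
        define t where "t = y - x"
        define \<rho> where "\<rho> = norm t"
        define \<sigma> where "\<sigma> = \<eta> * \<rho>"
        have \<rho>: "0 < \<rho>" "\<rho> < \<delta>" using False y by (auto simp: \<rho>_def t_def)
        have \<sigma>: "0 < \<sigma>" "\<sigma> \<le> \<rho>" using \<eta> \<rho> by (auto simp: \<sigma>_def mult_le_cancel_right1)
        define E where "E = f (x + t) - f x - f' t"
        let ?Q = "\<lambda>s::'a. indicator (cbox 0 (\<sigma> *\<^sub>R One)) s :: ennreal"
        have Qm: "emeasure lborel (cbox 0 (\<sigma> *\<^sub>R One) :: 'a set) = ennreal (\<sigma> ^ n)"
          using \<sigma> by (simp add: emeasure_lborel_cbox_eq n_def)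
        have tsum: "(\<Sum>i\<in>Basis. (t \<bullet> i) *\<^sub>R i) = t" by (rule euclidean_representation)
        define J where "J = (\<integral>\<^sup>+s. ennreal \<bar>f (x + s + t) - f (x + s) - f' t\<bar> * ?Q s \<partial>lborel)"
        have "J \<le> (\<Sum>i\<in>Basis. ennreal \<rho> * I i x (2 * \<rho>))"
          using averaged_increment_le[OF f, of \<sigma> \<rho> t Basis x a] \<sigma> Basis_le_norm[of _ t]
          unfolding J_def I_def tsum a_def[symmetric] f'_def \<rho>_def by simp
        also have "\<dots> \<le> (\<Sum>i\<in>(Basis::'a set). ennreal \<rho> * ennreal (\<kappa> * (2 * \<rho>) ^ n))"
        proof (intro sum_mono mult_left_mono)
          show "I i x (2 * \<rho>) \<le> ennreal (\<kappa> * (2 * \<rho>) ^ n)" if i: "i \<in> Basis" for i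
            by (rule d(2)[OF i _ \<delta>1[OF \<rho>(2) i]]) (use \<rho> in simp)
        qed simp
        also have "\<dots> = ennreal (n * \<rho> * \<kappa> * (2 * \<rho>) ^ n)"
          using \<rho> \<kappa> by (simp add: n_def[symmetric] ennreal_mult[symmetric] ennreal_of_nat_eq_real_of_nat mult.assoc)
        finally have J: "J \<le> ennreal (n * \<rho> * \<kappa> * (2 * \<rho>) ^ n)" .
        have contf: "continuous_on UNIV f" using f lipschitz_on_continuous_on by blast
        have [measurable]: "f \<in> borel_measurable borel" using contf by (rule borel_measurable_continuous_onI)
        have "ennreal (\<bar>E\<bar> * \<sigma> ^ n) = (\<integral>\<^sup>+s. ennreal \<bar>E\<bar> * ?Q s \<partial>lborel)"
          using \<sigma> by (simp add: nn_integral_cmult Qm ennreal_mult)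
        also have "\<dots> \<le> (\<integral>\<^sup>+s. ennreal \<bar>f (x + s + t) - f (x + s) - f' t\<bar> * ?Q s + ennreal (2 * L * (n * \<sigma>)) * ?Q s \<partial>lborel)"
        proof (rule nn_integral_mono)
          fix s
          show "ennreal \<bar>E\<bar> * ?Q s \<le> ennreal \<bar>f (x + s + t) - f (x + s) - f' t\<bar> * ?Q s + ennreal (2 * L * (n * \<sigma>)) * ?Q s"
          proof (cases "s \<in> cbox 0 (\<sigma> *\<^sub>R One)")
            case True
            have "norm s \<le> (\<Sum>i\<in>Basis. \<bar>s \<bullet> i\<bar>)" by (rule norm_le_l1)
            also have "\<dots> \<le> (\<Sum>i\<in>(Basis::'a set). \<sigma>)" using True by (intro sum_mono) (auto simp: mem_box)
            finally have ns: "norm s \<le> n * \<sigma>" by (simp add: n_def)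
            have "\<bar>f (x + s + t) - f (x + t)\<bar> \<le> L * norm s"
              using lipschitz_on_normD[OF f, of "x + s + t" "x + t"] by simp
            moreover have "\<bar>f (x + s) - f x\<bar> \<le> L * norm s"
              using lipschitz_on_normD[OF f, of "x + s" x] by simp
            moreover have "L * norm s \<le> L * (n * \<sigma>)" using ns L0 by (rule mult_left_mono)
            ultimately have "\<bar>E\<bar> \<le> \<bar>f (x + s + t) - f (x + s) - f' t\<bar> + 2 * L * (n * \<sigma>)"
              unfolding E_def by linarith
            then have "ennreal \<bar>E\<bar> \<le> ennreal (\<bar>f (x + s + t) - f (x + s) - f' t\<bar> + 2 * L * (n * \<sigma>))"
              by (rule ennreal_leI)
            also have "\<dots> = ennreal \<bar>f (x + s + t) - f (x + s) - f' t\<bar> + ennreal (2 * L * (n * \<sigma>))"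
              using L0 \<sigma> by (intro ennreal_plus) auto
            finally show ?thesis using True by simp
          qed simp
        qed
        also have "\<dots> = J + (\<integral>\<^sup>+s. ennreal (2 * L * (n * \<sigma>)) * ?Q s \<partial>lborel)"
          unfolding J_def by (rule nn_integral_add) measurable
        also have "(\<integral>\<^sup>+s. ennreal (2 * L * (n * \<sigma>)) * ?Q s \<partial>lborel) = ennreal (2 * L * (n * \<sigma>) * \<sigma> ^ n)"
          using \<sigma> L0 by (simp add: nn_integral_cmult Qm ennreal_mult)
        also have "J + \<dots> \<le> ennreal (n * \<rho> * \<kappa> * (2 * \<rho>) ^ n) + ennreal (2 * L * (n * \<sigma>) * \<sigma> ^ n)"
          by (rule add_right_mono[OF J])
        also have "\<dots> = ennreal (n * \<rho> * \<kappa> * (2 * \<rho>) ^ n + 2 * L * (n * \<sigma>) * \<sigma> ^ n)"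
          using \<rho> \<sigma> \<kappa> L0 by (intro ennreal_plus[symmetric]) auto
        finally have "\<bar>E\<bar> * \<sigma> ^ n \<le> n * \<rho> * \<kappa> * (2 * \<rho>) ^ n + 2 * L * (n * \<sigma>) * \<sigma> ^ n"
          using \<rho> \<sigma> \<kappa> L0 by (subst (asm) ennreal_le_iff) auto
        also have "n * \<rho> * \<kappa> * (2 * \<rho>) ^ n = (e / 2 * \<rho>) * \<sigma> ^ n"
          using n by (simp add: \<kappa>_def \<sigma>_def power_mult_distrib field_simps)
        also have "2 * L * (n * \<sigma>) * \<sigma> ^ n \<le> (e / 2 * \<rho>) * \<sigma> ^ n"
        proof (rule mult_right_mono)
          have "2 * L * (n * \<sigma>) = (2 * L * n * \<eta>) * \<rho>" by (simp add: \<sigma>_def)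
          also have "\<dots> \<le> e / 2 * \<rho>" using \<eta>2 \<rho> by (intro mult_right_mono) auto
          finally show "2 * L * (n * \<sigma>) \<le> e / 2 * \<rho>" .
        qed (use \<sigma> in auto)
        finally have "\<bar>E\<bar> * \<sigma> ^ n \<le> (e * \<rho>) * \<sigma> ^ n" by (simp add: field_simps)
        then have "\<bar>E\<bar> \<le> e * \<rho>" using \<sigma> by (simp add: mult_le_cancel_right)
        then show ?thesis by (simp add: E_def t_def \<rho>_def)
      qed
      then show "\<exists>d>0. \<forall>y. norm (y - x) < d \<longrightarrow> norm (f y - f x - f' (y - x)) \<le> e * norm (y - x)"
        using \<delta>0 by blast
    qed
    then show ?thesis unfolding differentiable_def by (intro exI[of _ f'])
  qed
  then have "{x. \<not> f differentiable (at x)} \<subseteq> (\<Union>i\<in>Basis. N i)" by blast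
  moreover have "negligible (\<Union>i\<in>(Basis::'a set). N i)"
  proof (rule negligible_Union)
    show "negligible t" if "t \<in> N ` Basis" for t using that PN unfolding P_def by blast
  qed simp
  ultimately show ?thesis by (rule negligible_subset[rotated])
qed

text \<open>
  McShane's extension: the largest \<open>L\<close>-Lipschitz function not above \<open>f\<close> on \<open>K\<close>.
\<close>

lemma lipschitz_extension_real:
  fixes f :: "'a::metric_space \<Rightarrow> real"
  assumes f: "L-lipschitz_on K f"
  obtains g where "L-lipschitz_on UNIV g" "\<And>x. x \<in> K \<Longrightarrow> g x = f x"
proof (cases "K = {}")
  case True
  have "L-lipschitz_on UNIV (\<lambda>_::'a. 0::real)" using lipschitz_on_nonneg[OF f] by (intro lipschitz_onI) auto
  then show ?thesis by (rule that) (use True in auto)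
next
  case False
  have L0: "0 \<le> L" using f lipschitz_on_nonneg by blast
  define g where "g x = (INF a\<in>K. f a + L * dist x a)" for x
  have lip: "f a \<le> f b + L * dist a b" if "a \<in> K" "b \<in> K" for a b
    using lipschitz_onD[OF f that] by (simp add: dist_real_def)
  have bdd: "bdd_below ((\<lambda>a. f a + L * dist x a) ` K)" for x
  proof -
    obtain b where b: "b \<in> K" using False by blast
    have "f b - L * dist x b \<le> f a + L * dist x a" if "a \<in> K" for a
    proof -
      have "L * dist b a \<le> L * (dist x b + dist x a)"
        using L0 dist_triangle3[of b a x] by (intro mult_left_mono) auto
      then show ?thesis using lip[OF b that] by (simp add: algebra_simps)
    qed
    then show ?thesis by (intro bdd_belowI2)
  qed
  have le: "g x \<le> g y + L * dist x y" for x y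
  proof -
    have "g x - L * dist x y \<le> f a + L * dist y a" if "a \<in> K" for a
    proof -
      have "g x \<le> f a + L * dist x a" unfolding g_def by (rule cINF_lower[OF bdd that])
      also have "L * dist x a \<le> L * (dist x y + dist y a)" using L0 dist_triangle by (intro mult_left_mono) auto
      finally show ?thesis by (simp add: algebra_simps)
    qed
    then have "g x - L * dist x y \<le> g y" unfolding g_def[of y] using False by (intro cINF_greatest) auto
    then show ?thesis by simp
  qed
  show ?thesis
  proof (rule that)
    show "L-lipschitz_on UNIV g"
    proof (rule lipschitz_onI)
      fix x y
      show "dist (g x) (g y) \<le> L * dist x y"
        using le[of x y] le[of y x] by (simp add: dist_real_def dist_commute abs_le_iff)
    qed (rule L0)
    fix x assume x: "x \<in> K"
    have "g x \<le> f x + L * dist x x" unfolding g_def by (rule cINF_lower[OF bdd x])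
    moreover have "f x \<le> g x" unfolding g_def using False lip[OF x] by (intro cINF_greatest) auto
    ultimately show "g x = f x" by simp
  qed
qed

lemma lipschitz_on_component:
  fixes f :: "'a::metric_space \<Rightarrow> 'b::euclidean_space"
  assumes f: "L-lipschitz_on K f" and b: "b \<in> Basis"
  shows "L-lipschitz_on K (\<lambda>x. f x \<bullet> b)"
proof (rule lipschitz_onI)
  fix x y assume xy: "x \<in> K" "y \<in> K"
  have "dist (f x \<bullet> b) (f y \<bullet> b) \<le> dist (f x) (f y)"
    using Basis_le_norm[OF b, of "f x - f y"] by (simp add: dist_norm inner_diff_left)
  also have "\<dots> \<le> L * dist x y" by (rule lipschitz_onD[OF f xy])
  finally show "dist (f x \<bullet> b) (f y \<bullet> b) \<le> L * dist x y" .
qed (rule lipschitz_on_nonneg[OF f])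

lemma lipschitz_extension:
  fixes f :: "'a::metric_space \<Rightarrow> 'b::euclidean_space"
  assumes f: "L-lipschitz_on K f"
  obtains g L' where "L'-lipschitz_on UNIV g" "\<And>x. x \<in> K \<Longrightarrow> g x = f x"
proof -
  have L0: "0 \<le> L" using f lipschitz_on_nonneg by blast
  have "\<exists>g. L-lipschitz_on UNIV g \<and> (\<forall>x\<in>K. g x = f x \<bullet> b)" if b: "b \<in> Basis" for b
  proof -
    from lipschitz_on_component[OF f b]
    obtain g where "L-lipschitz_on UNIV g" "\<And>x. x \<in> K \<Longrightarrow> g x = f x \<bullet> b"
      by (rule lipschitz_extension_real) (rule that)
    then show ?thesis by (intro exI[of _ g]) simp
  qed
  then obtain g where g: "\<And>b. b \<in> Basis \<Longrightarrow> L-lipschitz_on UNIV (g b)"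
    "\<And>b x. b \<in> Basis \<Longrightarrow> x \<in> K \<Longrightarrow> g b x = f x \<bullet> b" by metis
  show ?thesis
  proof (rule that[of "DIM('b) * L" "\<lambda>x. \<Sum>b\<in>Basis. g b x *\<^sub>R b"])
    show "(DIM('b) * L)-lipschitz_on UNIV (\<lambda>x. \<Sum>b\<in>Basis. g b x *\<^sub>R b)"
    proof (rule lipschitz_onI)
      fix x y
      have "dist (\<Sum>b\<in>Basis. g b x *\<^sub>R b) (\<Sum>b\<in>Basis. g b y *\<^sub>R b) = norm (\<Sum>b\<in>Basis. (g b x - g b y) *\<^sub>R b)"
        by (simp add: dist_norm sum_subtractf scaleR_left_diff_distrib)
      also have "\<dots> \<le> (\<Sum>b\<in>Basis. norm ((g b x - g b y) *\<^sub>R b))" by (rule norm_sum)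
      also have "\<dots> \<le> (\<Sum>b\<in>(Basis::'b set). L * dist x y)"
        using lipschitz_onD[OF g(1), of _ x y] by (intro sum_mono) (auto simp: dist_real_def)
      finally show "dist (\<Sum>b\<in>Basis. g b x *\<^sub>R b) (\<Sum>b\<in>Basis. g b y *\<^sub>R b) \<le> DIM('b) * L * dist x y"
        by simp
    qed (use L0 in auto)
    fix x assume "x \<in> K"
    then show "(\<Sum>b\<in>Basis. g b x *\<^sub>R b) = f x" using g(2) by (simp add: euclidean_representation)
  qed
qed

theorem rademacher:
  fixes f :: "'a::euclidean_space \<Rightarrow> 'b::euclidean_space"
  assumes "open U" and f: "L-lipschitz_on U f"
  shows "negligible {x\<in>U. \<not> f differentiable (at x)}"
proof -
  obtain g L' where g: "L'-lipschitz_on UNIV g" "\<And>x. x \<in> U \<Longrightarrow> g x = f x"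
    by (rule lipschitz_extension[OF f]) (rule that)
  have "negligible {x. \<not> (\<lambda>x. g x \<bullet> b) differentiable (at x)}" if "b \<in> Basis" for b
    by (rule rademacher_real[OF lipschitz_on_component[OF g(1) that]])
  then have "negligible (\<Union>b\<in>Basis. {x. \<not> (\<lambda>x. g x \<bullet> b) differentiable (at x)})"
    by (intro negligible_Union) auto
  moreover have "{x\<in>U. \<not> f differentiable (at x)} \<subseteq> (\<Union>b\<in>Basis. {x. \<not> (\<lambda>x. g x \<bullet> b) differentiable (at x)})"
  proof (rule subsetI, rule ccontr)
    fix x assume "x \<in> {x\<in>U. \<not> f differentiable (at x)}"
      and n: "x \<notin> (\<Union>b\<in>Basis. {x. \<not> (\<lambda>x. g x \<bullet> b) differentiable (at x)})"
    then have x: "x \<in> U" "\<not> f differentiable (at x)" by auto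
    from n have "\<forall>b\<in>Basis. (\<lambda>x. g x \<bullet> b) differentiable (at x)" by blast
    then have "g differentiable (at x)" using differentiable_componentwise_within[of g x UNIV] by (simp only:)
    then obtain g' where "(g has_derivative g') (at x)" unfolding differentiable_def by (rule exE)
    then have "(f has_derivative g') (at x)"
      by (rule has_derivative_transform_within_open[OF _ \<open>open U\<close> x(1)]) (use g(2) in auto)
    then have "f differentiable (at x)" unfolding differentiable_def by (intro exI[of _ g'])
    then show False using x(2) by simp
  qed
  ultimately show ?thesis by (rule negligible_subset)
qed

text \<open>
  Points of \<open>A\<close> approach \<open>x\<close> tangentially to every direction \<open>t\<close>. Derivatives at such a point are determined
  by the values on \<open>A\<close>, which is all that Lebesgue density points would be used for. Fixing the scales \<open>1/(n+1)\<close>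
  turns limits along \<open>A\<close> into limits of sequences.
\<close>

definition tangentially_dense :: "'a::real_normed_vector set \<Rightarrow> 'a \<Rightarrow> bool" where
  "tangentially_dense A x \<longleftrightarrow>
     (\<forall>t. \<exists>Y. (\<forall>n. Y n \<in> A) \<and> (\<lambda>n. real (Suc n) *\<^sub>R (Y n - x)) \<longlonglongrightarrow> t)"

text \<open>
  The distance function to \<open>A\<close> is Lipschitz, hence differentiable almost everywhere. At a point of
  \<open>A\<close> it has a minimum, so its derivative vanishes there: within distance \<open>o(s)\<close> of \<open>x + s t\<close> there is a point of \<open>A\<close>.
\<close>

lemma negligible_not_tangentially_dense:
  fixes A :: "'a::euclidean_space set"
  shows "negligible {x\<in>A. \<not> tangentially_dense A x}"
proof -
  have "1-lipschitz_on UNIV (\<lambda>x. infdist x A)"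
    by (rule lipschitz_onI) (auto simp: dist_real_def infdist_triangle_abs)
  from rademacher[OF open_UNIV this] have neg: "negligible {x. \<not> (\<lambda>x. infdist x A) differentiable (at x)}" by simp
  have "tangentially_dense A x" if x: "x \<in> A" and d: "(\<lambda>x. infdist x A) differentiable (at x)" for x
    unfolding tangentially_dense_def
  proof
    fix t
    obtain D where D: "((\<lambda>x. infdist x A) has_derivative D) (at x)" using d unfolding differentiable_def by blast
    have x0: "infdist x A = 0" using x by simp
    have "D = (\<lambda>v. 0)"
      by (rule differential_zero_maxmin[OF UNIV_I open_UNIV D]) (simp add: x0 infdist_nonneg)
    with D have D0: "((\<lambda>x. infdist x A) has_derivative (\<lambda>v. 0)) (at x)" by simp
    define h where "h n = 1 / real (Suc n)" for n
    have h0: "h n > 0" for n by (simp add: h_def)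
    have h: "h \<longlonglongrightarrow> 0" unfolding h_def by (rule LIMSEQ_Suc[OF lim_1_over_n])
    have "\<exists>Y\<in>A. dist (x + h n *\<^sub>R t) Y < infdist (x + h n *\<^sub>R t) A + h n * h n" for n
    proof (rule ccontr)
      assume "\<not> ?thesis"
      then have "infdist (x + h n *\<^sub>R t) A + h n * h n \<le> infdist (x + h n *\<^sub>R t) A"
        using x unfolding infdist_notempty[OF ex_in_conv[THEN iffD1, OF exI, OF x]] 
        by (intro cINF_greatest) (auto simp: not_less)
      then show False using mult_pos_pos[OF h0[of n] h0[of n]] by linarith
    qed
    then obtain Y where Y: "\<And>n. Y n \<in> A" "\<And>n. dist (x + h n *\<^sub>R t) (Y n) < infdist (x + h n *\<^sub>R t) A + h n * h n" by metis
    have lim: "(\<lambda>n. infdist (x + h n *\<^sub>R t) A / h n) \<longlonglongrightarrow> 0"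
    proof -
      have "((\<lambda>s. x + s *\<^sub>R t) has_derivative (\<lambda>s. s *\<^sub>R t)) (at 0)" by (auto intro!: derivative_eq_intros)
      moreover have "((\<lambda>x. infdist x A) has_derivative (\<lambda>v. 0)) (at (x + 0 *\<^sub>R t))" using D0 by simp
      ultimately have "((\<lambda>s. infdist (x + s *\<^sub>R t) A) has_derivative (\<lambda>s. 0)) (at (0::real))"
        by (rule has_derivative_compose)
      then have "((\<lambda>s. infdist (x + s *\<^sub>R t) A) has_real_derivative 0) (at 0)"
        by (simp add: has_field_derivative_def lambda_zero[symmetric])
      then have "((\<lambda>s. infdist (x + s *\<^sub>R t) A / s) \<longlongrightarrow> 0) (at 0)"
        by (simp add: has_field_derivative_iff x0)
      moreover have "filterlim h (at 0) sequentially"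
        using h h0 by (auto simp: filterlim_at less_imp_neq[symmetric] intro!: always_eventually)
      ultimately show ?thesis by (rule filterlim_compose)
    qed
    have "(\<lambda>n. real (Suc n) *\<^sub>R (Y n - x) - t) \<longlonglongrightarrow> 0"
    proof (rule Lim_null_comparison)
      show "\<forall>\<^sub>F n in sequentially. norm (real (Suc n) *\<^sub>R (Y n - x) - t) \<le> infdist (x + h n *\<^sub>R t) A / h n + h n"
      proof (intro always_eventually allI)
        fix n
        have "real (Suc n) *\<^sub>R (Y n - x) - t = (1 / h n) *\<^sub>R (Y n - (x + h n *\<^sub>R t))"
          using h0[of n] by (simp add: h_def algebra_simps del: of_nat_Suc)
        then have "norm (real (Suc n) *\<^sub>R (Y n - x) - t) = dist (x + h n *\<^sub>R t) (Y n) / h n"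
          using h0[of n] by (simp add: dist_norm norm_minus_commute)
        also have "\<dots> \<le> (infdist (x + h n *\<^sub>R t) A + h n * h n) / h n"
          using Y(2)[of n] h0[of n] by (intro divide_right_mono) auto
        also have "\<dots> = infdist (x + h n *\<^sub>R t) A / h n + h n" using h0[of n] by (simp add: add_divide_distrib)
        finally show "norm (real (Suc n) *\<^sub>R (Y n - x) - t) \<le> infdist (x + h n *\<^sub>R t) A / h n + h n" .
      qed
      show "(\<lambda>n. infdist (x + h n *\<^sub>R t) A / h n + h n) \<longlonglongrightarrow> 0" using tendsto_add[OF lim h] by simp
    qed
    then have "(\<lambda>n. real (Suc n) *\<^sub>R (Y n - x)) \<longlonglongrightarrow> t" by (rule LIM_zero_cancel)
    then show "\<exists>Y. (\<forall>n. Y n \<in> A) \<and> (\<lambda>n. real (Suc n) *\<^sub>R (Y n - x)) \<longlonglongrightarrow> t" using Y(1) by (intro exI[of _ Y]) simp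
  qed
  then have "{x\<in>A. \<not> tangentially_dense A x} \<subseteq> {x. \<not> (\<lambda>x. infdist x A) differentiable (at x)}"
    by (intro subsetI CollectI notI) (elim CollectE conjE, simp)
  then show ?thesis by (rule negligible_subset[OF neg])
qed

section \<open>Hausdorff measure as a metric outer measure\<close>

lemma hausdorff_premeasure_le_cover:
  assumes "A \<subseteq> (\<Union>i. C i)" "\<And>i. bounded (C i)" "\<And>i. diameter (C i) \<le> \<delta>"
  shows "hausdorff_premeasure h \<delta> A \<le> (\<Sum>i. hausdorff_weight h (C i))"
  unfolding hausdorff_premeasure_def by (rule INF_lower) (use assms in auto)

lemma hausdorff_premeasure_greatest:
  assumes "\<And>C. A \<subseteq> (\<Union>i. C i) \<Longrightarrow> (\<And>i. bounded (C i)) \<Longrightarrow> (\<And>i. diameter (C i) \<le> \<delta>) \<Longrightarrow>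
     y \<le> (\<Sum>i. hausdorff_weight h (C i))"
  shows "y \<le> hausdorff_premeasure h \<delta> A"
  unfolding hausdorff_premeasure_def by (rule INF_greatest) (use assms in auto)

lemma hausdorff_weight_empty [simp]: "hausdorff_weight h {} = 0"
  by (simp add: hausdorff_weight_def)

lemma hausdorff_premeasure_mono:
  assumes "A \<subseteq> B"
  shows "hausdorff_premeasure h \<delta> A \<le> hausdorff_premeasure h \<delta> B"
  by (rule hausdorff_premeasure_greatest, rule hausdorff_premeasure_le_cover) (use assms in auto)

lemma hausdorff_premeasure_antimono:
  assumes "\<delta> \<le> \<delta>'"
  shows "hausdorff_premeasure h \<delta>' A \<le> hausdorff_premeasure h \<delta> A"
  by (rule hausdorff_premeasure_greatest, rule hausdorff_premeasure_le_cover)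
    (use assms in \<open>auto intro: order_trans\<close>)

lemma hausdorff_premeasure_empty [simp]:
  assumes "0 \<le> \<delta>"
  shows "hausdorff_premeasure h \<delta> {} = 0"
  using hausdorff_premeasure_le_cover[of "{}" "\<lambda>_. {}" \<delta> h] assms by simp

lemma hausdorff_premeasure_countable_subadditive:
  "hausdorff_premeasure h \<delta> (\<Union>n. A n) \<le> (\<Sum>n. hausdorff_premeasure h \<delta> (A n))"
proof (cases "\<exists>n. hausdorff_premeasure h \<delta> (A n) = \<infinity>")
  case True
  then obtain n where "hausdorff_premeasure h \<delta> (A n) = \<infinity>" by blast
  moreover have "(\<Sum>k\<in>{n}. hausdorff_premeasure h \<delta> (A k)) \<le> (\<Sum>n. hausdorff_premeasure h \<delta> (A n))"
    by (rule sum_le_suminf) auto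
  ultimately show ?thesis by (simp add: top_unique)
next
  case False
  show ?thesis
  proof (rule ennreal_le_epsilon)
    fix e :: real assume e: "0 < e"
    have "\<exists>C. A n \<subseteq> (\<Union>i. C i) \<and> (\<forall>i. bounded (C i) \<and> diameter (C i) \<le> \<delta>) \<and>
        (\<Sum>i. hausdorff_weight h (C i)) \<le> hausdorff_premeasure h \<delta> (A n) + ennreal (e * (1/2) ^ Suc n)" for n
    proof (rule ccontr)
      assume "\<not> ?thesis"
      then have "hausdorff_premeasure h \<delta> (A n) + ennreal (e * (1/2) ^ Suc n) \<le> hausdorff_premeasure h \<delta> (A n)"
        by (intro hausdorff_premeasure_greatest) (meson le_cases)
      moreover have "hausdorff_premeasure h \<delta> (A n) < \<infinity>" using False by (auto simp: less_top)
      moreover have "0 < ennreal (e * (1/2) ^ Suc n)" using e by (simp add: ennreal_less_zero_iff)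
      ultimately show False
        by (metis add.right_neutral ennreal_add_left_cancel_le infinity_ennreal_def leD less_irrefl zero_less_iff_neq_zero top.not_eq_extremum)
    qed
    then obtain C where C: "\<And>n. A n \<subseteq> (\<Union>i. C n i)" "\<And>n i. bounded (C n i)" "\<And>n i. diameter (C n i) \<le> \<delta>"
      "\<And>n. (\<Sum>i. hausdorff_weight h (C n i)) \<le> hausdorff_premeasure h \<delta> (A n) + ennreal (e * (1/2) ^ Suc n)"
      by metis
    define E where "E k = case_prod C (prod_decode k)" for k
    have "(\<Union>n. A n) \<subseteq> (\<Union>k. E k)"
    proof
      fix x assume "x \<in> (\<Union>n. A n)"
      then obtain n i where "x \<in> C n i" using C(1) by blast
      then have "x \<in> E (prod_encode (n, i))" by (simp add: E_def)
      then show "x \<in> (\<Union>k. E k)" by blast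
    qed
    then have "hausdorff_premeasure h \<delta> (\<Union>n. A n) \<le> (\<Sum>k. hausdorff_weight h (E k))"
      by (rule hausdorff_premeasure_le_cover) (auto simp: E_def C split: prod.split)
    also have "\<dots> = (\<Sum>k. (\<lambda>(n, i). hausdorff_weight h (C n i)) (prod_decode k))"
      by (simp add: E_def case_prod_beta)
    also have "\<dots> = (\<Sum>n. \<Sum>i. hausdorff_weight h (C n i))"
      by (rule suminf_ennreal_2dimen) simp
    also have "\<dots> \<le> (\<Sum>n. hausdorff_premeasure h \<delta> (A n) + ennreal (e * (1/2) ^ Suc n))"
      by (rule suminf_le) (use C(4) in auto)
    also have "\<dots> = (\<Sum>n. hausdorff_premeasure h \<delta> (A n)) + (\<Sum>n. ennreal (e * (1/2) ^ Suc n))"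
      by (rule suminf_add[symmetric]) auto
    also have "(\<Sum>n. ennreal (e * (1/2) ^ Suc n)) = ennreal e"
    proof -
      have "(\<lambda>n. e * (1/2) ^ Suc n) sums (e * 1)" by (intro sums_mult power_half_series)
      then show ?thesis using e by (intro suminf_ennreal_eq) auto
    qed
    finally show "hausdorff_premeasure h \<delta> (\<Union>n. A n) \<le> (\<Sum>n. hausdorff_premeasure h \<delta> (A n)) + ennreal e" .
  qed
qed

lemma subadditive_Un_if_countably_subadditive:
  fixes m :: "'a set \<Rightarrow> ennreal"
  assumes "m {} = 0" and sub: "\<And>X :: nat \<Rightarrow> 'a set. m (\<Union>n. X n) \<le> (\<Sum>n. m (X n))"
  shows "m (A \<union> B) \<le> m A + m B"
proof -
  define X where "X n = (if n = 0 then A else if n = 1 then B else {})" for n :: nat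
  have "X 0 \<subseteq> (\<Union>n. X n)" "X 1 \<subseteq> (\<Union>n. X n)" by (intro UN_upper UNIV_I)+
  moreover have "X n \<subseteq> A \<union> B" for n by (simp add: X_def)
  then have "(\<Union>n. X n) \<subseteq> A \<union> B" by (rule UN_least)
  ultimately have "(\<Union>n. X n) = A \<union> B" by (simp add: X_def Un_commute)
  moreover have "(\<Sum>n. m (X n)) = (\<Sum>n\<in>{0,1}. m (X n))"
    by (rule suminf_finite) (auto simp: X_def assms)
  ultimately show ?thesis using sub[of X] by (simp add: X_def)
qed

lemma hausdorff_premeasure_le_measure:
  assumes "0 < \<delta>"
  shows "hausdorff_premeasure h \<delta> A \<le> hausdorff_measure h A"
  unfolding hausdorff_measure_def by (rule SUP_upper) (use assms in auto)

lemma hausdorff_measure_leI: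
  assumes "\<And>\<delta>. 0 < \<delta> \<Longrightarrow> hausdorff_premeasure h \<delta> A \<le> c"
  shows "hausdorff_measure h A \<le> c"
  unfolding hausdorff_measure_def by (rule SUP_least) (use assms in auto)

lemma hausdorff_measure_mono:
  "A \<subseteq> B \<Longrightarrow> hausdorff_measure h A \<le> hausdorff_measure h B"
  unfolding hausdorff_measure_def by (rule SUP_mono) (use hausdorff_premeasure_mono in blast)

lemma hausdorff_measure_empty [simp]: "hausdorff_measure h {} = 0"
  using hausdorff_measure_leI[of h "{}" 0] by simp

lemma hausdorff_measure_countable_subadditive:
  "hausdorff_measure h (\<Union>n. A n) \<le> (\<Sum>n. hausdorff_measure h (A n))"
proof (rule hausdorff_measure_leI)
  fix \<delta> :: real assume \<delta>: "0 < \<delta>"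
  have "hausdorff_premeasure h \<delta> (\<Union>n. A n) \<le> (\<Sum>n. hausdorff_premeasure h \<delta> (A n))"
    by (rule hausdorff_premeasure_countable_subadditive)
  also have "\<dots> \<le> (\<Sum>n. hausdorff_measure h (A n))"
    by (rule suminf_le) (use hausdorff_premeasure_le_measure[OF \<delta>] in auto)
  finally show "hausdorff_premeasure h \<delta> (\<Union>n. A n) \<le> (\<Sum>n. hausdorff_measure h (A n))" .
qed

lemma hausdorff_measure_null_UN:
  assumes "\<And>n::nat. hausdorff_measure h (A n) = 0"
  shows "hausdorff_measure h (\<Union>n. A n) = 0"
  using hausdorff_measure_countable_subadditive[of h A] assms by simp

lemma hausdorff_measure_null_countable_UN:
  assumes "countable I" "\<And>i. i \<in> I \<Longrightarrow> hausdorff_measure h (A i) = 0"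
  shows "hausdorff_measure h (\<Union>i\<in>I. A i) = 0"
proof (cases "I = {}")
  case False
  have "(\<Union>i\<in>I. A i) = (\<Union>n. A (from_nat_into I n))"
    using range_from_nat_into[OF False assms(1)] by (metis image_image)
  then show ?thesis using hausdorff_measure_null_UN[of h "\<lambda>n. A (from_nat_into I n)"] assms(2) from_nat_into[OF False] by simp
qed simp

lemma hausdorff_measure_Un_le:
  "hausdorff_measure h (A \<union> B) \<le> hausdorff_measure h A + hausdorff_measure h B"
  by (rule subadditive_Un_if_countably_subadditive)
    (simp_all add: hausdorff_measure_countable_subadditive)

text \<open>
  A set of diameter less than \<open>d\<close> meets at most one of \<open>A\<close> and \<open>B\<close>, so a fine cover of the union splits
  into a cover of \<open>A\<close> and a cover of \<open>B\<close>.
\<close>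

lemma hausdorff_measure_separated:
  assumes d: "0 < d" and sep: "\<And>x y. x \<in> A \<Longrightarrow> y \<in> B \<Longrightarrow> d \<le> dist x y"
  shows "hausdorff_measure h A + hausdorff_measure h B \<le> hausdorff_measure h (A \<union> B)"
proof -
  have small: "hausdorff_premeasure h \<delta> A + hausdorff_premeasure h \<delta> B \<le> hausdorff_premeasure h \<delta> (A \<union> B)"
    if "0 < \<delta>" "\<delta> < d" for \<delta>
  proof (rule hausdorff_premeasure_greatest)
    fix C :: "nat \<Rightarrow> 'a set"
    assume C: "A \<union> B \<subseteq> (\<Union>i. C i)" "\<And>i. bounded (C i)" "\<And>i. diameter (C i) \<le> \<delta>"
    define CA where "CA i = (if C i \<inter> A \<noteq> {} then C i else {})" for i
    define CB where "CB i = (if C i \<inter> B \<noteq> {} then C i else {})" for i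
    have disj: "C i \<inter> A = {} \<or> C i \<inter> B = {}" for i
    proof (rule ccontr)
      assume "\<not> ?thesis"
      then obtain x y where xy: "x \<in> C i" "x \<in> A" "y \<in> C i" "y \<in> B" by blast
      then have "dist x y \<le> diameter (C i)" using diameter_bounded_bound[OF C(2)] by blast
      then show False using sep[of x y] xy C(3)[of i] that by linarith
    qed
    have "hausdorff_premeasure h \<delta> A \<le> (\<Sum>i. hausdorff_weight h (CA i))"
    proof (rule hausdorff_premeasure_le_cover)
      show "A \<subseteq> (\<Union>i. CA i)"
      proof
        fix x assume x: "x \<in> A"
        then obtain i where "x \<in> C i" using C(1) by blast
        then have "x \<in> CA i" using x by (auto simp: CA_def)
        then show "x \<in> (\<Union>i. CA i)" by blast
      qed
    qed (use C that in \<open>auto simp: CA_def\<close>)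
    moreover have "hausdorff_premeasure h \<delta> B \<le> (\<Sum>i. hausdorff_weight h (CB i))"
    proof (rule hausdorff_premeasure_le_cover)
      show "B \<subseteq> (\<Union>i. CB i)"
      proof
        fix x assume x: "x \<in> B"
        then obtain i where "x \<in> C i" using C(1) by blast
        then have "x \<in> CB i" using x by (auto simp: CB_def)
        then show "x \<in> (\<Union>i. CB i)" by blast
      qed
    qed (use C that in \<open>auto simp: CB_def\<close>)
    ultimately have "hausdorff_premeasure h \<delta> A + hausdorff_premeasure h \<delta> B
      \<le> (\<Sum>i. hausdorff_weight h (CA i)) + (\<Sum>i. hausdorff_weight h (CB i))" by (rule add_mono)
    also have "\<dots> = (\<Sum>i. hausdorff_weight h (CA i) + hausdorff_weight h (CB i))"
      by (rule suminf_add) auto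
    also have "\<dots> \<le> (\<Sum>i. hausdorff_weight h (C i))"
    proof (rule suminf_le)
      fix i
      show "hausdorff_weight h (CA i) + hausdorff_weight h (CB i) \<le> hausdorff_weight h (C i)"
        using disj[of i] by (auto simp: CA_def CB_def)
    qed auto
    finally show "hausdorff_premeasure h \<delta> A + hausdorff_premeasure h \<delta> B \<le> (\<Sum>i. hausdorff_weight h (C i))" .
  qed
  have both: "hausdorff_premeasure h \<delta> A + hausdorff_premeasure h \<delta>' B \<le> hausdorff_measure h (A \<union> B)"
    if "0 < \<delta>" "0 < \<delta>'" for \<delta> \<delta>'
  proof -
    define \<eta> where "\<eta> = min (min \<delta> \<delta>') (d / 2)"
    have \<eta>: "0 < \<eta>" "\<eta> < d" "\<eta> \<le> \<delta>" "\<eta> \<le> \<delta>'" using that d by (auto simp: \<eta>_def)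
    have "hausdorff_premeasure h \<delta> A + hausdorff_premeasure h \<delta>' B \<le> hausdorff_premeasure h \<eta> A + hausdorff_premeasure h \<eta> B"
      by (intro add_mono hausdorff_premeasure_antimono \<eta>)
    also have "\<dots> \<le> hausdorff_premeasure h \<eta> (A \<union> B)" by (rule small[OF \<eta>(1,2)])
    also have "\<dots> \<le> hausdorff_measure h (A \<union> B)" by (rule hausdorff_premeasure_le_measure[OF \<eta>(1)])
    finally show ?thesis .
  qed
  have ne: "{0::real<..} \<noteq> {}" by (simp add: not_empty_eq_Ici_eq_empty)
  have "hausdorff_premeasure h \<delta> A + hausdorff_measure h B \<le> hausdorff_measure h (A \<union> B)" if "0 < \<delta>" for \<delta>
    unfolding hausdorff_measure_def[of h B] ennreal_SUP_add_right[OF ne]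
    by (rule SUP_least) (use both that in auto)
  then show ?thesis
    unfolding hausdorff_measure_def[of h A] ennreal_SUP_add_left[OF ne, symmetric]
    by (intro SUP_least) auto
qed

text \<open>
  Caratheodory's criterion. \<open>A n\<close>, the part of \<open>X\<close> at distance at least \<open>1/(n+1)\<close> from \<open>F\<close>, is separated from
  \<open>X \<inter> F\<close>. What remains of \<open>X - F\<close> is the union of the rings \<open>R k\<close> with \<open>k \<ge> n\<close>. Rings of
  equal parity are mutually separated, so the measures of all rings have a finite sum, whose tails tend to zero.
\<close>

lemma hausdorff_measurable_closed:
  fixes F :: "'a::metric_space set"
  assumes "closed F"
  shows "hausdorff_measurable h F"
proof -
  let ?H = "hausdorff_measure h :: 'a set \<Rightarrow> ennreal"
  have "?H (F \<inter> X) + ?H ((UNIV - F) \<inter> X) = ?H X" for X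
  proof (rule antisym)
    show "?H (F \<inter> X) + ?H ((UNIV - F) \<inter> X) \<le> ?H X"
    proof (cases "F = {} \<or> ?H X = \<infinity>")
      case True
      then show ?thesis by (auto simp: top_unique)
    next
      case False
      then have Fne: "F \<noteq> {}" and fin: "?H X < \<infinity>" by (auto simp: less_top)
      define i where "i z = infdist z F" for z
      have i_lip: "i y - i z \<le> dist z y" for y z
        using infdist_triangle[of y F z] by (simp add: i_def dist_commute)
      define A where "A n = {z\<in>X. 1 / real (Suc n) \<le> i z}" for n
      define R where "R k = {z\<in>X. 1 / real (Suc (Suc k)) \<le> i z \<and> i z < 1 / real (Suc k)}" for k
      have AF: "?H (F \<inter> X) + ?H (A n) \<le> ?H X" for n
      proof -
        have "?H (F \<inter> X) + ?H (A n) \<le> ?H ((F \<inter> X) \<union> A n)"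
        proof (rule hausdorff_measure_separated[of "1 / real (Suc n)"])
          fix x y assume "x \<in> F \<inter> X" "y \<in> A n"
          then show "1 / real (Suc n) \<le> dist x y" using i_lip[of y x] by (auto simp: A_def i_def)
        qed simp
        also have "\<dots> \<le> ?H X" by (rule hausdorff_measure_mono) (auto simp: A_def)
        finally show ?thesis .
      qed
      have rings: "(\<Sum>k<N. ?H (R (2 * k + m))) \<le> ?H (\<Union>k<N. R (2 * k + m))" for N m
      proof (induction N)
        case (Suc N)
        have "(\<Sum>k<Suc N. ?H (R (2 * k + m))) \<le> ?H (\<Union>k<N. R (2 * k + m)) + ?H (R (2 * N + m))"
          using Suc.IH by (simp add: add_right_mono)
        also have "\<dots> \<le> ?H ((\<Union>k<N. R (2 * k + m)) \<union> R (2 * N + m))"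
        \<comment> \<open>For \<open>N = 0\<close> the union is empty and the separation constant below would be meaningless.\<close>
        proof (cases "N = 0")
          case False
          show ?thesis
          proof (rule hausdorff_measure_separated[of "1 / real (2 * N + m) - 1 / real (2 * N + m + 1)"])
            show "0 < 1 / real (2 * N + m) - 1 / real (2 * N + m + 1)"
              using False by (simp add: frac_less2)
            fix x y assume x: "x \<in> (\<Union>k<N. R (2 * k + m))" and y: "y \<in> R (2 * N + m)"
            then obtain k where k: "k < N" "1 / real (Suc (Suc (2 * k + m))) \<le> i x" by (auto simp: R_def)
            have "1 / real (2 * N + m) \<le> 1 / real (Suc (Suc (2 * k + m)))"
              using k(1) by (intro frac_le) auto
            moreover have "i y < 1 / real (2 * N + m + 1)" using y by (simp add: R_def)
            ultimately show "1 / real (2 * N + m) - 1 / real (2 * N + m + 1) \<le> dist x y"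
              using k(2) i_lip[of x y] unfolding dist_commute[of y x] by linarith
          qed
        qed simp
        also have "(\<Union>k<N. R (2 * k + m)) \<union> R (2 * N + m) = (\<Union>k<Suc N. R (2 * k + m))"
          by (auto simp: lessThan_Suc)
        finally show ?case .
      qed simp
      have ring_sum: "(\<Sum>k<N. ?H (R k)) \<le> 2 * ?H X" for N
      proof -
        have "(\<Sum>k<N. ?H (R k)) \<le> (\<Sum>k<2 * N. ?H (R k))" by (rule sum_mono2) auto
        also have "\<dots> = (\<Sum>k<N. ?H (R (2 * k + 0))) + (\<Sum>k<N. ?H (R (2 * k + 1)))"
          by (induction N) (simp_all add: add_ac)
        also have "\<dots> \<le> ?H X + ?H X"
        proof (intro add_mono)
          have "(\<Sum>k<N. ?H (R (2 * k + m))) \<le> ?H X" for m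
            by (rule order_trans[OF rings hausdorff_measure_mono]) (auto simp: R_def)
          then show "(\<Sum>k<N. ?H (R (2 * k + 0))) \<le> ?H X" "(\<Sum>k<N. ?H (R (2 * k + 1))) \<le> ?H X"
            by blast+
        qed
        finally show ?thesis by (simp add: mult_2)
      qed
      have Rfin: "?H (R k) < \<infinity>" for k
        using hausdorff_measure_mono[of "R k" X h] fin by (auto simp: R_def intro: le_less_trans)
      define r where "r k = enn2real (?H (R k))" for k
      have r: "?H (R k) = ennreal (r k)" for k using Rfin[of k] by (simp add: r_def)
      have r0: "0 \<le> r k" for k by (simp add: r_def)
      obtain c where c: "?H X = ennreal c" "0 \<le> c" using fin by (cases "?H X") auto
      have "summable r"
      proof (rule summableI_nonneg_bounded[OF r0])
        fix N
        have "ennreal (sum r {..<N}) \<le> ennreal (2 * c)"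
          using ring_sum[of N] c r0 by (simp add: r sum_ennreal ennreal_mult)
        then show "sum r {..<N} \<le> 2 * c" using c by (simp add: ennreal_le_iff)
      qed
      show ?thesis
      proof (rule ennreal_le_epsilon)
        fix e :: real assume "0 < e"
        obtain n where "norm (\<Sum>k. r (k + n)) < e"
          using suminf_exist_split[OF \<open>0 < e\<close> \<open>summable r\<close>] by blast
        then have tail: "(\<Sum>k. ?H (R (k + n))) \<le> ennreal e"
          unfolding r using r0 \<open>summable r\<close>
          by (subst suminf_ennreal2) (auto simp: summable_iff_shift intro!: ennreal_leI)
        have "(UNIV - F) \<inter> X \<subseteq> A n \<union> (\<Union>k. R (k + n))"
        proof
          fix z assume z: "z \<in> (UNIV - F) \<inter> X"
          have "i z > 0" unfolding i_def using z assms Fne by (simp add: infdist_pos_not_in_closed)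
          then obtain m where m: "1 / real (Suc m) < i z" using nat_approx_posE by blast
          define j where "j = (LEAST j. 1 / real (Suc j) \<le> i z)"
          have j: "1 / real (Suc j) \<le> i z" unfolding j_def by (rule LeastI[of _ m]) (use m in simp)
          show "z \<in> A n \<union> (\<Union>k. R (k + n))"
          proof (cases "j \<le> n")
            case True
            then have "1 / real (Suc n) \<le> 1 / real (Suc j)" by (intro divide_left_mono) auto
            then show ?thesis using j z by (simp add: A_def)
          next
            case False
            then obtain k where k: "j = Suc (k + n)" by (metis add.commute less_imp_Suc_add not_le)
            have "\<not> 1 / real (Suc (k + n)) \<le> i z"
              using not_less_Least[of "k + n" "\<lambda>j. 1 / real (Suc j) \<le> i z"] k by (simp add: j_def)
            then have "z \<in> R (k + n)" using j z k by (simp add: R_def)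
            then show ?thesis by blast
          qed
        qed
        then have "?H ((UNIV - F) \<inter> X) \<le> ?H (A n \<union> (\<Union>k. R (k + n)))" by (rule hausdorff_measure_mono)
        also have "\<dots> \<le> ?H (A n) + ?H (\<Union>k. R (k + n))" by (rule hausdorff_measure_Un_le)
        also have "\<dots> \<le> ?H (A n) + ennreal e"
          using order_trans[OF hausdorff_measure_countable_subadditive tail] by (intro add_left_mono)
        finally have "?H (F \<inter> X) + ?H ((UNIV - F) \<inter> X) \<le> ?H (F \<inter> X) + (?H (A n) + ennreal e)"
          by (rule add_left_mono)
        also have "\<dots> \<le> ?H X + ennreal e" using AF[of n] by (simp add: add.assoc[symmetric] add_right_mono)
        finally show "?H (F \<inter> X) + ?H ((UNIV - F) \<inter> X) \<le> ?H X + ennreal e" .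
      qed
    qed
    have "?H X \<le> ?H ((F \<inter> X) \<union> ((UNIV - F) \<inter> X))" by (rule hausdorff_measure_mono) blast
    also have "\<dots> \<le> ?H (F \<inter> X) + ?H ((UNIV - F) \<inter> X)" by (rule hausdorff_measure_Un_le)
    finally show "?H X \<le> ?H (F \<inter> X) + ?H ((UNIV - F) \<inter> X)" .
  qed
  then show ?thesis by (simp add: hausdorff_measurable_def lambda_system_def)
qed

theorem hausdorff_measurable_borel:
  fixes E :: "'a::metric_space set"
  assumes "E \<in> sets borel"
  shows "hausdorff_measurable h E"
proof -
  let ?L = "lambda_system UNIV (Pow UNIV) (hausdorff_measure h :: 'a set \<Rightarrow> ennreal)"
  have "outer_measure_space (Pow UNIV) (hausdorff_measure h :: 'a set \<Rightarrow> ennreal)"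
    by (auto simp: outer_measure_space_def positive_def increasing_def countably_subadditive_def
        hausdorff_measure_mono hausdorff_measure_countable_subadditive)
  then have "measure_space UNIV ?L (hausdorff_measure h)"
    using sigma_algebra.caratheodory_lemma[OF sigma_algebra_Pow] by blast
  then have L: "sigma_algebra UNIV ?L" by (simp add: measure_space_def)
  have "sigma_sets UNIV (Collect closed) \<subseteq> ?L"
    by (rule sigma_algebra.sigma_sets_subset[OF L]) (use hausdorff_measurable_closed in \<open>auto simp: hausdorff_measurable_def\<close>)
  moreover have "sets borel = sigma_sets UNIV (Collect closed :: 'a set set)"
    unfolding borel_eq_closed by simp
  ultimately show ?thesis using assms by (auto simp: hausdorff_measurable_def)
qed

section \<open>Sets with Hausdorff-null image\<close>

lemma hausdorff_premeasure_le_diameter_bound: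
  fixes A :: "'a::real_normed_vector set"
  assumes h: "1 \<le> h" and D: "\<And>x y. x \<in> A \<Longrightarrow> y \<in> A \<Longrightarrow> dist x y \<le> D" and "0 \<le> D" "D \<le> \<delta>"
  shows "hausdorff_premeasure h \<delta> A \<le> ennreal (unit_ball_vol (real h) * (D / 2) ^ h)"
proof -
  define C where "C i = (if i = 0 then A else {})" for i :: nat
  have diam: "diameter A \<le> D" using \<open>0 \<le> D\<close> D by (intro diameter_le) (auto simp: dist_norm)
  have bdd: "bounded A"
  proof (cases "A = {}")
    case False
    then obtain a where "a \<in> A" by blast
    then show ?thesis using D unfolding bounded_def by blast
  qed simp
  have "hausdorff_premeasure h \<delta> A \<le> (\<Sum>i. hausdorff_weight h (C i))"
  proof (rule hausdorff_premeasure_le_cover)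
    have "A \<subseteq> C 0" by (simp add: C_def)
    then show "A \<subseteq> (\<Union>i. C i)" by blast
  qed (use bdd diam assms in \<open>auto simp: C_def\<close>)
  also have "\<dots> = (\<Sum>i\<in>{0}. hausdorff_weight h (C i))" by (rule suminf_finite) (auto simp: C_def)
  also have "\<dots> = hausdorff_weight h A" by (simp add: C_def)
  also have "\<dots> \<le> ennreal (unit_ball_vol (real h) * (D / 2) ^ h)"
  proof (cases "A = {}")
    case False
    have "unit_ball_vol (real h) * (diameter A / 2) ^ h \<le> unit_ball_vol (real h) * (D / 2) ^ h"
      using diam diameter_ge_0[OF bdd] by (intro mult_left_mono power_mono) (auto simp: less_imp_le)
    then show ?thesis using False by (simp add: hausdorff_weight_def ennreal_leI)
  qed simp
  finally show ?thesis .
qed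

lemma hausdorff_premeasure_finite_UN:
  assumes "finite I" "0 \<le> \<delta>"
  shows "hausdorff_premeasure h \<delta> (\<Union>i\<in>I. A i) \<le> (\<Sum>i\<in>I. hausdorff_premeasure h \<delta> (A i))"
  using assms(1)
proof (induction I)
  case empty
  then show ?case using assms by simp
next
  case (insert j I)
  have "hausdorff_premeasure h \<delta> (\<Union>i\<in>insert j I. A i)
    \<le> hausdorff_premeasure h \<delta> (A j) + hausdorff_premeasure h \<delta> (\<Union>i\<in>I. A i)"
    using subadditive_Un_if_countably_subadditive[of "hausdorff_premeasure h \<delta>" "A j" "\<Union>i\<in>I. A i"]
    by (simp add: assms hausdorff_premeasure_countable_subadditive)
  also have "\<dots> \<le> (\<Sum>i\<in>insert j I. hausdorff_premeasure h \<delta> (A i))"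
    using insert by (simp add: add_left_mono)
  finally show ?case .
qed

lemma dist_in_cube_le:
  fixes u :: "'a::euclidean_space" and s :: real
  assumes "x \<in> cube u s" "y \<in> cube u s"
  shows "dist x y \<le> DIM('a) * s"
proof -
  have "dist x y \<le> (\<Sum>i\<in>Basis. \<bar>(x - y) \<bullet> i\<bar>)" unfolding dist_norm by (rule norm_le_l1)
  also have "\<dots> \<le> (\<Sum>i\<in>(Basis::'a set). s)"
  proof (rule sum_mono)
    fix i :: 'a assume i: "i \<in> Basis"
    have "u \<bullet> i \<le> x \<bullet> i \<and> x \<bullet> i \<le> u \<bullet> i + s" "u \<bullet> i \<le> y \<bullet> i \<and> y \<bullet> i \<le> u \<bullet> i + s"
      using assms i by (auto simp: mem_box inner_add_left)
    then show "\<bar>(x - y) \<bullet> i\<bar> \<le> s" by (simp add: inner_diff_left abs_le_iff)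
  qed
  finally show ?thesis by simp
qed

lemma emeasure_cube:
  fixes u :: "'a::euclidean_space"
  assumes "0 \<le> s"
  shows "emeasure lborel (cube u s) = ennreal (s ^ DIM('a))"
  using assms by (simp add: emeasure_lborel_cbox_eq inner_add_left)

lemma cube_side_le_radius:
  fixes u :: "'a::euclidean_space"
  assumes "cube u s \<subseteq> ball x r" "0 < s"
  shows "s \<le> 2 * r"
proof -
  have "u \<in> cube u s" "u + s *\<^sub>R One \<in> cube u s"
    using assms(2) by (auto simp: mem_box inner_add_left)
  then have "u \<in> ball x r" "u + s *\<^sub>R One \<in> ball x r" using assms(1) by blast+
  then have "dist u (u + s *\<^sub>R One) < 2 * r" using dist_triangle_half_r[of x u "2 * r"] by auto
  moreover obtain i :: 'a where "i \<in> Basis" using nonempty_Basis by blast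
  moreover have "\<bar>(s *\<^sub>R One) \<bullet> i\<bar> \<le> norm (s *\<^sub>R One :: 'a)" using \<open>i \<in> Basis\<close> by (rule Basis_le_norm)
  moreover have "(s *\<^sub>R One) \<bullet> i = s" using \<open>i \<in> Basis\<close> by simp
  moreover have "dist u (u + s *\<^sub>R One) = norm (s *\<^sub>R One :: 'a)" by (simp only: dist_norm norm_minus_commute[of u] add_diff_cancel_left')
  ultimately show ?thesis by linarith
qed

text \<open>
  A bound on the images of small cubes, uniform only in its constant \<open>c\<close>, becomes a bound on the image of the whole set.
\<close>

lemma hausdorff_premeasure_image_le_of_cubes:
  fixes f :: "'a::euclidean_space \<Rightarrow> 'b::metric_space"
  assumes "bounded A" "open T" "A \<subseteq> T"
    and local: "\<And>x. x \<in> A \<Longrightarrow> \<exists>r>0. \<forall>u s. 0 < s \<and> x \<in> cube u s \<and> cube u s \<subseteq> ball x r \<longrightarrow>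
       hausdorff_premeasure h \<delta> (f ` cube u s) \<le> c * emeasure lborel (cube u s)"
    and \<delta>: "0 \<le> \<delta>"
  shows "hausdorff_premeasure h \<delta> (f ` A) \<le> c * emeasure lborel T"
proof -
  from local obtain r where r: "\<And>x. x \<in> A \<Longrightarrow> 0 < r x"
    "\<And>x u s. x \<in> A \<Longrightarrow> 0 < s \<Longrightarrow> x \<in> cube u s \<Longrightarrow> cube u s \<subseteq> ball x (r x) \<Longrightarrow>
       hausdorff_premeasure h \<delta> (f ` cube u s) \<le> c * emeasure lborel (cube u s)"
    by metis
  obtain Q where Q: "A \<subseteq> (\<Union>n. Q n)"
    "\<And>n. Q n \<noteq> {} \<Longrightarrow> \<exists>x\<in>A. \<exists>u s. 0 < s \<and> Q n = cube u s \<and> x \<in> Q n \<and> Q n \<subseteq> ball x (r x)"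
    "(\<Sum>n. emeasure lborel (Q n)) \<le> emeasure lborel T"
    using fine_cube_cover[OF assms(1-3), of r] r(1) by metis
  have "hausdorff_premeasure h \<delta> (f ` A) \<le> hausdorff_premeasure h \<delta> (\<Union>n. f ` Q n)"
    by (rule hausdorff_premeasure_mono) (use Q(1) in blast)
  also have "\<dots> \<le> (\<Sum>n. hausdorff_premeasure h \<delta> (f ` Q n))"
    by (rule hausdorff_premeasure_countable_subadditive)
  also have "\<dots> \<le> (\<Sum>n. c * emeasure lborel (Q n))"
  proof (rule suminf_le)
    fix n
    show "hausdorff_premeasure h \<delta> (f ` Q n) \<le> c * emeasure lborel (Q n)"
    proof (cases "Q n = {}")
      case False
      then obtain x u s where "x \<in> A" "0 < s" "Q n = cube u s" "x \<in> Q n" "Q n \<subseteq> ball x (r x)"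
        using Q(2) by blast
      then show ?thesis using r(2)[of x s u] by simp
    qed (simp add: \<delta>)
  qed auto
  also have "\<dots> = c * (\<Sum>n. emeasure lborel (Q n))" by (rule ennreal_suminf_cmult)
  also have "\<dots> \<le> c * emeasure lborel T" by (rule mult_left_mono[OF Q(3)]) simp
  finally show ?thesis .
qed

lemma hausdorff_null_image_from_bounded:
  assumes "\<And>k::nat. hausdorff_measure h (f ` (A \<inter> ball 0 (real k))) = 0"
  shows "hausdorff_measure h (f ` (A :: 'a::real_normed_vector set)) = 0"
proof -
  have "f ` A = (\<Union>k. f ` (A \<inter> ball 0 (real k)))"
  proof
    show "f ` A \<subseteq> (\<Union>k. f ` (A \<inter> ball 0 (real k)))"
    proof
      fix y assume "y \<in> f ` A"
      then obtain x where x: "x \<in> A" "y = f x" by blast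
      obtain k where "norm x < real k" using reals_Archimedean2 by blast
      then have "y \<in> f ` (A \<inter> ball 0 (real k))" using x by auto
      then show "y \<in> (\<Union>k. f ` (A \<inter> ball 0 (real k)))" by blast
    qed
  qed auto
  then show ?thesis using hausdorff_measure_null_UN[of h "\<lambda>k. f ` (A \<inter> ball 0 (real k))"] assms by simp
qed

text \<open>
  The image of a cube of side \<open>s\<close> has weight at most \<open>c s\<^sup>n\<close>, and the open set \<open>T\<close> can be chosen of arbitrarily
  small volume. The radius \<open>r\<close> only has to make the images of the cubes smaller than \<open>\<delta>\<close>.
\<close>

theorem hausdorff_null_lipschitz_image:
  fixes f :: "'a::euclidean_space \<Rightarrow> 'b::real_normed_vector"
  assumes f: "L-lipschitz_on UNIV f" and N: "negligible N"
  shows "hausdorff_measure DIM('a) (f ` N) = 0"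
proof (rule hausdorff_null_image_from_bounded)
  fix k :: nat
  define A where "A = N \<inter> ball 0 (real k)"
  define n where "n = DIM('a)"
  have n: "1 \<le> n" by (simp add: n_def Suc_leI)
  have L0: "0 \<le> L" using f lipschitz_on_nonneg by blast
  have negA: "negligible A" using N by (auto simp: A_def intro: negligible_subset)
  define c where "c = unit_ball_vol (real n) * (L * n / 2) ^ n"
  have c0: "0 \<le> c" using L0 by (simp add: c_def)
  have "hausdorff_measure n (f ` A) \<le> 0"
  proof (rule hausdorff_measure_leI)
    fix \<delta> :: real assume \<delta>: "0 < \<delta>"
    show "hausdorff_premeasure n \<delta> (f ` A) \<le> 0"
    proof (rule ennreal_le_epsilon)
      fix e :: real assume e: "0 < e"
      have e': "0 < e / (c + 1)" using e c0 by simp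
      obtain T where T: "open T" "A \<subseteq> T" "emeasure lebesgue (T - A) < ennreal (e / (c + 1))"
        using sets_lebesgue_outer_open[OF negligible_imp_sets[OF negA] e'] by metis
      have "emeasure lebesgue T \<le> emeasure lebesgue (T - A) + emeasure lebesgue A"
      proof -
        have "T \<in> sets lebesgue" using T(1) by simp
        then have "T - A \<in> sets lebesgue" using negligible_imp_sets[OF negA] by (rule sets.Diff)
        moreover have "T - A \<union> A = T" using T(2) by blast
        ultimately show ?thesis using emeasure_subadditive[of "T - A" lebesgue A] negligible_imp_sets[OF negA] by (simp only:)
      qed
      also have "emeasure lebesgue A = 0" using negA by (simp add: negligible_iff_null_sets null_setsD1)
      finally have Te: "emeasure lborel T \<le> ennreal (e / (c + 1))" using T by simp
      have "hausdorff_premeasure n \<delta> (f ` A) \<le> ennreal c * emeasure lborel T"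
      proof (rule hausdorff_premeasure_image_le_of_cubes)
        show "bounded A" by (rule bounded_subset[of "ball 0 (real k)"]) (auto simp: A_def)
        fix x assume "x \<in> A"
        define r where "r = \<delta> / (2 * L * n + 1)"
        have r: "0 < r" using \<delta> L0 by (simp add: r_def add_nonneg_pos)
        show "\<exists>r>0. \<forall>u s. 0 < s \<and> x \<in> cube u s \<and> cube u s \<subseteq> ball x r \<longrightarrow>
           hausdorff_premeasure n \<delta> (f ` cube u s) \<le> ennreal c * emeasure lborel (cube u s)"
        proof (intro exI[of _ r] conjI allI impI r)
          fix u s assume *: "0 < s \<and> x \<in> cube u s \<and> cube u s \<subseteq> ball x r"
          have s: "s \<le> 2 * r" using * cube_side_le_radius by blast
          have "hausdorff_premeasure n \<delta> (f ` cube u s) \<le> ennreal (unit_ball_vol (real n) * (L * (n * s) / 2) ^ n)"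
          proof (rule hausdorff_premeasure_le_diameter_bound[OF n])
            fix y z assume "y \<in> f ` cube u s" "z \<in> f ` cube u s"
            then obtain y' z' where yz: "y = f y'" "z = f z'" "y' \<in> cube u s" "z' \<in> cube u s"
              by blast
            have "dist y z \<le> L * dist y' z'" using lipschitz_onD[OF f, of y' z'] yz by simp
            also have "\<dots> \<le> L * (n * s)" using dist_in_cube_le[OF yz(3,4)] L0 by (intro mult_left_mono) (auto simp: n_def)
            finally show "dist y z \<le> L * (n * s)" .
          next
            show "0 \<le> L * (n * s)" using * L0 by simp
            have "L * (n * s) \<le> L * (n * (2 * r))" using s L0 by (intro mult_left_mono) auto
            also have "\<dots> = \<delta> * (2 * L * n / (2 * L * n + 1))" by (simp add: r_def)
            also have "\<dots> \<le> \<delta> * 1" using \<delta> L0 by (intro mult_left_mono) (auto simp: divide_le_eq add_nonneg_pos)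
            finally show "L * (n * s) \<le> \<delta>" by simp
          qed
          also have "unit_ball_vol (real n) * (L * (n * s) / 2) ^ n = c * s ^ n"
            by (simp add: c_def power_mult_distrib power_divide)
          also have "ennreal (c * s ^ n) = ennreal c * emeasure lborel (cube u s)"
            using * c0 by (simp add: emeasure_cube n_def ennreal_mult)
          finally show "hausdorff_premeasure n \<delta> (f ` cube u s) \<le> ennreal c * emeasure lborel (cube u s)" .
        qed
      qed (use T \<delta> in auto)
      also have "\<dots> \<le> ennreal c * ennreal (e / (c + 1))" using Te by (rule mult_left_mono) simp
      also have "\<dots> = ennreal (e * (c / (c + 1)))" using c0 e by (simp add: ennreal_mult[symmetric] mult.commute)
      also have "\<dots> \<le> ennreal e"
      proof (rule ennreal_leI)
        have "e * (c / (c + 1)) \<le> e * 1" using e c0 by (intro mult_left_mono) auto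
        then show "e * (c / (c + 1)) \<le> e" by simp
      qed
      finally show "hausdorff_premeasure n \<delta> (f ` A) \<le> 0 + ennreal e" by simp
    qed
  qed
  then show "hausdorff_measure DIM('a) (f ` (N \<inter> ball 0 (real k))) = 0" by (simp add: A_def n_def)
qed

text \<open>
  If \<open>T\<close> kills \<open>e\<close>, then \<open>T (y - x)\<close> depends only on the projection of \<open>y - x\<close> along \<open>e\<close> onto a coordinate
  hyperplane. Cutting that hyperplane into a grid of mesh \<open>s/N\<close> divides the cube into at most
  \<open>(5N)\<^sup>n\<^sup>-\<^sup>1\<close> tubes, and the image of each tube has diameter \<open>O(s/N)\<close>. The total weight is thus \<open>O(s\<^sup>n/N)\<close>: the missing
  dimension gains one factor \<open>1/N\<close>.
\<close>

lemma hausdorff_premeasure_degenerate_cube: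
  fixes f T :: "'a::euclidean_space \<Rightarrow> 'b::real_normed_vector"
  defines "n \<equiv> DIM('a)"
  assumes s: "0 < s" and x: "x \<in> cube u s" and T: "linear T" and B: "0 \<le> B" "\<And>v. norm (T v) \<le> B * norm v"
    and e: "e \<noteq> 0" "T e = 0" and N: "1 \<le> (N::nat)"
    and approx: "\<And>y. y \<in> cube u s \<Longrightarrow> norm (f y - f x - T (y - x)) \<le> 1 / N * norm (y - x)"
    and \<delta>: "(B + 2) * n * s / N \<le> \<delta>"
  shows "hausdorff_premeasure n \<delta> (f ` cube u s)
     \<le> ennreal (5 ^ (n - 1) * unit_ball_vol (real n) * ((B + 2) * n / 2) ^ n / N) * emeasure lborel (cube u s)"
proof -
  let ?K = "cube u s"
  have n: "1 \<le> n" by (simp add: n_def Suc_leI)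
  \<comment> \<open>Project onto the hyperplane orthogonal to the coordinate in which \<open>e\<close> is largest, so that projecting along \<open>e\<close> at most doubles the coordinates.\<close>
  obtain i :: 'a where i: "i \<in> Basis" and imax: "\<And>j. j \<in> Basis \<Longrightarrow> \<bar>e \<bullet> j\<bar> \<le> \<bar>e \<bullet> i\<bar>"
  proof -
    have fin: "finite ((\<lambda>j. \<bar>e \<bullet> j\<bar>) ` Basis)" "(\<lambda>j. \<bar>e \<bullet> j\<bar>) ` (Basis::'a set) \<noteq> {}" by auto
    obtain i where i: "i \<in> Basis" "Max ((\<lambda>j. \<bar>e \<bullet> j\<bar>) ` Basis) = \<bar>e \<bullet> i\<bar>"
      using Max_in[OF fin] unfolding image_iff by blast
    show ?thesis
    proof (rule that[OF i(1)])
      fix j :: 'a assume "j \<in> Basis"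
      then have "\<bar>e \<bullet> j\<bar> \<in> (\<lambda>j. \<bar>e \<bullet> j\<bar>) ` Basis" by (rule imageI)
      then show "\<bar>e \<bullet> j\<bar> \<le> \<bar>e \<bullet> i\<bar>" using Max_ge[OF fin(1)] i(2) by metis
    qed
  qed
  have ei: "e \<bullet> i \<noteq> 0"
  proof
    assume ei0: "e \<bullet> i = 0"
    have "e \<bullet> j = 0" if "j \<in> Basis" for j using imax[OF that] ei0 by linarith
    then have "e = 0" using euclidean_eqI[of e 0] by simp
    then show False using e by simp
  qed
  define e' where "e' = (1 / (e \<bullet> i)) *\<^sub>R e"
  have e'i: "e' \<bullet> i = 1" using ei by (simp add: e'_def)
  have e'j: "\<bar>e' \<bullet> j\<bar> \<le> 1" if "j \<in> Basis" for j
    using imax[OF that] ei by (simp add: e'_def abs_mult field_simps)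
  have Te': "T e' = 0" using e(2) T by (simp add: e'_def linear_cmul)
  define p where "p y = (y - x) - ((y - x) \<bullet> i) *\<^sub>R e'" for y
  have Tp: "T (p y) = T (y - x)" for y using T Te' by (simp add: p_def linear_diff linear_cmul)
  have pi0: "p y \<bullet> i = 0" for y by (simp add: p_def inner_diff_left e'i)
  have yx: "\<bar>(y - x) \<bullet> j\<bar> \<le> s" if "y \<in> ?K" "j \<in> Basis" for y j
  proof -
    have "u \<bullet> j \<le> x \<bullet> j \<and> x \<bullet> j \<le> u \<bullet> j + s" "u \<bullet> j \<le> y \<bullet> j \<and> y \<bullet> j \<le> u \<bullet> j + s"
      using x that by (auto simp: mem_box inner_add_left)
    then show ?thesis by (simp add: inner_diff_left abs_le_iff)
  qed
  have pj: "\<bar>p y \<bullet> j\<bar> \<le> 2 * s" if "y \<in> ?K" "j \<in> Basis" for y j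
  proof -
    have "\<bar>((y - x) \<bullet> i) * (e' \<bullet> j)\<bar> \<le> s * 1"
      unfolding abs_mult using yx[OF that(1) i] e'j[OF that(2)] s by (intro mult_mono) auto
    then show ?thesis using yx[OF that] by (simp add: p_def inner_diff_left[of _ _ j])
  qed
  define m where "m y = restrict (\<lambda>j. \<lfloor>(p y \<bullet> j) * N / s\<rfloor>) (Basis - {i})" for y
  define G where "G = PiE (Basis - {i}) (\<lambda>_::'a. {- 2 * int N .. 2 * int N})"
  have finG: "finite G" unfolding G_def by (intro finite_PiE) auto
  have cardG: "card G = (4 * N + 1) ^ (n - 1)"
  proof -
    have "nat (4 * int N + 1) = 4 * N + 1" by simp
    then show ?thesis using i by (simp add: G_def card_PiE n_def card_Diff_singleton del: One_nat_def)
  qed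
  have mG: "m y \<in> G" if y: "y \<in> ?K" for y
  proof -
    have "\<lfloor>(p y \<bullet> j) * N / s\<rfloor> \<in> {- 2 * int N .. 2 * int N}" if "j \<in> Basis" for j
    proof -
      have "\<bar>(p y \<bullet> j) * N / s\<bar> \<le> 2 * N"
        using mult_right_mono[OF pj[OF y that], of "real N"] s by (simp add: abs_mult divide_le_eq mult_ac)
      then have b: "- (2 * real N) \<le> (p y \<bullet> j) * N / s" "(p y \<bullet> j) * N / s \<le> 2 * real N" by linarith+
      have "- 2 * int N \<le> \<lfloor>(p y \<bullet> j) * N / s\<rfloor>" using b(1) by (simp add: le_floor_iff)
      moreover have "\<lfloor>(p y \<bullet> j) * N / s\<rfloor> \<le> 2 * int N" using b(2) by (simp add: floor_le_iff)
      ultimately show ?thesis by simp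
    qed
    then show ?thesis by (auto simp: m_def G_def)
  qed
  define D where "D = (B + 2) * n * s / N"
  have D0: "0 \<le> D" using s B by (simp add: D_def)
  have close: "dist (f y) (f z) \<le> D" if yz: "y \<in> ?K" "z \<in> ?K" "m y = m z" for y z
  proof -
    have "norm (p y - p z) \<le> (\<Sum>j\<in>Basis. \<bar>(p y - p z) \<bullet> j\<bar>)" by (rule norm_le_l1)
    also have "\<dots> \<le> (\<Sum>j\<in>(Basis::'a set). s / N)"
    proof (rule sum_mono)
      fix j :: 'a assume j: "j \<in> Basis"
      show "\<bar>(p y - p z) \<bullet> j\<bar> \<le> s / N"
      proof (cases "j = i")
        case True
        then show ?thesis using pi0 s by (simp add: inner_diff_left)
      next
        case False
        then have "m y j = \<lfloor>(p y \<bullet> j) * N / s\<rfloor>" "m z j = \<lfloor>(p z \<bullet> j) * N / s\<rfloor>" using j by (auto simp: m_def)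
        then have "\<lfloor>(p y \<bullet> j) * N / s\<rfloor> = \<lfloor>(p z \<bullet> j) * N / s\<rfloor>" using yz(3) by simp
        then have "\<bar>(p y \<bullet> j) * N / s - (p z \<bullet> j) * N / s\<bar> \<le> 1" by linarith
        then have "\<bar>((p y - p z) \<bullet> j) * (N / s)\<bar> \<le> 1" by (simp add: inner_diff_left left_diff_distrib diff_divide_distrib)
        then have "\<bar>(p y - p z) \<bullet> j\<bar> * (N / s) \<le> 1" using s by (simp add: abs_mult)
        then show ?thesis using s N by (simp add: field_simps)
      qed
    qed
    also have "\<dots> = n * (s / N)" by (simp add: n_def)
    finally have pp: "norm (p y - p z) \<le> n * (s / N)" .
    have "T (y - z) = T (p y - p z)"
      using Tp[of y] Tp[of z] T by (simp add: linear_diff)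
    then have "norm (T (y - z)) \<le> B * norm (p y - p z)" using B(2)[of "p y - p z"] by simp
    also have "\<dots> \<le> B * (n * (s / N))" using pp B by (intro mult_left_mono) auto
    finally have t1: "norm (T (y - z)) \<le> B * n * s / N" by simp
    have nyx: "norm (y' - x) \<le> n * s" if "y' \<in> ?K" for y'
      using dist_in_cube_le[OF that x] by (simp add: dist_norm n_def)
    have t2: "norm (f y' - f x - T (y' - x)) \<le> n * s / N" if "y' \<in> ?K" for y'
    proof -
      have "norm (f y' - f x - T (y' - x)) \<le> 1 / N * norm (y' - x)" by (rule approx[OF that])
      also have "\<dots> \<le> 1 / N * (n * s)" using nyx[OF that] by (intro mult_left_mono) auto
      finally show ?thesis by simp
    qed
    have tri: "norm (a - b + c) \<le> norm a + norm b + norm c" for a b c :: 'b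
      using norm_triangle_ineq[of "a - b" c] norm_triangle_ineq4[of a b] by linarith
    have "f y - f z = (f y - f x - T (y - x)) - (f z - f x - T (z - x)) + T (y - z)"
      using T by (simp add: linear_diff)
    then have "norm (f y - f z) \<le> norm (f y - f x - T (y - x)) + norm (f z - f x - T (z - x)) + norm (T (y - z))"
      using tri by (simp only:)
    also have "\<dots> \<le> n * s / N + n * s / N + B * n * s / N" using t1 t2 yz by (intro add_mono) auto
    also have "\<dots> = D" by (simp add: D_def algebra_simps add_divide_distrib)
    finally show ?thesis by (simp add: dist_norm)
  qed
  have \<delta>0: "0 \<le> \<delta>" using D0 \<delta> by (simp add: D_def)
  have "hausdorff_premeasure n \<delta> (f ` ?K) \<le> hausdorff_premeasure n \<delta> (\<Union>g\<in>G. f ` {y\<in>?K. m y = g})"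
    by (rule hausdorff_premeasure_mono) (use mG in auto)
  also have "\<dots> \<le> (\<Sum>g\<in>G. hausdorff_premeasure n \<delta> (f ` {y\<in>?K. m y = g}))"
    by (rule hausdorff_premeasure_finite_UN[OF finG \<delta>0])
  also have "\<dots> \<le> (\<Sum>g\<in>G. ennreal (unit_ball_vol (real n) * (D / 2) ^ n))"
    by (intro sum_mono hausdorff_premeasure_le_diameter_bound n D0) (use close \<delta> in \<open>auto simp: D_def\<close>)
  also have "\<dots> = ennreal (real (card G) * (unit_ball_vol (real n) * (D / 2) ^ n))"
    using D0 by (simp add: ennreal_mult ennreal_of_nat_eq_real_of_nat)
  also have "\<dots> \<le> ennreal ((5 ^ (n - 1) * unit_ball_vol (real n) * ((B + 2) * n / 2) ^ n / N) * s ^ n)"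
  proof (rule ennreal_leI)
    have "real (card G) \<le> (5 * real N) ^ (n - 1)"
      unfolding cardG of_nat_power using N by (intro power_mono) auto
    then have "real (card G) * (unit_ball_vol (real n) * (D / 2) ^ n) \<le> (5 * real N) ^ (n - 1) * (unit_ball_vol (real n) * (D / 2) ^ n)"
      using D0 by (intro mult_right_mono) auto
    also have "\<dots> = (5 ^ (n - 1) * unit_ball_vol (real n) * ((B + 2) * n / 2) ^ n * s ^ n) * (real N ^ (n - 1) / real N ^ n)"
      by (simp add: D_def power_mult_distrib power_divide mult_ac)
    also have "real N ^ (n - 1) / real N ^ n = 1 / N"
    proof -
      obtain m where "n = Suc m" using n by (cases n) auto
      then show ?thesis using N by simp
    qed
    finally show "real (card G) * (unit_ball_vol (real n) * (D / 2) ^ n)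
      \<le> (5 ^ (n - 1) * unit_ball_vol (real n) * ((B + 2) * n / 2) ^ n / N) * s ^ n" by simp
  qed
  also have "\<dots> = ennreal (5 ^ (n - 1) * unit_ball_vol (real n) * ((B + 2) * n / 2) ^ n / N) * emeasure lborel ?K"
    unfolding emeasure_cube[OF less_imp_le[OF s]] n_def[symmetric] using s B by (intro ennreal_mult) auto
  finally show ?thesis .
qed

text \<open>
  A Sard-type statement. The sets \<open>P B\<close>, on which
  the operator norm of the derivative is at most \<open>B\<close>, make the constant of the previous lemma uniform; the
  accuracy \<open>1/N\<close> of the linear approximation may hold on a neighbourhood depending on the point.
\<close>

theorem hausdorff_null_critical_values:
  fixes f :: "'a::euclidean_space \<Rightarrow> 'b::real_normed_vector"
  assumes crit: "\<And>x. x \<in> A \<Longrightarrow> \<exists>f' e. (f has_derivative f') (at x) \<and> e \<noteq> 0 \<and> f' e = 0"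
  shows "hausdorff_measure DIM('a) (f ` A) = 0"
proof -
  define n where "n = DIM('a)"
  define P where "P B = {x\<in>A. norm x < real B \<and> (\<exists>f' e. (f has_derivative f') (at x) \<and> e \<noteq> 0 \<and> f' e = 0 \<and> (\<forall>v. norm (f' v) \<le> real B * norm v))}" for B :: nat
  have "A \<subseteq> (\<Union>B. P B)"
  proof
    fix x assume x: "x \<in> A"
    then obtain f' e where f': "(f has_derivative f') (at x)" "e \<noteq> 0" "f' e = 0" using crit by blast
    obtain K where K: "\<And>v. norm (f' v) \<le> norm v * K" using bounded_linear.bounded[OF has_derivative_bounded_linear[OF f'(1)]] by blast
    obtain B where B: "max K (norm x) < real B" using reals_Archimedean2 by blast
    have "norm (f' v) \<le> real B * norm v" for v
    proof -
      have "norm v * K \<le> norm v * real B" using B by (intro mult_left_mono) auto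
      then show ?thesis using K[of v] by (simp add: mult.commute)
    qed
    then have "x \<in> P B" using x f' B unfolding P_def by auto
    then show "x \<in> (\<Union>B. P B)" by blast
  qed
  then have "hausdorff_measure n (f ` A) \<le> hausdorff_measure n (\<Union>B. f ` P B)" by (intro hausdorff_measure_mono) blast
  moreover have "hausdorff_measure n (f ` P B) = 0" for B
  proof -
    have "hausdorff_measure n (f ` P B) \<le> 0"
    proof (rule hausdorff_measure_leI)
      fix \<delta> :: real assume \<delta>: "0 < \<delta>"
      define C where "C = 5 ^ (n - 1) * unit_ball_vol (real n) * ((real B + 2) * n / 2) ^ n"
      have C0: "0 \<le> C" by (simp add: C_def)
      define M where "M = measure lborel (ball 0 (real B) :: 'a set)"
      have M: "emeasure lborel (ball 0 (real B) :: 'a set) = ennreal M"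
        unfolding M_def by (rule emeasure_eq_ennreal_measure) (simp add: emeasure_ball less_top[symmetric])
      have est: "hausdorff_premeasure n \<delta> (f ` P B) \<le> ennreal (C / N * M)" if N: "1 \<le> N" for N :: nat
      proof -
        have "hausdorff_premeasure n \<delta> (f ` P B) \<le> ennreal (C / N) * emeasure lborel (ball 0 (real B) :: 'a set)"
        proof (rule hausdorff_premeasure_image_le_of_cubes)
          show "bounded (P B)" by (rule bounded_subset[of "ball 0 (real B)"]) (auto simp: P_def)
          show "P B \<subseteq> ball 0 (real B)" by (auto simp: P_def)
          fix x assume "x \<in> P B"
          then obtain f' e where f': "(f has_derivative f') (at x)" "e \<noteq> 0" "f' e = 0" "\<And>v. norm (f' v) \<le> real B * norm v"
            by (auto simp: P_def)
          have "0 < 1 / real N" using N by simp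
          then obtain d where d: "0 < d" "\<And>y. norm (y - x) < d \<Longrightarrow> norm (f y - f x - f' (y - x)) \<le> 1 / real N * norm (y - x)"
            using f'(1) unfolding has_derivative_at_alt by metis
          define r where "r = min d (\<delta> / (2 * ((real B + 2) * n) + 1))"
          have r: "0 < r" using d \<delta> by (simp add: r_def add_nonneg_pos)
          show "\<exists>r>0. \<forall>u s. 0 < s \<and> x \<in> cube u s \<and> cube u s \<subseteq> ball x r \<longrightarrow>
             hausdorff_premeasure n \<delta> (f ` cube u s) \<le> ennreal (C / N) * emeasure lborel (cube u s)"
          proof (intro exI[of _ r] conjI allI impI r)
            fix u s assume *: "0 < s \<and> x \<in> cube u s \<and> cube u s \<subseteq> ball x r"
            have s: "s \<le> 2 * r" using * cube_side_le_radius by blast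
            show "hausdorff_premeasure n \<delta> (f ` cube u s) \<le> ennreal (C / N) * emeasure lborel (cube u s)"
              unfolding C_def n_def
            proof (rule hausdorff_premeasure_degenerate_cube[of s x u f' "real B" e])
              show "linear f'" using f'(1) has_derivative_linear by blast
              show "norm (f y - f x - f' (y - x)) \<le> 1 / real N * norm (y - x)" if "y \<in> cube u s" for y
              proof (rule d(2))
                have "y \<in> ball x r" using * that by blast
                then show "norm (y - x) < d" by (simp add: r_def dist_norm norm_minus_commute)
              qed
              have "(real B + 2) * n * s / N \<le> (real B + 2) * n * s / 1" using N * by (intro divide_left_mono) auto
              also have "\<dots> \<le> (real B + 2) * n * (2 * r)" using s by (simp add: mult_left_mono)
              also have "\<dots> \<le> (real B + 2) * n * (2 * (\<delta> / (2 * ((real B + 2) * n) + 1)))"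
                by (intro mult_left_mono) (auto simp: r_def)
              also have "\<dots> = \<delta> * (2 * ((real B + 2) * n) / (2 * ((real B + 2) * n) + 1))" by simp
              also have "\<dots> \<le> \<delta> * 1" using \<delta> by (intro mult_left_mono) (auto simp: divide_le_eq add_nonneg_pos)
              finally show "(real B + 2) * real DIM('a) * s / real N \<le> \<delta>" by (simp add: n_def)
            qed (use * N f' in auto)
          qed
        qed (use \<delta> in auto)
        also have "\<dots> = ennreal (C / N * M)" unfolding M using C0 by (intro ennreal_mult[symmetric]) (auto simp: M_def)
        finally show ?thesis .
      qed
      show "hausdorff_premeasure n \<delta> (f ` P B) \<le> 0"
      proof (rule ennreal_le_epsilon)
        fix e :: real assume e: "0 < e"
        obtain N where N: "C * M / e < real N" using reals_Archimedean2 by blast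
        have CM: "0 \<le> C * M" using C0 by (simp add: M_def)
        then have "0 \<le> C * M / e" using e by simp
        then have N1: "1 \<le> N" using N by (cases N) auto
        have "C / N * M \<le> e" using N N1 e by (simp add: field_simps)
        then show "hausdorff_premeasure n \<delta> (f ` P B) \<le> 0 + ennreal e"
          using est[OF N1] by (auto intro: order_trans ennreal_leI)
      qed
    qed
    then show ?thesis by simp
  qed
  ultimately show ?thesis using hausdorff_measure_null_UN[of n "\<lambda>B. f ` P B"] by (simp add: n_def)
qed

section \<open>Independent families and distributions\<close>

text \<open>
  Frames of distributions are indexed by numbers and repetitions matter when they are perturbed, so
  independence is a property of the family and not of its range.
\<close>

definition independent_family :: "nat \<Rightarrow> (nat \<Rightarrow> 'a::real_vector) \<Rightarrow> bool" where
  "independent_family k v \<longleftrightarrow> (\<forall>c. (\<Sum>i<k. c i *\<^sub>R v i) = 0 \<longrightarrow> (\<forall>i<k. c i = 0))"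

lemma in_span_family_iff:
  "u \<in> span (v ` {..<k::nat}) \<longleftrightarrow> (\<exists>c. u = (\<Sum>i<k. c i *\<^sub>R v i))"
proof
  assume "u \<in> span (v ` {..<k})"
  moreover have "span (v ` {..<k}) \<subseteq> {u. \<exists>c. u = (\<Sum>i<k. c i *\<^sub>R v i)}"
  proof (rule span_minimal)
    show "v ` {..<k} \<subseteq> {u. \<exists>c. u = (\<Sum>i<k. c i *\<^sub>R v i)}"
    proof
      fix w assume "w \<in> v ` {..<k}"
      then obtain j where j: "j < k" "w = v j" by blast
      have "(\<Sum>i<k. (if i = j then 1 else 0) *\<^sub>R v i) = (\<Sum>i<k. if i = j then v i else 0)"
        by (rule sum.cong) auto
      also have "\<dots> = w" using j by (simp add: sum.delta)
      finally have "w = (\<Sum>i<k. (if i = j then 1 else 0) *\<^sub>R v i)" ..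
      then show "w \<in> {u. \<exists>c. u = (\<Sum>i<k. c i *\<^sub>R v i)}"
        by (intro CollectI exI[of _ "\<lambda>i. if i = j then 1 else 0"])
    qed
    show "subspace {u. \<exists>c. u = (\<Sum>i<k. c i *\<^sub>R v i)}"
    proof (rule subspaceI)
      show "0 \<in> {u. \<exists>c. u = (\<Sum>i<k. c i *\<^sub>R v i)}" by (intro CollectI exI[of _ "\<lambda>_. 0"]) simp
      fix x y :: 'a and r :: real assume "x \<in> {u. \<exists>c. u = (\<Sum>i<k. c i *\<^sub>R v i)}"
      then obtain c where x: "x = (\<Sum>i<k. c i *\<^sub>R v i)" by blast
      show "r *\<^sub>R x \<in> {u. \<exists>c. u = (\<Sum>i<k. c i *\<^sub>R v i)}"
        by (intro CollectI exI[of _ "\<lambda>i. r * c i"]) (simp add: x scaleR_sum_right)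
      assume "y \<in> {u. \<exists>c. u = (\<Sum>i<k. c i *\<^sub>R v i)}"
      then obtain d where y: "y = (\<Sum>i<k. d i *\<^sub>R v i)" by blast
      show "x + y \<in> {u. \<exists>c. u = (\<Sum>i<k. c i *\<^sub>R v i)}"
        by (intro CollectI exI[of _ "\<lambda>i. c i + d i"]) (simp add: x y scaleR_left_distrib sum.distrib)
    qed
  qed
  ultimately show "\<exists>c. u = (\<Sum>i<k. c i *\<^sub>R v i)" by blast
next
  assume "\<exists>c. u = (\<Sum>i<k. c i *\<^sub>R v i)"
  then obtain c where u: "u = (\<Sum>i<k. c i *\<^sub>R v i)" by blast
  show "u \<in> span (v ` {..<k})" unfolding u by (intro span_sum span_scale span_base) auto
qed

lemma independent_family_iff:
  fixes v :: "nat \<Rightarrow> 'a::euclidean_space"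
  shows "independent_family k v \<longleftrightarrow> inj_on v {..<k} \<and> independent (v ` {..<k})"
proof (intro iffI conjI)
  assume ind: "independent_family k v"
  show inj: "inj_on v {..<k}"
  proof (rule inj_onI, rule ccontr)
    fix i j assume ij: "i \<in> {..<k}" "j \<in> {..<k}" "v i = v j" "i \<noteq> j"
    define c where "c l = (if l = i then 1 else 0) - (if l = j then 1 else (0::real))" for l
    have "(\<Sum>l<k. c l *\<^sub>R v l) = (\<Sum>l<k. if l = i then v l else 0) - (\<Sum>l<k. if l = j then v l else 0)"
      unfolding sum_subtractf[symmetric] by (rule sum.cong) (auto simp: c_def)
    also have "\<dots> = v i - v j" using ij by (simp add: sum.delta)
    finally have "(\<Sum>l<k. c l *\<^sub>R v l) = 0" using ij by simp
    then have "c i = 0" using ind ij unfolding independent_family_def by blast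
    then show False using ij by (simp add: c_def)
  qed
  show "independent (v ` {..<k})"
    unfolding independent_explicit
  proof (intro conjI allI impI ballI)
    fix c u assume "(\<Sum>w\<in>v ` {..<k}. c w *\<^sub>R w) = 0" and u: "u \<in> v ` {..<k}"
    then have "(\<Sum>i<k. c (v i) *\<^sub>R v i) = 0" by (simp add: sum.reindex[OF inj])
    then have "\<forall>i<k. c (v i) = 0" using ind unfolding independent_family_def by (elim allE[of _ "\<lambda>i. c (v i)"]) simp
    then show "c u = 0" using u by auto
  qed simp
next
  assume "inj_on v {..<k} \<and> independent (v ` {..<k})"
  then have inj: "inj_on v {..<k}" and ind: "independent (v ` {..<k})" by auto
  show "independent_family k v"
    unfolding independent_family_def
  proof (intro allI impI)
    fix c i assume c: "(\<Sum>i<k. c i *\<^sub>R v i) = 0" and i: "i < k"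
    define c' where "c' u = c (the_inv_into {..<k} v u)" for u
    have c': "c' (v i) = c i" if "i < k" for i using the_inv_into_f_f[OF inj] that by (simp add: c'_def)
    have "(\<Sum>w\<in>v ` {..<k}. c' w *\<^sub>R w) = (\<Sum>i<k. c i *\<^sub>R v i)"
      unfolding sum.reindex[OF inj] by (rule sum.cong) (auto simp: c')
    then have "\<forall>u\<in>v ` {..<k}. c' u = 0" using ind c unfolding independent_explicit by auto
    then show "c i = 0" using c'[OF i] i by auto
  qed
qed

lemma dim_span_family:
  fixes v :: "nat \<Rightarrow> 'a::euclidean_space"
  shows "dim (span (v ` {..<k})) = k \<longleftrightarrow> independent_family k v"
proof
  assume d: "dim (span (v ` {..<k})) = k"
  have "dim (v ` {..<k}) \<le> card (v ` {..<k})" by (rule dim_le_card') simp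
  moreover have le: "card (v ` {..<k}) \<le> k" using card_image_le[of "{..<k}" v] by simp
  ultimately have c: "card (v ` {..<k}) = k" using d by (simp add: dim_span)
  then have "inj_on v {..<k}" by (intro eq_card_imp_inj_on) auto
  moreover have "independent (v ` {..<k})"
    by (rule card_le_dim_spanning[of _ "span (v ` {..<k})"]) (use c d in \<open>auto simp: span_superset\<close>)
  ultimately show "independent_family k v" by (simp add: independent_family_iff)
next
  assume "independent_family k v"
  then have "inj_on v {..<k}" "independent (v ` {..<k})" by (auto simp: independent_family_iff)
  then show "dim (span (v ` {..<k})) = k" by (simp add: dim_span dim_eq_card_independent card_image)
qed

lemma independent_family_dual:
  fixes v :: "nat \<Rightarrow> 'a::euclidean_space"
  assumes "independent_family k v"
  obtains g :: "nat \<Rightarrow> 'a \<Rightarrow> real" where "\<And>j. j < k \<Longrightarrow> bounded_linear (g j)"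
    "\<And>i j. j < k \<Longrightarrow> i < k \<Longrightarrow> g j (v i) = (if i = j then 1 else 0)"
    "\<And>u. u \<in> span (v ` {..<k}) \<Longrightarrow> u = (\<Sum>i<k. g i u *\<^sub>R v i)"
proof -
  have inj: "inj_on v {..<k}" and indep: "independent (v ` {..<k})" using assms by (auto simp: independent_family_iff)
  have "\<exists>g. linear g \<and> (\<forall>i<k. g (v i) = (if i = j then 1 else (0::real)))" if j: "j < k" for j
  proof -
    obtain g where g: "linear g" "\<forall>x\<in>v ` {..<k}. g x = (if x = v j then 1 else (0::real))"
      using linear_independent_extend[OF indep, of "\<lambda>x. if x = v j then 1 else 0"] by blast
    have "g (v i) = (if i = j then 1 else 0)" if "i < k" for i
      using g(2) that j inj_on_eq_iff[OF inj, of i j] by auto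
    then show ?thesis using g(1) by blast
  qed
  then obtain g where g: "\<And>j. j < k \<Longrightarrow> linear (g j)" "\<And>i j. j < k \<Longrightarrow> i < k \<Longrightarrow> g j (v i) = (if i = j then 1 else (0::real))"
    by metis
  show ?thesis
  proof (rule that)
    show "bounded_linear (g j)" if "j < k" for j using g(1)[OF that] by (simp add: linear_linear)
    show "g j (v i) = (if i = j then 1 else 0)" if "j < k" "i < k" for i j by (rule g(2)[OF that])
    fix u assume "u \<in> span (v ` {..<k})"
    then obtain c where u: "u = (\<Sum>i<k. c i *\<^sub>R v i)" unfolding in_span_family_iff by blast
    have "g j u = c j" if j: "j < k" for j
    proof -
      have "g j u = (\<Sum>i<k. c i * g j (v i))" unfolding u
        by (simp add: linear_sum[OF g(1)[OF j]] linear_cmul[OF g(1)[OF j]])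
      also have "\<dots> = (\<Sum>i<k. if i = j then c i else 0)" by (rule sum.cong) (use g(2) j in auto)
      also have "\<dots> = c j" using j by (simp add: sum.delta)
      finally show ?thesis .
    qed
    then show "u = (\<Sum>i<k. g i u *\<^sub>R v i)" unfolding u by (intro sum.cong) (auto simp: u[symmetric])
  qed
qed

text \<open>
  With the dual functionals \<open>g j\<close> of \<open>v\<close>, the matrix of the values \<open>g j (w i)\<close> is close to the identity,
  hence diagonally dominant: evaluate a vanishing combination at the \<open>g j\<close> for which \<open>\<bar>c j\<bar>\<close> is largest.
\<close>

lemma independent_family_perturb:
  fixes v :: "nat \<Rightarrow> 'a::euclidean_space"
  assumes ind: "independent_family k v"
  obtains \<epsilon> where "0 < \<epsilon>" "\<And>w. (\<And>i. i < k \<Longrightarrow> norm (w i - v i) < \<epsilon>) \<Longrightarrow> independent_family k w"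
proof -
  obtain g where g: "\<And>j. j < k \<Longrightarrow> bounded_linear (g j)"
    "\<And>i j. j < k \<Longrightarrow> i < k \<Longrightarrow> g j (v i) = (if i = j then 1 else (0::real))"
    by (rule independent_family_dual[OF ind]) blast
  have "\<exists>M. \<forall>x. \<bar>g j x\<bar> \<le> M * norm x" if "j < k" for j
    using bounded_linear.bounded[OF g(1)[OF that]] by (metis real_norm_def mult.commute)
  then obtain M where M: "\<And>j x. j < k \<Longrightarrow> \<bar>g j x\<bar> \<le> M j * norm x" by metis
  define S where "S = (\<Sum>j<k. \<bar>M j\<bar>) + 1"
  have S: "S > 0" "\<And>j. j < k \<Longrightarrow> M j \<le> S"
  proof -
    show "S > 0" by (simp add: S_def sum_nonneg add_nonneg_pos)
    fix j assume "j < k"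
    then have "\<bar>M j\<bar> \<le> (\<Sum>j<k. \<bar>M j\<bar>)" by (intro member_le_sum) auto
    then show "M j \<le> S" by (simp add: S_def)
  qed
  define \<epsilon> where "\<epsilon> = 1 / (2 * S * (real k + 1))"
  have \<epsilon>: "0 < \<epsilon>" using S by (simp add: \<epsilon>_def)
  show ?thesis
  proof (rule that[OF \<epsilon>])
    fix w assume w: "\<And>i. i < k \<Longrightarrow> norm (w i - v i) < \<epsilon>"
    show "independent_family k w"
      unfolding independent_family_def
    proof (intro allI impI, rule ccontr)
      fix c i assume c: "(\<Sum>i<k. c i *\<^sub>R w i) = 0" and i: "i < k" and ci: "c i \<noteq> 0"
      have fin: "finite ((\<lambda>l. \<bar>c l\<bar>) ` {..<k})" "(\<lambda>l. \<bar>c l\<bar>) ` {..<k} \<noteq> {}" using i by auto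
      obtain j where j: "j < k" "Max ((\<lambda>l. \<bar>c l\<bar>) ` {..<k}) = \<bar>c j\<bar>"
        using Max_in[OF fin] unfolding image_iff by blast
      have cj: "\<bar>c l\<bar> \<le> \<bar>c j\<bar>" if "l < k" for l
      proof -
        have "\<bar>c l\<bar> \<in> (\<lambda>l. \<bar>c l\<bar>) ` {..<k}" using that by simp
        then have "\<bar>c l\<bar> \<le> Max ((\<lambda>l. \<bar>c l\<bar>) ` {..<k})" by (rule Max_ge[OF fin(1)])
        then show ?thesis using j(2) by linarith
      qed
      have pos: "0 < \<bar>c j\<bar>" using cj[OF i] ci by linarith
      interpret g: bounded_linear "g j" by (rule g(1)[OF j(1)])
      have "0 = g j (\<Sum>l<k. c l *\<^sub>R w l)" by (simp add: c g.zero)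
      also have "\<dots> = (\<Sum>l<k. c l * g j (w l))" by (simp add: g.sum g.scaleR)
      also have "\<dots> = (\<Sum>l<k. c l * g j (v l)) + (\<Sum>l<k. c l * g j (w l - v l))"
        unfolding sum.distrib[symmetric] by (rule sum.cong) (auto simp: g.diff algebra_simps)
      also have "(\<Sum>l<k. c l * g j (v l)) = (\<Sum>l<k. if l = j then c l else 0)"
        by (rule sum.cong) (use g(2) j in auto)
      also have "\<dots> = c j" using j by (simp add: sum.delta)
      finally have "\<bar>c j\<bar> = \<bar>\<Sum>l<k. c l * g j (w l - v l)\<bar>" by linarith
      also have "\<dots> \<le> (\<Sum>l<k. \<bar>c l * g j (w l - v l)\<bar>)" by (rule sum_abs)
      also have "\<dots> \<le> (\<Sum>l<k. \<bar>c j\<bar> * (S * \<epsilon>))"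
      proof (rule sum_mono)
        fix l assume "l \<in> {..<k}"
        then have l: "l < k" by simp
        have "\<bar>g j (w l - v l)\<bar> \<le> M j * norm (w l - v l)" by (rule M[OF j(1)])
        also have "\<dots> \<le> S * \<epsilon>" using S j w[OF l] by (intro mult_mono) auto
        finally show "\<bar>c l * g j (w l - v l)\<bar> \<le> \<bar>c j\<bar> * (S * \<epsilon>)"
          unfolding abs_mult using cj[OF l] by (intro mult_mono) auto
      qed
      also have "\<dots> = \<bar>c j\<bar> * (real k * (S * \<epsilon>))" by simp
      also have "real k * (S * \<epsilon>) = real k / (2 * (real k + 1))" using S by (simp add: \<epsilon>_def)
      also have "\<bar>c j\<bar> * (real k / (2 * (real k + 1))) < \<bar>c j\<bar> * 1"
        using pos by (intro mult_strict_left_mono) (auto simp: divide_less_eq)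
      finally show False by simp
    qed
  qed
qed

lemma independent_family_eventually:
  fixes v :: "nat \<Rightarrow> 'b \<Rightarrow> 'a::euclidean_space"
  assumes "independent_family k v0" and lim: "\<And>i. i < k \<Longrightarrow> (v i \<longlongrightarrow> v0 i) F"
  shows "\<forall>\<^sub>F x in F. independent_family k (\<lambda>i. v i x)"
proof -
  obtain \<epsilon> where \<epsilon>: "0 < \<epsilon>" "\<And>w. (\<And>i. i < k \<Longrightarrow> norm (w i - v0 i) < \<epsilon>) \<Longrightarrow> independent_family k w"
    using independent_family_perturb[OF assms(1)] by blast
  have "\<forall>\<^sub>F x in F. \<forall>i\<in>{..<k}. norm (v i x - v0 i) < \<epsilon>"
    unfolding eventually_ball_finite_distrib[OF finite_lessThan]
    using lim \<epsilon>(1) by (auto simp: tendsto_iff dist_norm)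
  then show ?thesis by eventually_elim (use \<epsilon>(2) in auto)
qed

text \<open>
  If \<open>u0\<close> were outside the span, adding it to the family would preserve independence, and by openness
  of independence \<open>u x\<close> would eventually be independent of the \<open>v i x\<close>.
\<close>

lemma span_family_closed:
  fixes v :: "nat \<Rightarrow> 'b \<Rightarrow> 'a::euclidean_space"
  assumes ind: "independent_family k v0" and lim: "\<And>i. i < k \<Longrightarrow> (v i \<longlongrightarrow> v0 i) F"
    and u: "(u \<longlongrightarrow> u0) F" and mem: "\<forall>\<^sub>F x in F. u x \<in> span ((\<lambda>i. v i x) ` {..<k})" and "F \<noteq> bot"
  shows "u0 \<in> span (v0 ` {..<k})"
proof (rule ccontr)
  assume u0: "u0 \<notin> span (v0 ` {..<k})"
  define w0 where "w0 i = (if i < k then v0 i else u0)" for i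
  define w where "w i x = (if i < k then v i x else u x)" for i x
  have "independent_family (Suc k) w0"
    unfolding independent_family_def
  proof (intro allI impI)
    fix c i assume "(\<Sum>i<Suc k. c i *\<^sub>R w0 i) = 0" and i: "i < Suc k"
    then have s: "(\<Sum>i<k. c i *\<^sub>R v0 i) + c k *\<^sub>R u0 = 0" by (simp add: w0_def)
    have ck: "c k = 0"
    proof (rule ccontr)
      assume ck: "c k \<noteq> 0"
      have "u0 = (- 1 / c k) *\<^sub>R (\<Sum>i<k. c i *\<^sub>R v0 i)"
        using s ck by (simp add: add_eq_0_iff2)
      also have "\<dots> \<in> span (v0 ` {..<k})" by (intro span_scale span_sum span_base) auto
      finally show False using u0 by blast
    qed
    then have "\<forall>i<k. c i = 0" using s ind unfolding independent_family_def by simp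
    then show "c i = 0" using ck i by (auto simp: less_Suc_eq)
  qed
  moreover have "(w i \<longlongrightarrow> w0 i) F" for i
    using lim u by (cases "i < k") (auto simp: w_def[abs_def] w0_def)
  ultimately have "\<forall>\<^sub>F x in F. independent_family (Suc k) (\<lambda>i. w i x)"
    by (intro independent_family_eventually) auto
  with mem have "\<forall>\<^sub>F x in F. False"
  proof eventually_elim
    case (elim x)
    then obtain c where c: "u x = (\<Sum>i<k. c i *\<^sub>R v i x)" unfolding in_span_family_iff by blast
    define c' where "c' i = (if i < k then c i else -1)" for i
    have "(\<Sum>i<Suc k. c' i *\<^sub>R w i x) = 0" by (simp add: c'_def w_def c)
    then have "c' k = 0" using elim(2) unfolding independent_family_def by blast
    then show False by (simp add: c'_def)
  qed
  then show False using \<open>F \<noteq> bot\<close> by (simp add: eventually_False)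
qed

lemma C1_on_imp_isCont: "C1_on U f \<Longrightarrow> x \<in> U \<Longrightarrow> isCont f x"
  unfolding C1_on_def using has_derivative_continuous by blast

lemma C1_distribution_frame:
  assumes "C1_distribution_on U k V"
  obtains X where "\<And>i. i < k \<Longrightarrow> C1_on U (X i)" "\<And>x. x \<in> U \<Longrightarrow> V x = span ((\<lambda>i. X i x) ` {..<k})"
    "\<And>x. x \<in> U \<Longrightarrow> independent_family k (\<lambda>i. X i x)"
proof -
  obtain X where X: "\<forall>i<k. C1_on U (X i)" "\<forall>x\<in>U. V x = span ((\<lambda>i. X i x) ` {..<k})"
    using assms unfolding C1_distribution_on_def by blast
  have "independent_family k (\<lambda>i. X i x)" if "x \<in> U" for x
  proof -
    have "dim (V x) = k" using assms that unfolding C1_distribution_on_def distribution_on_def by blast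
    then show ?thesis using X(2) that dim_span_family[of "\<lambda>i. X i x" k] by simp
  qed
  then show ?thesis using that X by blast
qed

lemma C1_distribution_closed:
  assumes V: "C1_distribution_on U k V" and x: "x \<in> U" "\<forall>\<^sub>F n in F. z n \<in> U" and z: "(z \<longlongrightarrow> x) F"
    and u: "(u \<longlongrightarrow> u0) F" and mem: "\<forall>\<^sub>F n in F. u n \<in> V (z n)" and "F \<noteq> bot"
  shows "u0 \<in> V x"
proof -
  obtain X where X: "\<And>i. i < k \<Longrightarrow> C1_on U (X i)" "\<And>x. x \<in> U \<Longrightarrow> V x = span ((\<lambda>i. X i x) ` {..<k})"
    "\<And>x. x \<in> U \<Longrightarrow> independent_family k (\<lambda>i. X i x)" by (rule C1_distribution_frame[OF V]) blast
  have "u0 \<in> span ((\<lambda>i. X i x) ` {..<k})"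
  proof (rule span_family_closed[OF X(3)[OF x(1)] _ u _ \<open>F \<noteq> bot\<close>])
    show "((\<lambda>n. X i (z n)) \<longlongrightarrow> X i x) F" if "i < k" for i
      using isCont_tendsto_compose[OF C1_on_imp_isCont[OF X(1)[OF that] x(1)] z] .
    show "\<forall>\<^sub>F n in F. u n \<in> span ((\<lambda>i. X i (z n)) ` {..<k})"
      using mem x(2) by eventually_elim (use X(2) in simp)
  qed
  then show ?thesis using X(2)[OF x(1)] by simp
qed

section \<open>Involutivity at a point\<close>

lemma has_derivative_sequence:
  fixes f :: "'a::real_normed_vector \<Rightarrow> 'b::real_normed_vector"
  assumes f: "(f has_derivative f') (at y)" and Y: "(\<lambda>n. real (Suc n) *\<^sub>R (Y n - y)) \<longlonglongrightarrow> t"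
  shows "(\<lambda>n. real (Suc n) *\<^sub>R (f (Y n) - f y)) \<longlonglongrightarrow> f' t"
proof -
  interpret f': bounded_linear f' using f has_derivative_bounded_linear by blast
  define q where "q n = real (Suc n) *\<^sub>R (Y n - y)" for n
  have q: "q \<longlonglongrightarrow> t" using Y by (simp add: q_def[abs_def])
  have Yq: "Y n - y = (1 / real (Suc n)) *\<^sub>R q n" for n by (simp add: q_def)
  have "(\<lambda>n. (1 / real (Suc n)) *\<^sub>R q n) \<longlonglongrightarrow> 0 *\<^sub>R t"
    by (intro tendsto_scaleR q LIMSEQ_Suc[OF lim_1_over_n])
  then have Y0: "(\<lambda>n. Y n - y) \<longlonglongrightarrow> 0" by (simp add: Yq)
  obtain B where B: "0 < B" "\<And>n. norm (q n) \<le> B"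
    using convergent_imp_Bseq[OF convergentI[OF q]] by (auto elim: BseqE)
  have "(\<lambda>n. real (Suc n) *\<^sub>R (f (Y n) - f y) - f' (q n)) \<longlonglongrightarrow> 0"
  proof (rule LIMSEQ_I)
    fix e :: real assume e: "0 < e"
    then have "0 < e / (2 * B)" using B by simp
    then obtain d where d: "0 < d" "\<And>z. norm (z - y) < d \<Longrightarrow> norm (f z - f y - f' (z - y)) \<le> e / (2 * B) * norm (z - y)"
      using f unfolding has_derivative_at_alt by blast
    obtain N where N: "\<And>n. n \<ge> N \<Longrightarrow> norm (Y n - y) < d"
      using LIMSEQ_D[OF Y0 d(1)] by auto
    have "norm (real (Suc n) *\<^sub>R (f (Y n) - f y) - f' (q n) - 0) < e" if "n \<ge> N" for n
    proof -
      have fq: "f' (q n) = real (Suc n) *\<^sub>R f' (Y n - y)" by (simp only: q_def f'.scaleR)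
      have "real (Suc n) *\<^sub>R (f (Y n) - f y) - f' (q n) = real (Suc n) *\<^sub>R (f (Y n) - f y - f' (Y n - y))"
        by (simp only: fq scaleR_diff_right)
      also have "norm \<dots> = real (Suc n) * norm (f (Y n) - f y - f' (Y n - y))" by (simp del: of_nat_Suc)
      also have "\<dots> \<le> real (Suc n) * (e / (2 * B) * norm (Y n - y))"
        by (rule mult_left_mono[OF d(2)[OF N[OF that]]]) simp
      also have "\<dots> = e / (2 * B) * norm (q n)" by (simp add: q_def del: of_nat_Suc)
      also have "\<dots> \<le> e / (2 * B) * B" using B e by (intro mult_left_mono) auto
      also have "\<dots> < e" using B e by simp
      finally show ?thesis by simp
    qed
    then show "\<exists>N. \<forall>n\<ge>N. norm (real (Suc n) *\<^sub>R (f (Y n) - f y) - f' (q n) - 0) < e" by blast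
  qed
  from tendsto_add[OF this f'.tendsto[OF q]] show ?thesis by simp
qed

lemma sequence_tendsto_base:
  fixes y :: "'a::real_normed_vector"
  assumes Y: "(\<lambda>n. real (Suc n) *\<^sub>R (Y n - y)) \<longlonglongrightarrow> t"
  shows "Y \<longlonglongrightarrow> y"
proof -
  have "(\<lambda>n. (1 / real (Suc n)) *\<^sub>R (real (Suc n) *\<^sub>R (Y n - y))) \<longlonglongrightarrow> 0 *\<^sub>R t"
    by (intro tendsto_scaleR Y LIMSEQ_Suc[OF lim_1_over_n])
  then have "(\<lambda>n. Y n - y) \<longlonglongrightarrow> 0" by (simp del: of_nat_Suc)
  then show ?thesis by (rule LIM_zero_cancel)
qed

text \<open>
  The difference quotients of \<open>D\<close> along \<open>Y\<close> lie in the planes \<open>V (f (Y n))\<close>, and \<open>V\<close> has closed graph. The lemma is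
  applied with \<open>A\<close> open to fields tangent to a distribution, and with \<open>A\<close> the preimage of a tangency set.
\<close>

lemma derivative_in_distribution:
  assumes V: "C1_distribution_on U k V" and U: "open U" "f y \<in> U" and f: "isCont f y"
    and D: "(D has_derivative D') (at y)" "D y = 0" and mem: "\<And>z. z \<in> A \<Longrightarrow> D z \<in> V (f z)"
    and Y: "\<And>n. Y n \<in> A" "(\<lambda>n. real (Suc n) *\<^sub>R (Y n - y)) \<longlonglongrightarrow> t"
  shows "D' t \<in> V (f y)"
proof (rule C1_distribution_closed[OF V U(2), of "\<lambda>n. f (Y n)" sequentially "\<lambda>n. real (Suc n) *\<^sub>R (D (Y n) - D y)"])
  show lim: "(\<lambda>n. f (Y n)) \<longlonglongrightarrow> f y" by (rule isCont_tendsto_compose[OF f sequence_tendsto_base[OF Y(2)]])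
  show ev: "\<forall>\<^sub>F n in sequentially. f (Y n) \<in> U" by (rule topological_tendstoD[OF lim U])
  show "(\<lambda>n. real (Suc n) *\<^sub>R (D (Y n) - D y)) \<longlonglongrightarrow> D' t" by (rule has_derivative_sequence[OF D(1) Y(2)])
  show "\<forall>\<^sub>F n in sequentially. real (Suc n) *\<^sub>R (D (Y n) - D y) \<in> V (f (Y n))"
    using ev
  proof eventually_elim
    case (elim n)
    have "subspace (V (f (Y n)))" using V elim unfolding C1_distribution_on_def distribution_on_def by blast
    then show ?case using mem[OF Y(1)] D(2) by (simp add: subspace_scale del: of_nat_Suc)
  qed
qed simp

text \<open>
  The bracket at \<open>x\<close> modulo \<open>W x\<close> depends only on the values of the fields at \<open>x\<close>. To see this without
  expressing a tangent field \<open>Z\<close> in the frame with \<open>C\<^sup>1\<close> coefficients, subtract from \<open>Z\<close> the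
  combination of the \<open>w i\<close> with constant coefficients that agrees with \<open>Z\<close> at \<open>x\<close>: the difference is tangent and
  vanishes at \<open>x\<close>, so its derivative there takes values in \<open>W x\<close>.
\<close>

lemma involutive_if_frame_commutes:
  assumes U: "open U" "x \<in> U" and W: "C1_distribution_on U h W"
    and span: "\<And>z. z \<in> U \<Longrightarrow> W z = span ((\<lambda>j. w j z) ` {..<h})"
    and der: "\<And>j. j < h \<Longrightarrow> (w j has_derivative w' j) (at x)"
    and comm: "\<And>i j. i < h \<Longrightarrow> j < h \<Longrightarrow> w' j (w i x) = w' i (w j x)"
  shows "\<not> non_involutive_at U W x"
proof
  assume "non_involutive_at U W x"
  then obtain X Y where XY: "C1_on U X" "C1_on U Y" "field_tangent_on U X W" "field_tangent_on U Y W"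
    and notin: "lie_bracket X Y x \<notin> W x" unfolding non_involutive_at_def by blast
  have sub: "subspace (W x)" using W U unfolding C1_distribution_on_def distribution_on_def by blast
  have field: "Z' v - (\<Sum>i<h. a i *\<^sub>R w' i v) \<in> W x"
    if Z: "field_tangent_on U Z W" "(Z has_derivative Z') (at x)" "Z x = (\<Sum>i<h. a i *\<^sub>R w i x)" for Z Z' a v
  proof -
    define D where "D z = Z z - (\<Sum>i<h. a i *\<^sub>R w i z)" for z
    have D: "(D has_derivative (\<lambda>v. Z' v - (\<Sum>i<h. a i *\<^sub>R w' i v))) (at x)"
      unfolding D_def by (intro has_derivative_diff Z(2) has_derivative_sum has_derivative_scaleR_right der) simp
    have D0: "D x = 0" by (simp add: D_def Z(3))
    have mem: "D z \<in> W (id z)" if z: "z \<in> U" for z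
    proof -
      have "(\<Sum>i<h. a i *\<^sub>R w i z) \<in> W z" unfolding span[OF z] by (intro span_sum span_scale span_base) auto
      moreover have "Z z \<in> W z" using Z(1) z unfolding field_tangent_on_def by blast
      moreover have "subspace (W z)" using W z unfolding C1_distribution_on_def distribution_on_def by blast
      ultimately show ?thesis by (simp add: D_def subspace_diff)
    qed
    define y where "y n = x + (1 / real (Suc n)) *\<^sub>R v" for n
    have yx: "real (Suc n) *\<^sub>R (y n - x) = v" for n by (simp add: y_def del: of_nat_Suc)
    have "y \<longlonglongrightarrow> x" by (rule sequence_tendsto_base[of y x v]) (simp add: yx del: of_nat_Suc)
    from topological_tendstoD[OF this U] obtain N where N: "\<And>n. n \<ge> N \<Longrightarrow> y n \<in> U"
      unfolding eventually_sequentially by blast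
    define y' where "y' n = (if n \<ge> N then y n else x)" for n
    have y'U: "y' n \<in> U" for n using N U by (simp add: y'_def)
    have "(\<lambda>n. real (Suc n) *\<^sub>R (y' n - x)) \<longlonglongrightarrow> v"
    proof (rule tendsto_eventually)
      show "\<forall>\<^sub>F n in sequentially. real (Suc n) *\<^sub>R (y' n - x) = v"
        unfolding eventually_sequentially using yx by (intro exI[of _ N]) (simp add: y'_def del: of_nat_Suc)
    qed
    from derivative_in_distribution[OF W U(1), of id x, OF _ _ D D0 mem y'U this] U(2)
    show ?thesis by simp
  qed
  obtain X' where X': "(X has_derivative X') (at x)" using XY(1) U(2) unfolding C1_on_def by blast
  obtain Y' where Y': "(Y has_derivative Y') (at x)" using XY(2) U(2) unfolding C1_on_def by blast
  have br: "lie_bracket X Y x = Y' (X x) - X' (Y x)"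
    unfolding lie_bracket_def frechet_derivative_at[OF X', symmetric] frechet_derivative_at[OF Y', symmetric] ..
  have "X x \<in> span ((\<lambda>j. w j x) ` {..<h})" "Y x \<in> span ((\<lambda>j. w j x) ` {..<h})"
    using XY(3,4) U(2) span[OF U(2)] unfolding field_tangent_on_def by auto
  then obtain a b where a: "X x = (\<Sum>i<h. a i *\<^sub>R w i x)" and b: "Y x = (\<Sum>j<h. b j *\<^sub>R w j x)"
    unfolding in_span_family_iff by blast
  have lin: "linear (w' j)" if "j < h" for j using der[OF that] has_derivative_linear by blast
  have "(\<Sum>j<h. b j *\<^sub>R w' j (X x)) = (\<Sum>j<h. \<Sum>i<h. (a i * b j) *\<^sub>R w' j (w i x))"
    unfolding a by (rule sum.cong)
      (auto simp: linear_sum[OF lin] linear_cmul[OF lin] scaleR_sum_right mult.commute)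
  also have "\<dots> = (\<Sum>j<h. \<Sum>i<h. (a i * b j) *\<^sub>R w' i (w j x))"
    by (intro sum.cong refl) (use comm in auto)
  also have "\<dots> = (\<Sum>i<h. \<Sum>j<h. (a i * b j) *\<^sub>R w' i (w j x))" by (rule sum.swap)
  also have "\<dots> = (\<Sum>i<h. a i *\<^sub>R w' i (Y x))"
    unfolding b by (rule sum.cong)
      (auto simp: linear_sum[OF lin] linear_cmul[OF lin] scaleR_sum_right)
  finally have eq: "(\<Sum>j<h. b j *\<^sub>R w' j (X x)) = (\<Sum>i<h. a i *\<^sub>R w' i (Y x))" .
  have "Y' (X x) - (\<Sum>j<h. b j *\<^sub>R w' j (X x)) - (X' (Y x) - (\<Sum>i<h. a i *\<^sub>R w' i (Y x))) \<in> W x"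
    by (rule subspace_diff[OF sub field[OF XY(4) Y' b] field[OF XY(3) X' a]])
  then have "lie_bracket X Y x \<in> W x" unfolding br eq by (simp add: algebra_simps)
  then show False using notin by blast
qed

lemma C1_on_affine_combination:
  fixes X :: "nat \<Rightarrow> 'a::real_normed_vector \<Rightarrow> 'b::real_normed_vector"
  assumes X: "\<And>i. i < k \<Longrightarrow> C1_on U (X i)" and c: "\<And>i. i < k \<Longrightarrow> bounded_linear (C i)"
  shows "C1_on U (\<lambda>z. \<Sum>i<k. (c i + C i (z - x)) *\<^sub>R X i z)"
proof -
  have "\<forall>i. \<exists>f'. i < k \<longrightarrow> (\<forall>z\<in>U. (X i has_derivative blinfun_apply (f' z)) (at z)) \<and> continuous_on U f'"
    using X unfolding C1_on_def by simp
  then obtain X' where X': "\<And>i z. i < k \<Longrightarrow> z \<in> U \<Longrightarrow> (X i has_derivative blinfun_apply (X' i z)) (at z)"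
    "\<And>i. i < k \<Longrightarrow> continuous_on U (X' i)" by metis
  define g where "g i z = c i + C i (z - x)" for i z
  have g': "(g i has_derivative C i) (at z)" if "i < k" for i z
  proof -
    interpret C: bounded_linear "C i" by (rule c[OF that])
    show ?thesis unfolding g_def by (auto intro!: derivative_eq_intros C.has_derivative)
  qed
  have gcont: "continuous_on U (g i)" if "i < k" for i
    by (intro continuous_at_imp_continuous_on ballI has_derivative_continuous[OF g'[OF that]])
  have Xcont: "continuous_on U (X i)" if "i < k" for i
    by (intro continuous_at_imp_continuous_on ballI has_derivative_continuous[OF X'(1)[OF that]])
  define D where "D z = (\<Sum>i<k. g i z *\<^sub>R X' i z + (blinfun_scaleR_left (X i z) o\<^sub>L Blinfun (C i)))" for z
  have Dv: "D z v = (\<Sum>i<k. g i z *\<^sub>R X' i z v + C i v *\<^sub>R X i z)" for z v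
    unfolding D_def by (simp add: blinfun.sum_left blinfun.add_left blinfun.scaleR_left bounded_linear_Blinfun_apply[OF c])
  have "((\<lambda>z. \<Sum>i<k. g i z *\<^sub>R X i z) has_derivative D z) (at z)" if z: "z \<in> U" for z
  proof -
    have "((\<lambda>z. \<Sum>i<k. g i z *\<^sub>R X i z) has_derivative (\<lambda>v. \<Sum>i<k. g i z *\<^sub>R X' i z v + C i v *\<^sub>R X i z)) (at z)"
      by (intro has_derivative_sum has_derivative_scaleR g' X'(1) z) auto
    then show ?thesis by (simp add: Dv[abs_def])
  qed
  moreover have "continuous_on U D" unfolding D_def
    by (intro continuous_on_sum continuous_on_add continuous_on_scaleR gcont X'(2)
        bounded_bilinear.continuous_on[OF bounded_bilinear_blinfun_compose] continuous_on_const
        bounded_linear.continuous_on[OF bounded_linear_blinfun_scaleR_left] Xcont) auto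
  ultimately show ?thesis unfolding C1_on_def g_def by blast
qed

section \<open>Symmetry of the derivative of a gradient along a map\<close>

text \<open>
  Compare \<open>\<psi>\<close> along the segment with the quadratic function whose derivative is \<open>(A + \<theta> B) d\<close>.
\<close>

lemma segment_increment_bound:
  fixes \<psi> :: "'a::real_normed_vector \<Rightarrow> 'b::real_normed_vector" and \<psi>' :: "'a \<Rightarrow> 'a \<Rightarrow>\<^sub>L 'b"
  assumes der: "\<And>\<theta>. \<theta> \<in> {0..1} \<Longrightarrow> (\<psi> has_derivative blinfun_apply (\<psi>' (p + \<theta> *\<^sub>R d))) (at (p + \<theta> *\<^sub>R d))"
    and near: "\<And>\<theta>. \<theta> \<in> {0..1} \<Longrightarrow> norm (\<psi>' (p + \<theta> *\<^sub>R d) - (A + \<theta> *\<^sub>R B)) \<le> e"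
  shows "norm (\<psi> (p + d) - \<psi> p - (A d + (1/2) *\<^sub>R B d)) \<le> e * norm d"
proof -
  define \<phi> where "\<phi> \<theta> = \<psi> (p + \<theta> *\<^sub>R d) - (\<theta> *\<^sub>R A d + (\<theta>\<^sup>2 / 2) *\<^sub>R B d)" for \<theta> :: real
  define v where "v \<theta> = \<psi>' (p + \<theta> *\<^sub>R d) d - (A d + \<theta> *\<^sub>R B d)" for \<theta>
  have "(\<phi> has_derivative (\<lambda>s. s *\<^sub>R v \<theta>)) (at \<theta> within {0..1})" if \<theta>: "\<theta> \<in> {0..1}" for \<theta>
  proof -
    have "((\<lambda>\<theta>. p + \<theta> *\<^sub>R d) has_derivative (\<lambda>s. s *\<^sub>R d)) (at \<theta> within {0..1})"
      by (auto intro!: derivative_eq_intros)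
    from has_derivative_compose[OF this der[OF \<theta>]]
    have 1: "((\<lambda>\<theta>. \<psi> (p + \<theta> *\<^sub>R d)) has_derivative (\<lambda>s. s *\<^sub>R \<psi>' (p + \<theta> *\<^sub>R d) d)) (at \<theta> within {0..1})"
      by (simp add: blinfun.scaleR_right)
    have 2: "((\<lambda>\<theta>. \<theta> *\<^sub>R A d + (\<theta>\<^sup>2 / 2) *\<^sub>R B d) has_derivative (\<lambda>s. s *\<^sub>R (A d + \<theta> *\<^sub>R B d))) (at \<theta> within {0..1})"
      by (auto intro!: derivative_eq_intros simp: algebra_simps)
    show ?thesis unfolding \<phi>_def v_def
      by (rule has_derivative_eq_rhs[OF has_derivative_diff[OF 1 2]]) (simp add: scaleR_diff_right)
  qed
  moreover have "onorm (\<lambda>s. s *\<^sub>R v \<theta>) \<le> e * norm d" if \<theta>: "\<theta> \<in> {0..1}" for \<theta>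
  proof (rule onorm_le)
    fix s :: real
    have "v \<theta> = (\<psi>' (p + \<theta> *\<^sub>R d) - (A + \<theta> *\<^sub>R B)) d"
      by (simp add: v_def blinfun.diff_left blinfun.add_left blinfun.scaleR_left)
    then have "norm (v \<theta>) \<le> norm (\<psi>' (p + \<theta> *\<^sub>R d) - (A + \<theta> *\<^sub>R B)) * norm d" by (simp add: norm_blinfun)
    also have "\<dots> \<le> e * norm d" using near[OF \<theta>] by (rule mult_right_mono) simp
    finally have "norm (v \<theta>) * norm s \<le> e * norm d * norm s" by (rule mult_right_mono) simp
    then show "norm (s *\<^sub>R v \<theta>) \<le> e * norm d * norm s" by (simp add: mult.commute)
  qed
  ultimately have "norm (\<phi> 1 - \<phi> 0) \<le> e * norm d * norm (1 - 0 :: real)"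
    by (intro differentiable_bound[of "{0..1}"]) auto
  then show ?thesis by (simp add: \<phi>_def algebra_simps)
qed

text \<open>
  If \<open>\<psi>\<close> were twice differentiable, \<open>M t (G s)\<close> would be its second derivative at \<open>(G t, G s)\<close>. In
  general only \<open>\<psi>' \<circ> g\<close> is differentiable, at \<open>y\<close>. But the segments between the points \<open>P a = g (y + \<epsilon> a)\<close> stay
  within \<open>o(\<epsilon>)\<close> of the image of \<open>g\<close>, and as \<open>\<psi>'\<close> is Lipschitz, it is there an affine function up to \<open>o(\<epsilon>)\<close>.
  So each side of the triangle \<open>P 0\<close>, \<open>P t\<close>, \<open>P s\<close> contributes its trapezoidal value up to
  \<open>o(\<epsilon>\<^sup>2)\<close>. The contributions add up to zero, and what is left of order \<open>\<epsilon>\<^sup>2\<close> is, up to sign, half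
  of \<open>M t (G s) - M s (G t)\<close>.
\<close>

lemma derivative_along_map_symmetric:
  fixes g :: "'c::real_normed_vector \<Rightarrow> 'a::real_normed_vector" and \<psi> :: "'a \<Rightarrow> 'b::real_normed_vector"
    and \<psi>' :: "'a \<Rightarrow> 'a \<Rightarrow>\<^sub>L 'b"
  assumes U: "open U" "g y \<in> U" and der: "\<And>u. u \<in> U \<Longrightarrow> (\<psi> has_derivative blinfun_apply (\<psi>' u)) (at u)"
    and lip: "K-lipschitz_on U \<psi>'"
    and G: "(g has_derivative G) (at y)" and M: "((\<lambda>z. \<psi>' (g z)) has_derivative M) (at y)"
  shows "M t (G s) = M s (G t)"
proof -
  define u where "u = g y"
  define N where "N = \<psi>' u"
  have K0: "0 \<le> K" using lip lipschitz_on_nonneg by blast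
  interpret G: bounded_linear G using G has_derivative_bounded_linear by blast
  interpret M: bounded_linear M using M has_derivative_bounded_linear by blast
  obtain \<rho> where \<rho>: "0 < \<rho>" "ball u \<rho> \<subseteq> U" using U open_contains_ball unfolding u_def by blast
  obtain B where B: "0 < B" "\<And>v. norm (G v) \<le> norm v * B" using G.pos_bounded by blast
  define m where "m = norm t + norm s + 1"
  have m: "0 < m" "norm t \<le> m" "norm s \<le> m" by (auto simp: m_def add_nonneg_pos)
  define m' where "m' = 2 * B * m + 2 * m"
  have m': "0 < m'" using m B by (simp add: m'_def add_pos_pos)
  define C where "C = 6 * (2 * K + 1) * m * m' + (norm (M t) + norm (M s)) * m"
  have C0: "0 \<le> C" using K0 m m' by (simp add: C_def)
  have main: "norm (M t (G s) - M s (G t)) \<le> C * \<eta>" if \<eta>: "0 < \<eta>" "\<eta> \<le> 1" for \<eta>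
  proof -
    obtain d1 where d1: "0 < d1" "\<And>z. norm (z - y) < d1 \<Longrightarrow> norm (g z - g y - G (z - y)) \<le> \<eta> * norm (z - y)"
      using G \<eta>(1) unfolding has_derivative_at_alt by blast
    obtain d2 where d2: "0 < d2" "\<And>z. norm (z - y) < d2 \<Longrightarrow> norm (\<psi>' (g z) - \<psi>' (g y) - M (z - y)) \<le> \<eta> * norm (z - y)"
      using M \<eta>(1) unfolding has_derivative_at_alt by blast
    have "continuous (at y) g" using G has_derivative_continuous by blast
    then obtain d3 where d3: "0 < d3" "\<And>z. dist z y < d3 \<Longrightarrow> dist (g z) (g y) < \<rho>"
      using \<rho>(1) unfolding continuous_at_eps_delta by blast
    define \<epsilon> where "\<epsilon> = min d1 (min d2 d3) / (2 * m)"
    have \<epsilon>: "0 < \<epsilon>" using d1 d2 d3 m by (simp add: \<epsilon>_def)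
    have \<epsilon>m: "\<epsilon> * m < min d1 (min d2 d3)"
    proof -
      have "0 < min d1 (min d2 d3)" using d1 d2 d3 by simp
      moreover have "\<epsilon> * m = min d1 (min d2 d3) / 2" using m by (simp add: \<epsilon>_def)
      ultimately show ?thesis by linarith
    qed
    have sm: "norm (\<epsilon> *\<^sub>R a) \<le> \<epsilon> * m" if "norm a \<le> m" for a :: 'c using that \<epsilon> by simp
    define P where "P a = g (y + \<epsilon> *\<^sub>R a)" for a
    have P1: "norm (P a - u - \<epsilon> *\<^sub>R G a) \<le> \<eta> * \<epsilon> * m" if "norm a \<le> m" for a
    proof -
      have "norm (g (y + \<epsilon> *\<^sub>R a) - g y - G (\<epsilon> *\<^sub>R a)) \<le> \<eta> * norm (\<epsilon> *\<^sub>R a)"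
        using d1(2)[of "y + \<epsilon> *\<^sub>R a"] sm[OF that] \<epsilon>m by simp
      also have "\<dots> \<le> \<eta> * (\<epsilon> * m)" using sm[OF that] \<eta> by (intro mult_left_mono) auto
      finally show ?thesis by (simp add: P_def u_def G.scaleR mult.assoc)
    qed
    have P2: "norm (\<psi>' (P a) - (N + \<epsilon> *\<^sub>R M a)) \<le> \<eta> * \<epsilon> * m" if "norm a \<le> m" for a
    proof -
      have "norm (\<psi>' (g (y + \<epsilon> *\<^sub>R a)) - \<psi>' (g y) - M (\<epsilon> *\<^sub>R a)) \<le> \<eta> * norm (\<epsilon> *\<^sub>R a)"
        using d2(2)[of "y + \<epsilon> *\<^sub>R a"] sm[OF that] \<epsilon>m by simp
      also have "\<dots> \<le> \<eta> * (\<epsilon> * m)" using sm[OF that] \<eta> by (intro mult_left_mono) auto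
      finally show ?thesis by (simp add: P_def N_def u_def M.scaleR mult.assoc diff_diff_eq)
    qed
    have P3: "P a \<in> ball u \<rho>" if "norm a \<le> m" for a
      using d3(2)[of "y + \<epsilon> *\<^sub>R a"] sm[OF that] \<epsilon>m by (simp add: P_def u_def dist_norm norm_minus_commute)
    have edge: "norm (\<psi> (P b) - \<psi> (P a) - ((N + \<epsilon> *\<^sub>R M a) (P b - P a) + (1/2) *\<^sub>R (\<epsilon> *\<^sub>R M (b - a)) (P b - P a)))
        \<le> (2 * K + 1) * (\<eta> * \<epsilon> * m) * (\<epsilon> * m')" if ab: "norm a \<le> m" "norm b \<le> m" for a b
    proof -
      define d where "d = P b - P a"
      have q: "P a + \<theta> *\<^sub>R d = (1 - \<theta>) *\<^sub>R P a + \<theta> *\<^sub>R P b" for \<theta> by (simp add: d_def algebra_simps)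
      have inball: "P a + \<theta> *\<^sub>R d \<in> ball u \<rho>" if "\<theta> \<in> {0..1}" for \<theta>
        unfolding q using that P3 ab by (intro convexD[OF convex_ball]) auto
      have "norm (\<psi> (P a + d) - \<psi> (P a) - ((N + \<epsilon> *\<^sub>R M a) d + (1/2) *\<^sub>R (\<epsilon> *\<^sub>R M (b - a)) d))
          \<le> ((2 * K + 1) * (\<eta> * \<epsilon> * m)) * norm d"
      proof (rule segment_increment_bound)
        fix \<theta> :: real assume \<theta>: "\<theta> \<in> {0..1}"
        show "(\<psi> has_derivative blinfun_apply (\<psi>' (P a + \<theta> *\<^sub>R d))) (at (P a + \<theta> *\<^sub>R d))"
          using inball[OF \<theta>] \<rho>(2) by (intro der) blast
        define z where "z = (1 - \<theta>) *\<^sub>R a + \<theta> *\<^sub>R b"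
        have z: "norm z \<le> m"
        proof -
          have "norm z \<le> (1 - \<theta>) * norm a + \<theta> * norm b"
            unfolding z_def using \<theta> by (intro order_trans[OF norm_triangle_ineq]) simp
          also have "\<dots> \<le> (1 - \<theta>) * m + \<theta> * m" using \<theta> ab by (intro add_mono mult_left_mono) auto
          finally show ?thesis by (simp add: algebra_simps)
        qed
        have Gz: "G z = (1 - \<theta>) *\<^sub>R G a + \<theta> *\<^sub>R G b" by (simp add: z_def G.add G.scaleR)
        have "P a + \<theta> *\<^sub>R d - P z = ((1 - \<theta>) *\<^sub>R (P a - u - \<epsilon> *\<^sub>R G a) + \<theta> *\<^sub>R (P b - u - \<epsilon> *\<^sub>R G b)) - (P z - u - \<epsilon> *\<^sub>R G z)"
          unfolding q Gz by (simp add: algebra_simps)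
        also have "norm \<dots> \<le> ((1 - \<theta>) * norm (P a - u - \<epsilon> *\<^sub>R G a) + \<theta> * norm (P b - u - \<epsilon> *\<^sub>R G b)) + norm (P z - u - \<epsilon> *\<^sub>R G z)"
          using \<theta> by (intro order_trans[OF norm_triangle_ineq4] add_right_mono order_trans[OF norm_triangle_ineq]) simp
        also have "\<dots> \<le> ((1 - \<theta>) * (\<eta> * \<epsilon> * m) + \<theta> * (\<eta> * \<epsilon> * m)) + \<eta> * \<epsilon> * m"
          using \<theta> ab z by (intro add_mono mult_left_mono P1) auto
        also have "\<dots> = 2 * (\<eta> * \<epsilon> * m)" by (simp add: algebra_simps)
        finally have close: "norm (P a + \<theta> *\<^sub>R d - P z) \<le> 2 * (\<eta> * \<epsilon> * m)" .
        have "norm (\<psi>' (P a + \<theta> *\<^sub>R d) - \<psi>' (P z)) \<le> K * norm (P a + \<theta> *\<^sub>R d - P z)"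
          using inball[OF \<theta>] P3[OF z] \<rho>(2) by (intro lipschitz_on_normD[OF lip]) auto
        also have "\<dots> \<le> K * (2 * (\<eta> * \<epsilon> * m))" by (rule mult_left_mono[OF close K0])
        finally have l1: "norm (\<psi>' (P a + \<theta> *\<^sub>R d) - \<psi>' (P z)) \<le> K * (2 * (\<eta> * \<epsilon> * m))" .
        have Mz: "N + \<epsilon> *\<^sub>R M a + \<theta> *\<^sub>R (\<epsilon> *\<^sub>R M (b - a)) = N + \<epsilon> *\<^sub>R M z"
          by (simp add: z_def M.add M.scaleR M.diff algebra_simps)
        have "\<psi>' (P a + \<theta> *\<^sub>R d) - (N + \<epsilon> *\<^sub>R M z) = (\<psi>' (P a + \<theta> *\<^sub>R d) - \<psi>' (P z)) + (\<psi>' (P z) - (N + \<epsilon> *\<^sub>R M z))" by simp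
        also have "norm \<dots> \<le> K * (2 * (\<eta> * \<epsilon> * m)) + \<eta> * \<epsilon> * m"
          by (rule order_trans[OF norm_triangle_ineq add_mono[OF l1 P2[OF z]]])
        finally show "norm (\<psi>' (P a + \<theta> *\<^sub>R d) - (N + \<epsilon> *\<^sub>R M a + \<theta> *\<^sub>R (\<epsilon> *\<^sub>R M (b - a)))) \<le> (2 * K + 1) * (\<eta> * \<epsilon> * m)"
          unfolding Mz by (simp add: algebra_simps)
      qed
      also have "norm d \<le> \<epsilon> * m'"
      proof -
        have "d = \<epsilon> *\<^sub>R G (b - a) + (P b - u - \<epsilon> *\<^sub>R G b) - (P a - u - \<epsilon> *\<^sub>R G a)"
          by (simp add: d_def G.diff algebra_simps)
        also have "norm \<dots> \<le> norm (\<epsilon> *\<^sub>R G (b - a)) + norm (P b - u - \<epsilon> *\<^sub>R G b) + norm (P a - u - \<epsilon> *\<^sub>R G a)"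
          by (intro order_trans[OF norm_triangle_ineq4] add_right_mono norm_triangle_ineq)
        also have "\<dots> \<le> \<epsilon> * (2 * m * B) + \<eta> * \<epsilon> * m + \<eta> * \<epsilon> * m"
        proof (intro add_mono P1 ab)
          have "norm (b - a) \<le> 2 * m" using norm_triangle_ineq4[of b a] ab by linarith
          then have "norm (G (b - a)) \<le> 2 * m * B"
            using B(2)[of "b - a"] B(1) by (meson mult_right_mono less_imp_le order_trans)
          then show "norm (\<epsilon> *\<^sub>R G (b - a)) \<le> \<epsilon> * (2 * m * B)" using \<epsilon> by simp
        qed
        also have "\<dots> \<le> \<epsilon> * (2 * m * B) + \<epsilon> * m + \<epsilon> * m"
        proof -
          have "\<eta> * (\<epsilon> * m) \<le> 1 * (\<epsilon> * m)" using \<eta> \<epsilon> m by (intro mult_right_mono) auto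
          then show ?thesis by (simp add: mult_ac)
        qed
        also have "\<dots> = \<epsilon> * m'" by (simp add: m'_def algebra_simps)
        finally show ?thesis .
      qed
      finally show ?thesis using K0 \<eta> \<epsilon> m by (simp add: d_def mult_left_mono)
    qed
    define d1 where "d1 = P t - u"
    define d3 where "d3 = P s - u"
    have P0: "P 0 = u" by (simp add: P_def u_def)
    have n0: "norm (0 :: 'c) \<le> m" using m by simp
    let ?e = "(2 * K + 1) * (\<eta> * \<epsilon> * m) * (\<epsilon> * m')"
    let ?E1 = "\<psi> (P t) - \<psi> u - (N d1 + (1/2) *\<^sub>R (\<epsilon> *\<^sub>R M t) d1)"
    let ?E2 = "\<psi> (P s) - \<psi> (P t) - ((N + \<epsilon> *\<^sub>R M t) (d3 - d1) + (1/2) *\<^sub>R (\<epsilon> *\<^sub>R M (s - t)) (d3 - d1))"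
    let ?E3 = "\<psi> (P s) - \<psi> u - (N d3 + (1/2) *\<^sub>R (\<epsilon> *\<^sub>R M s) d3)"
    have E1: "norm ?E1 \<le> ?e" using edge[OF n0 m(2)] by (simp add: P0 d1_def M.zero)
    have E2: "norm ?E2 \<le> ?e" using edge[OF m(2,3)] by (simp add: d1_def d3_def)
    have E3: "norm ?E3 \<le> ?e" using edge[OF n0 m(3)] by (simp add: P0 d3_def M.zero)
    define \<alpha> where "\<alpha> = \<epsilon> / 2"
    have half: "(1/2) *\<^sub>R (\<epsilon> *\<^sub>R Q) v = \<alpha> *\<^sub>R Q v" for Q :: "'a \<Rightarrow>\<^sub>L 'b" and v
      by (simp add: \<alpha>_def blinfun.scaleR_left)
    have full: "(\<epsilon> *\<^sub>R Q) v = \<alpha> *\<^sub>R Q v + \<alpha> *\<^sub>R Q v" for Q :: "'a \<Rightarrow>\<^sub>L 'b" and v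
      by (simp add: \<alpha>_def blinfun.scaleR_left flip: scaleR_left_distrib)
    have "\<alpha> *\<^sub>R (M t d3 - M s d1) = ?E3 - (?E1 + ?E2)"
      unfolding half unfolding blinfun.add_left full M.diff
      by (simp add: blinfun.diff_right blinfun.diff_left scaleR_diff_right algebra_simps)
    also have "norm \<dots> \<le> ?e + (?e + ?e)"
      by (intro order_trans[OF norm_triangle_ineq4] add_mono E3 order_trans[OF norm_triangle_ineq] E1 E2)
    finally have e0: "norm (\<alpha> *\<^sub>R (M t d3 - M s d1)) \<le> ?e + (?e + ?e)" .
    have n\<alpha>: "norm (\<alpha> *\<^sub>R (M t d3 - M s d1)) = norm (M t d3 - M s d1) * \<epsilon> / 2"
      using \<epsilon> by (simp add: \<alpha>_def)
    have "norm (M t d3 - M s d1) * \<epsilon> \<le> (6 * (2 * K + 1) * (\<eta> * m) * (\<epsilon> * m')) * \<epsilon>"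
      using e0 unfolding n\<alpha> by (simp add: algebra_simps)
    then have loop: "norm (M t d3 - M s d1) \<le> 6 * (2 * K + 1) * (\<eta> * m) * (\<epsilon> * m')"
      using \<epsilon> by (simp only: mult_le_cancel_right_pos)
    have "\<epsilon> *\<^sub>R (M t (G s) - M s (G t)) = (M t d3 - M s d1) - (M t (d3 - \<epsilon> *\<^sub>R G s) - M s (d1 - \<epsilon> *\<^sub>R G t))"
      by (simp add: blinfun.diff_right blinfun.scaleR_right algebra_simps)
    also have "norm \<dots> \<le> 6 * (2 * K + 1) * (\<eta> * m) * (\<epsilon> * m') + (norm (M t) * (\<eta> * \<epsilon> * m) + norm (M s) * (\<eta> * \<epsilon> * m))"
    proof -
      have b1: "norm (M t (d3 - \<epsilon> *\<^sub>R G s)) \<le> norm (M t) * (\<eta> * \<epsilon> * m)"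
        using P1[OF m(3)] by (intro order_trans[OF norm_blinfun] mult_left_mono) (auto simp: d3_def)
      have b2: "norm (M s (d1 - \<epsilon> *\<^sub>R G t)) \<le> norm (M s) * (\<eta> * \<epsilon> * m)"
        using P1[OF m(2)] by (intro order_trans[OF norm_blinfun] mult_left_mono) (auto simp: d1_def)
      show ?thesis
        by (rule order_trans[OF norm_triangle_ineq4
              add_mono[OF loop order_trans[OF norm_triangle_ineq4 add_mono[OF b1 b2]]]])
    qed
    also have "\<dots> = \<epsilon> * (C * \<eta>)" by (simp add: C_def algebra_simps)
    finally show ?thesis using \<epsilon> by simp
  qed
  have "norm (M t (G s) - M s (G t)) \<le> 0"
  proof (rule field_le_epsilon)
    fix e :: real assume e: "0 < e"
    define \<eta> where "\<eta> = min 1 (e / (C + 1))"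
    have \<eta>: "0 < \<eta>" "\<eta> \<le> 1" using e C0 by (auto simp: \<eta>_def)
    have "norm (M t (G s) - M s (G t)) \<le> C * \<eta>" by (rule main[OF \<eta>])
    also have "\<dots> \<le> C * (e / (C + 1))" using C0 by (intro mult_left_mono) (auto simp: \<eta>_def)
    also have "\<dots> = e * (C / (C + 1))" by simp
    also have "\<dots> \<le> e * 1" using e C0 by (intro mult_left_mono) auto
    finally show "norm (M t (G s) - M s (G t)) \<le> 0 + e" by simp
  qed
  then show ?thesis by simp
qed

section \<open>Constructing an involutive distribution\<close>

text \<open>
  In the application \<open>g\<close> is \<open>f\<close> read in a chart, \<open>\<psi>\<close> the inverse chart and \<open>A\<close> the preimage of the
  tangency set. Suppose that \<open>F\<close> is injective. The fields \<open>w j\<close> are built in the frame \<open>X\<close> of \<open>V\<close>, with coefficients that are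
  affine functions: \<open>c j\<close> matches the value \<open>\<psi>' (g y) (e j)\<close>, and \<open>C j\<close> matches the first derivative
  along the image of \<open>f\<close>. The latter is possible because the defect \<open>\<Delta> j\<close>, which takes values in \<open>V\<close> on \<open>A\<close> and
  vanishes at \<open>y\<close>, has its derivative in \<open>V x\<close>.
\<close>

lemma tangency_forces_degeneracy:
  fixes V :: "real^'n \<Rightarrow> (real^'n) set" and f :: "'c::euclidean_space \<Rightarrow> real^'n"
    and g :: "'c \<Rightarrow> real^'n" and \<psi> :: "real^'n \<Rightarrow> real^'n" and \<psi>' :: "real^'n \<Rightarrow> (real^'n) \<Rightarrow>\<^sub>L (real^'n)"
  assumes V: "C1_distribution_on UNIV k V" and noninv: "h_non_involutive_at DIM('c) V (f y)"
    and \<psi>: "open U" "g y \<in> U" "\<And>u. u \<in> U \<Longrightarrow> (\<psi> has_derivative blinfun_apply (\<psi>' u)) (at u)" "K-lipschitz_on U \<psi>'"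
    and f: "(f has_derivative F) (at y)" and g: "(g has_derivative G) (at y)"
    and M: "((\<lambda>z. \<psi>' (g z)) has_derivative M) (at y)"
    and FG: "\<And>t. F t = \<psi>' (g y) (G t)"
    and A: "y \<in> A" "tangentially_dense A y" "subspace L" "\<And>z. z \<in> A \<Longrightarrow> g z \<in> L"
    and tang: "\<And>z v. z \<in> A \<Longrightarrow> v \<in> L \<Longrightarrow> \<psi>' (g z) v \<in> V (f z)"
  shows "\<exists>e. e \<noteq> 0 \<and> F e = 0"
proof (rule ccontr)
  assume nodeg: "\<not> ?thesis"
  define x where "x = f y"
  define h where "h = DIM('c)"
  interpret F: bounded_linear F using f has_derivative_bounded_linear by blast
  interpret G: bounded_linear G using g has_derivative_bounded_linear by blast
  interpret M: bounded_linear M using M has_derivative_bounded_linear by blast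
  have Flin: "linear F" using f has_derivative_linear by blast
  have "inj F"
  proof (rule injI)
    fix s t assume "F s = F t"
    then have "F (s - t) = 0" by (simp add: F.diff)
    then have "s - t = 0" using nodeg by blast
    then show "s = t" by simp
  qed
  then obtain P where P: "linear P" "P \<circ> F = id" using linear_injective_left_inverse[OF Flin] by blast
  have PF: "P (F t) = t" for t using P(2) by (metis comp_apply id_apply)
  have Pbl: "bounded_linear P" using P(1) by (simp add: linear_linear)
  obtain b :: "nat \<Rightarrow> 'c" where b: "bij_betw b {..<h} Basis"
    using ex_bij_betw_nat_finite[OF finite_Basis] unfolding h_def atLeast0LessThan by blast
  have GL: "G t \<in> L" for t
  proof -
    obtain Y where Y: "\<And>n. Y n \<in> A" "(\<lambda>n. real (Suc n) *\<^sub>R (Y n - y)) \<longlonglongrightarrow> t"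
      using A(2) unfolding tangentially_dense_def by blast
    show ?thesis
    proof (rule closed_sequentially[OF closed_subspace[OF A(3)] _ has_derivative_sequence[OF g Y(2)]])
      show "real (Suc n) *\<^sub>R (g (Y n) - g y) \<in> L" for n
        by (rule subspace_scale[OF A(3) subspace_diff[OF A(3) A(4)[OF Y(1)] A(4)[OF A(1)]]])
    qed
  qed
  obtain X where X: "\<And>i. i < k \<Longrightarrow> C1_on UNIV (X i)" "\<And>z. V z = span ((\<lambda>i. X i z) ` {..<k})"
    "\<And>z. independent_family k (\<lambda>i. X i z)" by (rule C1_distribution_frame[OF V]) blast
  have "\<exists>D. (X i has_derivative D) (at x)" if "i < k" for i
    using X(1)[OF that] unfolding C1_on_def by blast
  then obtain X' where X': "\<And>i. i < k \<Longrightarrow> (X i has_derivative X' i) (at x)" by metis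
  obtain d where d: "\<And>i. i < k \<Longrightarrow> bounded_linear (d i)"
    "\<And>u. u \<in> span ((\<lambda>i. X i x) ` {..<k}) \<Longrightarrow> u = (\<Sum>i<k. d i u *\<^sub>R X i x)"
    by (rule independent_family_dual[OF X(3)[of x]]) blast
  define e where "e j = G (b j)" for j
  define c where "c j i = d i (\<psi>' (g y) (e j))" for j i
  have wx0: "\<psi>' (g y) (e j) = (\<Sum>i<k. c j i *\<^sub>R X i x)" for j
    unfolding c_def e_def by (rule d(2)) (use tang[OF A(1) GL[of "b j"]] X(2) in \<open>simp add: x_def\<close>)
  define \<Delta> where "\<Delta> j z = \<psi>' (g z) (e j) - (\<Sum>i<k. c j i *\<^sub>R X i (f z))" for j z
  define \<Delta>' where "\<Delta>' j t = M t (e j) - (\<Sum>i<k. c j i *\<^sub>R X' i (F t))" for j t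
  have \<Delta>der: "(\<Delta> j has_derivative \<Delta>' j) (at y)" for j
  proof -
    have 1: "((\<lambda>z. \<psi>' (g z) (e j)) has_derivative (\<lambda>t. M t (e j))) (at y)"
      using bounded_linear.has_derivative[OF blinfun.bounded_linear_left M] .
    have 2: "((\<lambda>z. X i (f z)) has_derivative (\<lambda>t. X' i (F t))) (at y)" if "i < k" for i
      by (rule has_derivative_compose[OF f]) (use X'[OF that] in \<open>simp add: x_def\<close>)
    show ?thesis unfolding \<Delta>_def \<Delta>'_def
      by (intro has_derivative_diff 1 has_derivative_sum has_derivative_scaleR_right 2) simp
  qed
  have \<Delta>V: "\<Delta>' j t \<in> V x" for j t
  proof -
    obtain Y where Y: "\<And>n. Y n \<in> A" "(\<lambda>n. real (Suc n) *\<^sub>R (Y n - y)) \<longlonglongrightarrow> t"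
      using A(2) unfolding tangentially_dense_def by blast
    have 0: "\<Delta> j y = 0" unfolding \<Delta>_def wx0 by (simp add: x_def)
    have mem: "\<Delta> j z \<in> V (f z)" if "z \<in> A" for z
    proof -
      have "subspace (V (f z))" using X(2) by simp
      moreover have "(\<Sum>i<k. c j i *\<^sub>R X i (f z)) \<in> V (f z)"
        unfolding X(2) by (intro span_sum span_scale span_base) auto
      ultimately show ?thesis
        unfolding \<Delta>_def e_def by (intro subspace_diff tang[OF that GL])
    qed
    show ?thesis unfolding x_def
      by (rule derivative_in_distribution[OF V open_UNIV UNIV_I has_derivative_continuous[OF f] \<Delta>der 0 mem Y])
  qed
  define C where "C j i v = d i (\<Delta>' j (P v))" for j i v
  have \<Delta>bl: "bounded_linear (\<Delta>' j)" for j using \<Delta>der has_derivative_bounded_linear by blast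
  have Cbl: "bounded_linear (C j i)" if "i < k" for j i
    unfolding C_def by (intro bounded_linear_compose[OF d(1)[OF that]] bounded_linear_compose[OF \<Delta>bl Pbl])
  define w where "w j z = (\<Sum>i<k. (c j i + C j i (z - x)) *\<^sub>R X i z)" for j z
  define w' where "w' j v = (\<Sum>i<k. c j i *\<^sub>R X' i v + C j i v *\<^sub>R X i x)" for j v
  have wC1: "C1_on UNIV (w j)" for j
    unfolding w_def by (rule C1_on_affine_combination[OF X(1) Cbl])
  have wder: "(w j has_derivative w' j) (at x)" for j
  proof -
    have "((\<lambda>z. (c j i + C j i (z - x)) *\<^sub>R X i z) has_derivative (\<lambda>v. c j i *\<^sub>R X' i v + C j i v *\<^sub>R X i x)) (at x)" if i: "i < k" for i
    proof -
      interpret C: bounded_linear "C j i" by (rule Cbl[OF i])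
      have "((\<lambda>z. c j i + C j i (z - x)) has_derivative C j i) (at x)"
        by (auto intro!: derivative_eq_intros C.has_derivative)
      from has_derivative_scaleR[OF this X'[OF i]] show ?thesis by (simp add: C.zero)
    qed
    then show ?thesis unfolding w_def w'_def by (intro has_derivative_sum) simp
  qed
  have wx: "w j x = F (b j)" for j
  proof -
    have "w j x = (\<Sum>i<k. c j i *\<^sub>R X i x)" unfolding w_def
      by (rule sum.cong) (auto simp: linear_0[OF bounded_linear.linear[OF Cbl]])
    then show ?thesis using wx0[of j] FG[of "b j"] by (simp add: e_def)
  qed
  have w'F: "w' j (F t) = M t (e j)" for j t
  proof -
    have "\<Delta>' j t = (\<Sum>i<k. d i (\<Delta>' j t) *\<^sub>R X i x)" by (rule d(2)) (use \<Delta>V X(2) in simp)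
    then have "w' j (F t) = (\<Sum>i<k. c j i *\<^sub>R X' i (F t)) + \<Delta>' j t"
      unfolding w'_def C_def PF sum.distrib by simp
    then show ?thesis by (simp add: \<Delta>'_def)
  qed
  have comm: "w' j (w i x) = w' i (w j x)" for i j
    unfolding wx w'F e_def by (rule derivative_along_map_symmetric[OF \<psi> g M])
  have "independent_family h (\<lambda>j. F (b j))"
    unfolding independent_family_def
  proof (intro allI impI)
    fix a i assume "(\<Sum>j<h. a j *\<^sub>R F (b j)) = 0" and i: "i < h"
    then have "F (\<Sum>j<h. a j *\<^sub>R b j) = 0" by (simp add: F.sum F.scaleR)
    then have "(\<Sum>j<h. a j *\<^sub>R b j) = 0" using nodeg by auto
    moreover have "independent_family h b"
      using b independent_Basis by (simp add: independent_family_iff bij_betw_def)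
    ultimately show "a i = 0" using i unfolding independent_family_def by blast
  qed
  then have "independent_family h (\<lambda>j. w j x)" by (simp add: wx)
  then have "\<forall>\<^sub>F z in nhds x. independent_family h (\<lambda>j. w j z)"
  proof (rule independent_family_eventually)
    show "(w j \<longlongrightarrow> w j x) (nhds x)" for j
      using has_derivative_continuous[OF wder] by (simp only: continuous_at tendsto_at_iff_tendsto_nhds)
  qed
  then obtain U where U: "open U" "x \<in> U" "\<And>z. z \<in> U \<Longrightarrow> independent_family h (\<lambda>j. w j z)"
    unfolding eventually_nhds by blast
  define W where "W z = span ((\<lambda>j. w j z) ` {..<h})" for z
  have W: "C1_distribution_on U h W"
    unfolding C1_distribution_on_def distribution_on_def
  proof (intro conjI ballI exI[of _ w] allI impI)
    show "subspace (W z)" for z by (simp add: W_def)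
    show "dim (W z) = h" if "z \<in> U" for z unfolding W_def dim_span_family by (rule U(3)[OF that])
    show "C1_on U (w i)" for i using wC1[of i] unfolding C1_on_def by (meson UNIV_I continuous_on_subset subset_UNIV)
  qed (simp add: W_def)
  have "distribution_tangent_on U W V"
    unfolding distribution_tangent_on_def W_def
  proof
    fix z
    show "span ((\<lambda>j. w j z) ` {..<h}) \<subseteq> V z"
    proof (rule span_minimal)
      show "subspace (V z)" by (simp add: X(2))
      have "w j z \<in> V z" for j unfolding w_def X(2) by (intro span_sum span_scale span_base) auto
      then show "(\<lambda>j. w j z) ` {..<h} \<subseteq> V z" by blast
    qed
  qed
  then have "non_involutive_at U W x"
    using noninv U(1,2) W unfolding h_non_involutive_at_def x_def h_def by blast
  moreover have "\<not> non_involutive_at U W x"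
    by (rule involutive_if_frame_commutes[OF U(1,2) W _ wder comm]) (simp add: W_def)
  ultimately show False by blast
qed

section \<open>The tangency set in a chart\<close>

lemma differentiable_blinfun:
  fixes F :: "'c::real_normed_vector \<Rightarrow> 'a::euclidean_space \<Rightarrow>\<^sub>L 'b::real_normed_vector"
  assumes "\<And>b. b \<in> Basis \<Longrightarrow> (\<lambda>z. F z b) differentiable (at y)"
  shows "F differentiable (at y)"
proof -
  have "\<exists>D. ((\<lambda>z. F z b) has_derivative D) (at y)" if "b \<in> Basis" for b
    using assms[OF that] unfolding differentiable_def .
  then obtain D where D: "\<And>b. b \<in> Basis \<Longrightarrow> ((\<lambda>z. F z b) has_derivative D b) (at y)" by metis
  define E where "E b v = blinfun_scaleR_left v o\<^sub>L blinfun_inner_left b" for b :: 'a and v :: 'b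
  have E: "bounded_linear (E b)" for b
    unfolding E_def
    by (rule bounded_linear_compose[OF bounded_bilinear.bounded_linear_left[OF bounded_bilinear_blinfun_compose] bounded_linear_blinfun_scaleR_left])
  have "F = (\<lambda>z. \<Sum>b\<in>Basis. E b (F z b))"
  proof (rule ext, rule blinfun_eqI)
    fix z v
    have "F z v = F z (\<Sum>b\<in>Basis. (v \<bullet> b) *\<^sub>R b)" by (simp add: euclidean_representation)
    also have "\<dots> = (\<Sum>b\<in>Basis. (v \<bullet> b) *\<^sub>R F z b)" by (simp add: blinfun.sum_right blinfun.scaleR_right)
    also have "\<dots> = (\<Sum>b\<in>Basis. E b (F z b)) v" by (simp add: blinfun.sum_left E_def inner_commute)
    finally show "F z v = (\<Sum>b\<in>Basis. E b (F z b)) v" .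
  qed
  moreover have "((\<lambda>z. \<Sum>b\<in>Basis. E b (F z b)) has_derivative (\<lambda>t. \<Sum>b\<in>Basis. E b (D b t))) (at y)"
    by (intro has_derivative_sum bounded_linear.has_derivative[OF E] D)
  ultimately have "(F has_derivative (\<lambda>t. \<Sum>b\<in>Basis. E b (D b t))) (at y)" by simp
  then show ?thesis unfolding differentiable_def by (rule exI[where x="\<lambda>t. \<Sum>b\<in>Basis. E b (D b t)"])
qed

lemma lipschitz_on_ball_if_C11:
  fixes \<phi> :: "'a::real_normed_vector \<Rightarrow> 'b::real_normed_vector"
  assumes "ball p r \<subseteq> U" "0 < r" and der: "\<And>x. x \<in> U \<Longrightarrow> (\<phi> has_derivative blinfun_apply (\<phi>' x)) (at x)"
    and lip: "K-lipschitz_on U \<phi>'"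
  shows "(norm (\<phi>' p) + K * r)-lipschitz_on (ball p r) \<phi>"
proof (rule lipschitz_onI)
  have K0: "0 \<le> K" using lip lipschitz_on_nonneg by blast
  show "0 \<le> norm (\<phi>' p) + K * r" using K0 assms(2) by simp
  fix x y assume xy: "x \<in> ball p r" "y \<in> ball p r"
  have "norm (\<phi> x - \<phi> y) \<le> (norm (\<phi>' p) + K * r) * norm (x - y)"
  proof (rule differentiable_bound[OF convex_ball _ _ xy])
    fix z assume z: "z \<in> ball p r"
    show "(\<phi> has_derivative blinfun_apply (\<phi>' z)) (at z within ball p r)"
      using der z assms(1) by (blast intro: has_derivative_at_withinI)
    have "norm (\<phi>' z - \<phi>' p) \<le> K * norm (z - p)"
      using z assms by (intro lipschitz_on_normD[OF lip]) auto
    also have "\<dots> \<le> K * r" using z K0 by (intro mult_left_mono) (auto simp: dist_norm norm_minus_commute)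
    finally have "norm (\<phi>' z) \<le> norm (\<phi>' p) + K * r" using norm_triangle_sub[of "\<phi>' z" "\<phi>' p"] by linarith
    then show "onorm (blinfun_apply (\<phi>' z)) \<le> norm (\<phi>' p) + K * r" by (simp add: norm_blinfun.rep_eq)
  qed
  then show "dist (\<phi> x) (\<phi> y) \<le> (norm (\<phi>' p) + K * r) * dist x y" by (simp add: dist_norm)
qed

text \<open>
  A flattening chart as in the definition of submanifolds, with its derivatives and Lipschitz constants named.
\<close>

locale C11_chart =
  fixes S U U' L :: "(real^'n) set" and \<phi> \<psi> :: "real^'n \<Rightarrow> real^'n"
    and \<phi>' \<psi>' :: "real^'n \<Rightarrow> (real^'n) \<Rightarrow>\<^sub>L (real^'n)" and K K' :: real
  assumes open_U: "open U" and open_U': "open U'" and homeo: "homeomorphism U U' \<phi> \<psi>"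
    and der_\<phi>: "\<And>x. x \<in> U \<Longrightarrow> (\<phi> has_derivative blinfun_apply (\<phi>' x)) (at x)" and lip_\<phi>: "K-lipschitz_on U \<phi>'"
    and der_\<psi>: "\<And>u. u \<in> U' \<Longrightarrow> (\<psi> has_derivative blinfun_apply (\<psi>' u)) (at u)" and lip_\<psi>: "K'-lipschitz_on U' \<psi>'"
    and sub_L: "subspace L" and flat: "\<phi> ` (U \<inter> S) = U' \<inter> L"
begin

lemma \<phi>_in: "x \<in> U \<Longrightarrow> \<phi> x \<in> U'" and \<psi>_in: "u \<in> U' \<Longrightarrow> \<psi> u \<in> U"
  and \<psi>\<phi>: "x \<in> U \<Longrightarrow> \<psi> (\<phi> x) = x" and \<phi>\<psi>: "u \<in> U' \<Longrightarrow> \<phi> (\<psi> u) = u"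
  using homeo unfolding homeomorphism_def by auto

lemma in_S_iff:
  assumes "x \<in> U"
  shows "x \<in> S \<longleftrightarrow> \<phi> x \<in> L"
proof
  assume "x \<in> S"
  then show "\<phi> x \<in> L" using assms flat by blast
next
  assume "\<phi> x \<in> L"
  then have "\<phi> x \<in> \<phi> ` (U \<inter> S)" using \<phi>_in[OF assms] flat by blast
  then obtain z where "z \<in> U" "z \<in> S" "\<phi> x = \<phi> z" by blast
  then show "x \<in> S" using \<psi>\<phi> assms by metis
qed

lemma \<psi>'_L_subset_tangent_space:
  assumes q: "q \<in> U" "q \<in> S" and v: "v \<in> L"
  shows "\<psi>' (\<phi> q) v \<in> tangent_space S q"
proof -
  define \<gamma> where "\<gamma> t = \<psi> (\<phi> q + t *\<^sub>R v)" for t :: real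
  have "((\<lambda>t::real. \<phi> q + t *\<^sub>R v) \<longlongrightarrow> \<phi> q + 0 *\<^sub>R v) (at 0)"
    by (intro tendsto_intros)
  then have "((\<lambda>t::real. \<phi> q + t *\<^sub>R v) \<longlongrightarrow> \<phi> q) (nhds 0)"
    using tendsto_at_iff_tendsto_nhds[of "\<lambda>t. \<phi> q + t *\<^sub>R v" 0] by simp
  from topological_tendstoD[OF this open_U' \<phi>_in[OF q(1)]]
  obtain \<epsilon> where \<epsilon>: "\<epsilon> > 0" "\<And>t. dist t 0 < \<epsilon> \<Longrightarrow> \<phi> q + t *\<^sub>R v \<in> U'"
    unfolding eventually_nhds_metric by blast
  have inU': "\<phi> q + t *\<^sub>R v \<in> U'" if "t \<in> {-\<epsilon><..<\<epsilon>}" for t using \<epsilon>(2)[of t] that by (auto simp: dist_real_def)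
  have der: "(\<gamma> has_derivative blinfun_apply (blinfun_scaleR_left (\<psi>' (\<phi> q + t *\<^sub>R v) v))) (at t)"
    if t: "t \<in> {-\<epsilon><..<\<epsilon>}" for t
  proof -
    have "((\<lambda>t. \<phi> q + t *\<^sub>R v) has_derivative (\<lambda>s. s *\<^sub>R v)) (at t)" by (auto intro!: derivative_eq_intros)
    from has_derivative_compose[OF this der_\<psi>[OF inU'[OF t]]] show ?thesis
      by (simp add: \<gamma>_def[abs_def] blinfun.scaleR_right)
  qed
  have cont: "continuous_on {-\<epsilon><..<\<epsilon>} (\<lambda>t. blinfun_scaleR_left (\<psi>' (\<phi> q + t *\<^sub>R v) v))"
  proof (intro bounded_linear.continuous_on[OF bounded_linear_blinfun_scaleR_left])
    have "continuous_on {-\<epsilon><..<\<epsilon>} (\<lambda>t. \<psi>' (\<phi> q + t *\<^sub>R v))"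
      by (rule continuous_on_compose2[OF lipschitz_on_continuous_on[OF lip_\<psi>]])
        (use inU' in \<open>auto intro!: continuous_intros\<close>)
    then show "continuous_on {-\<epsilon><..<\<epsilon>} (\<lambda>t. \<psi>' (\<phi> q + t *\<^sub>R v) v)"
      by (rule bounded_linear.continuous_on[OF blinfun.bounded_linear_left])
  qed
  have "C1_on {-\<epsilon><..<\<epsilon>} \<gamma>"
    unfolding C1_on_def
    by (rule exI[of _ "\<lambda>t. blinfun_scaleR_left (\<psi>' (\<phi> q + t *\<^sub>R v) v)"]) (use der cont in blast)
  moreover have "\<gamma> ` {-\<epsilon><..<\<epsilon>} \<subseteq> S"
  proof
    fix z assume "z \<in> \<gamma> ` {-\<epsilon><..<\<epsilon>}"
    then obtain t where t: "t \<in> {-\<epsilon><..<\<epsilon>}" "z = \<gamma> t" by blast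
    have "\<phi> q + t *\<^sub>R v \<in> L"
      using in_S_iff[OF q(1)] q(2) v by (intro subspace_add subspace_scale sub_L) auto
    then show "z \<in> S" using in_S_iff[OF \<psi>_in[OF inU'[OF t(1)]]] \<phi>\<psi>[OF inU'[OF t(1)]] by (simp add: t(2) \<gamma>_def)
  qed
  moreover have "\<gamma> 0 = q" using \<psi>\<phi>[OF q(1)] by (simp add: \<gamma>_def)
  moreover have "(\<gamma> has_vector_derivative \<psi>' (\<phi> q) v) (at 0)"
    using der[of 0] \<epsilon>(1) by (simp add: has_vector_derivative_def)
  ultimately show ?thesis unfolding tangent_space_def using \<epsilon>(1) by blast
qed

lemma tangent_space_subset_\<psi>'_L:
  assumes q: "q \<in> U" "q \<in> S" and w: "w \<in> tangent_space S q"
  shows "\<exists>v\<in>L. w = \<psi>' (\<phi> q) v"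
proof -
  obtain \<gamma> \<epsilon> where \<gamma>: "\<epsilon> > 0" "\<gamma> ` {-\<epsilon><..<\<epsilon>} \<subseteq> S" "\<gamma> 0 = q" "(\<gamma> has_vector_derivative w) (at 0)"
    using w unfolding tangent_space_def by blast
  have d\<gamma>: "(\<gamma> has_derivative (\<lambda>s. s *\<^sub>R w)) (at 0)" using \<gamma>(4) by (simp add: has_vector_derivative_def)
  have d\<phi>: "(\<phi> has_derivative blinfun_apply (\<phi>' q)) (at q)" by (rule der_\<phi>[OF q(1)])
  have d: "((\<lambda>t. \<phi> (\<gamma> t)) has_derivative (\<lambda>s. \<phi>' q (s *\<^sub>R w))) (at 0)"
    by (rule has_derivative_compose[OF d\<gamma>]) (use d\<phi> \<gamma>(3) in simp)
  define Y where "Y n = 1 / real (Suc n)" for n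
  have Y1: "real (Suc n) *\<^sub>R (Y n - 0) = 1" for n by (simp add: Y_def del: of_nat_Suc)
  have YL: "(\<lambda>n. real (Suc n) *\<^sub>R (Y n - 0)) \<longlonglongrightarrow> 1" unfolding Y1 by (rule tendsto_const)
  have Y0: "Y \<longlonglongrightarrow> 0" by (rule sequence_tendsto_base[OF YL])
  have lim: "(\<lambda>n. real (Suc n) *\<^sub>R (\<phi> (\<gamma> (Y n)) - \<phi> (\<gamma> 0))) \<longlonglongrightarrow> \<phi>' q (1 *\<^sub>R w)"
    by (rule has_derivative_sequence[OF d YL])
  have "(\<lambda>n. \<gamma> (Y n)) \<longlonglongrightarrow> q"
    using isCont_tendsto_compose[OF has_derivative_continuous[OF d\<gamma>] Y0] \<gamma>(3) by simp
  then have "\<forall>\<^sub>F n in sequentially. \<gamma> (Y n) \<in> U" by (rule topological_tendstoD[OF _ open_U q(1)])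
  moreover have "\<forall>\<^sub>F n in sequentially. Y n \<in> {-\<epsilon><..<\<epsilon>}"
    by (rule topological_tendstoD[OF Y0]) (use \<gamma>(1) in auto)
  ultimately have "\<forall>\<^sub>F n in sequentially. real (Suc n) *\<^sub>R (\<phi> (\<gamma> (Y n)) - \<phi> (\<gamma> 0)) \<in> L"
  proof eventually_elim
    case (elim n)
    then have "\<phi> (\<gamma> (Y n)) \<in> L" using in_S_iff[OF elim(1)] \<gamma>(2) by blast
    moreover have "\<phi> (\<gamma> 0) \<in> L" using in_S_iff[OF q(1)] q(2) \<gamma>(3) by simp
    ultimately show ?case by (intro subspace_scale subspace_diff sub_L)
  qed
  then have "\<phi>' q (1 *\<^sub>R w) \<in> L"
    by (rule Lim_in_closed_set[OF closed_subspace[OF sub_L] _ sequentially_bot lim])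
  moreover have "\<psi>' (\<phi> q) (\<phi>' q w) = w"
  proof -
    have "((\<lambda>x. \<psi> (\<phi> x)) has_derivative (\<lambda>v. \<psi>' (\<phi> q) (\<phi>' q v))) (at q)"
      by (rule has_derivative_compose[OF d\<phi> der_\<psi>[OF \<phi>_in[OF q(1)]]])
    moreover have "((\<lambda>x. \<psi> (\<phi> x)) has_derivative (\<lambda>v. v)) (at q)"
      by (rule has_derivative_transform_within_open[OF has_derivative_ident open_U q(1)]) (simp add: \<psi>\<phi>)
    ultimately have "(\<lambda>v. \<psi>' (\<phi> q) (\<phi>' q v)) = (\<lambda>v. v)" by (rule has_derivative_unique)
    then show ?thesis by (rule fun_cong)
  qed
  ultimately show ?thesis by (intro bexI[of _ "\<phi>' q w"]) auto
qed

text \<open>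
  Tangent spaces are \<open>\<psi>' (\<phi> q) ` L\<close>, so they vary continuously with \<open>q\<close>, and \<open>V\<close> has closed graph.
\<close>

lemma tangency_set_rel_closed:
  assumes V: "C1_distribution_on UNIV k V" and q: "q \<in> U" "q \<in> closure (tangency_set S V \<inter> U)"
  shows "q \<in> tangency_set S V"
proof -
  obtain z where z: "\<And>n. z n \<in> tangency_set S V \<inter> U" "z \<longlonglongrightarrow> q"
    using q(2) unfolding closure_sequential by blast
  have zS: "z n \<in> S" "z n \<in> U" for n using z(1)[of n] by (auto simp: tangency_set_def)
  have \<phi>z: "(\<lambda>n. \<phi> (z n)) \<longlonglongrightarrow> \<phi> q"
    by (rule isCont_tendsto_compose[OF has_derivative_continuous[OF der_\<phi>[OF q(1)]] z(2)])
  have "\<phi> q \<in> L"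
    by (rule closed_sequentially[OF closed_subspace[OF sub_L] _ \<phi>z]) (use in_S_iff zS in blast)
  then have qS: "q \<in> S" using in_S_iff[OF q(1)] by simp
  have "w \<in> V q" if w: "w \<in> tangent_space S q" for w
  proof -
    obtain v where v: "v \<in> L" "w = \<psi>' (\<phi> q) v" using tangent_space_subset_\<psi>'_L[OF q(1) qS w] by blast
    have "isCont \<psi>' (\<phi> q)"
      using lipschitz_on_continuous_on[OF lip_\<psi>] open_U' \<phi>_in[OF q(1)] continuous_on_eq_continuous_at by blast
    then have "(\<lambda>n. \<psi>' (\<phi> (z n))) \<longlonglongrightarrow> \<psi>' (\<phi> q)" by (rule isCont_tendsto_compose[OF _ \<phi>z])
    then have lim: "(\<lambda>n. \<psi>' (\<phi> (z n)) v) \<longlonglongrightarrow> w" unfolding v(2)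
      by (rule bounded_linear.tendsto[OF blinfun.bounded_linear_left])
    have "\<psi>' (\<phi> (z n)) v \<in> V (z n)" for n
      using \<psi>'_L_subset_tangent_space[OF zS(2,1) v(1)] z(1)[of n] unfolding tangency_set_def by blast
    then show ?thesis by (intro C1_distribution_closed[OF V UNIV_I _ z(2) lim]) auto
  qed
  then show ?thesis using qS unfolding tangency_set_def by blast
qed

text \<open>
  Outside the null set \<open>Bad\<close> all differentiability and density hypotheses of
  \<open>tangency_forces_degeneracy\<close> hold, so there the derivative of \<open>f\<close> is not injective. Passing to a ball, which is convex and
  bounded, makes the chart \<open>\<phi>\<close> Lipschitz.
\<close>

lemma tangency_set_null_in_ball:
  fixes f :: "'c::euclidean_space \<Rightarrow> real^'n"
  assumes V: "C1_distribution_on UNIV k V" and noninv: "h_non_involutive DIM('c) V"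
    and ball: "ball p r \<subseteq> U" "0 < r" and f: "Q-lipschitz_on UNIV f"
  shows "hausdorff_measure DIM('c) (f ` {y. f y \<in> tangency_set S V \<inter> ball p r}) = 0"
proof -
  define A where "A = {y. f y \<in> tangency_set S V \<inter> ball p r}"
  define R where "R = f -` ball p r"
  have contf: "continuous_on UNIV f" using f lipschitz_on_continuous_on by blast
  have openR: "open R" unfolding R_def by (rule open_vimage[OF open_ball contf])
  have AR: "A \<subseteq> R" by (auto simp: A_def R_def)
  have RU: "f z \<in> U" if "z \<in> R" for z using that ball by (auto simp: R_def)
  define g where "g z = \<phi> (f z)" for z
  define K1 where "K1 = norm (\<phi>' p) + K * r"
  have lip\<phi>: "K1-lipschitz_on (ball p r) \<phi>"
    unfolding K1_def by (rule lipschitz_on_ball_if_C11[OF ball der_\<phi> lip_\<phi>])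
  have lipg: "(K1 * Q)-lipschitz_on R g"
    unfolding g_def
    by (rule lipschitz_on_compose2[OF lipschitz_on_subset[OF f subset_UNIV] lipschitz_on_subset[OF lip\<phi>]]) (auto simp: R_def)
  have lipN: "(K' * (K1 * Q))-lipschitz_on R (\<lambda>z. \<psi>' (g z))"
    by (rule lipschitz_on_compose2[OF lipg lipschitz_on_subset[OF lip_\<psi>]]) (use RU \<phi>_in in \<open>auto simp: g_def\<close>)
  have neg1: "negligible {z\<in>R. \<not> f differentiable (at z)}"
    by (rule rademacher[OF openR lipschitz_on_subset[OF f subset_UNIV]])
  have neg2: "negligible {z\<in>R. \<not> (\<lambda>z. \<psi>' (g z) b) differentiable (at z)}" for b
  proof (rule rademacher[OF openR])
    show "(norm b * (K' * (K1 * Q)))-lipschitz_on R (\<lambda>z. \<psi>' (g z) b)"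
    proof (rule lipschitz_onI)
      fix y z assume yz: "y \<in> R" "z \<in> R"
      have "dist (\<psi>' (g y) b) (\<psi>' (g z) b) = norm ((\<psi>' (g y) - \<psi>' (g z)) b)" by (simp add: dist_norm blinfun.diff_left)
      also have "\<dots> \<le> norm (\<psi>' (g y) - \<psi>' (g z)) * norm b" by (rule norm_blinfun)
      also have "\<dots> \<le> (K' * (K1 * Q) * norm (y - z)) * norm b"
        by (intro mult_right_mono lipschitz_on_normD[OF lipN yz]) simp
      finally show "dist (\<psi>' (g y) b) (\<psi>' (g z) b) \<le> norm b * (K' * (K1 * Q)) * dist y z" by (simp add: dist_norm mult_ac)
    qed (use lipschitz_on_nonneg[OF lipN] in auto)
  qed
  define Bad where "Bad = {z\<in>R. \<not> f differentiable (at z)} \<union> (\<Union>b\<in>Basis. {z\<in>R. \<not> (\<lambda>z. \<psi>' (g z) b) differentiable (at z)})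
      \<union> {z\<in>A. \<not> tangentially_dense A z}"
  have negBad: "negligible Bad"
    unfolding Bad_def using neg1 neg2 negligible_not_tangentially_dense[of A]
    by (intro negligible_Un negligible_Union) auto
  have crit: "\<exists>F e. (f has_derivative F) (at y) \<and> e \<noteq> 0 \<and> F e = 0" if y: "y \<in> A - Bad" for y
  proof -
    have yA: "y \<in> A" and yR: "y \<in> R" using y AR by auto
    have td: "tangentially_dense A y" using y by (auto simp: Bad_def)
    have "f differentiable (at y)" using y yR by (auto simp: Bad_def)
    then obtain F where F: "(f has_derivative F) (at y)" unfolding differentiable_def by blast
    have "(\<lambda>z. \<psi>' (g z)) differentiable (at y)"
      by (rule differentiable_blinfun) (use y yR in \<open>auto simp: Bad_def\<close>)
    then obtain M where M: "((\<lambda>z. \<psi>' (g z)) has_derivative M) (at y)" unfolding differentiable_def by blast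
    have G: "(g has_derivative (\<lambda>t. \<phi>' (f y) (F t))) (at y)"
      unfolding g_def by (rule has_derivative_compose[OF F der_\<phi>[OF RU[OF yR]]])
    have gU: "g y \<in> U'" using RU[OF yR] \<phi>_in by (simp add: g_def)
    have FG: "F t = \<psi>' (g y) (\<phi>' (f y) (F t))" for t
    proof -
      have "((\<lambda>z. \<psi> (g z)) has_derivative (\<lambda>t. \<psi>' (g y) (\<phi>' (f y) (F t)))) (at y)"
        by (rule has_derivative_compose[OF G der_\<psi>[OF gU]])
      moreover have "((\<lambda>z. \<psi> (g z)) has_derivative F) (at y)"
        by (rule has_derivative_transform_within_open[OF F openR yR]) (use RU \<psi>\<phi> in \<open>simp add: g_def\<close>)
      ultimately have "(\<lambda>t. \<psi>' (g y) (\<phi>' (f y) (F t))) = F" by (rule has_derivative_unique)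
      from fun_cong[OF this, of t] show ?thesis by simp
    qed
    have gL: "g z \<in> L" if "z \<in> A" for z
      using in_S_iff[OF RU] that AR unfolding g_def A_def tangency_set_def by blast
    have tang: "\<psi>' (g z) v \<in> V (f z)" if "z \<in> A" "v \<in> L" for z v
    proof -
      have "f z \<in> U" using that AR RU by blast
      moreover have "f z \<in> S" "tangent_space S (f z) \<subseteq> V (f z)" using that by (auto simp: A_def tangency_set_def)
      ultimately show ?thesis using \<psi>'_L_subset_tangent_space[of "f z" v] that unfolding g_def by blast
    qed
    have "h_non_involutive_at DIM('c) V (f y)" using noninv unfolding h_non_involutive_def by blast
    from tangency_forces_degeneracy[OF V this open_U' gU der_\<psi> lip_\<psi> F G M FG yA td sub_L gL tang]
    show ?thesis using F by blast
  qed
  have "f ` A \<subseteq> f ` Bad \<union> f ` (A - Bad)" by blast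
  then have "hausdorff_measure DIM('c) (f ` A) \<le> hausdorff_measure DIM('c) (f ` Bad) + hausdorff_measure DIM('c) (f ` (A - Bad))"
    by (rule order_trans[OF hausdorff_measure_mono hausdorff_measure_Un_le])
  also have "\<dots> = 0"
    using hausdorff_null_lipschitz_image[OF f negBad]
      hausdorff_null_critical_values[of "A - Bad" f, OF crit] by simp
  finally show ?thesis by (simp add: A_def)
qed

end

lemma C11_submanifold_chart:
  fixes S :: "(real^'n) set"
  assumes "C11_submanifold d S" "p \<in> S"
  obtains U U' L \<phi> \<psi> \<phi>' \<psi>' K K' where "p \<in> U" "C11_chart S U U' L \<phi> \<psi> \<phi>' \<psi>' K K'"
proof -
  from bspec[OF assms(1)[unfolded C11_submanifold_def] assms(2)] show ?thesis
  proof (elim exE conjE)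
    fix U U' :: "(real^'n) set" and \<phi> \<psi> and L :: "(real^'n) set"
    assume c: "open U" "p \<in> U" "open U'" "homeomorphism U U' \<phi> \<psi>" "C11_on U \<phi>" "C11_on U' \<psi>"
      "subspace L" "\<phi> ` (U \<inter> S) = U' \<inter> L"
    from c(5,6) obtain \<phi>' \<psi>' K K' where d: "\<forall>x\<in>U. (\<phi> has_derivative blinfun_apply (\<phi>' x)) (at x)"
      "K-lipschitz_on U \<phi>'" "\<forall>x\<in>U'. (\<psi> has_derivative blinfun_apply (\<psi>' x)) (at x)" "K'-lipschitz_on U' \<psi>'"
      unfolding C11_on_def by blast
    have "C11_chart S U U' L \<phi> \<psi> \<phi>' \<psi>' K K'"
      by unfold_locales (use c d in auto)
    then show ?thesis using that c(2) by blast
  qed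
qed

text \<open>
  By Lindelof's theorem countably many charts suffice, both for the Borel property and for nullity.
\<close>

lemma tangency_set_ball_cover:
  assumes V: "C1_distribution_on UNIV k V" and noninv: "h_non_involutive DIM('c::euclidean_space) V"
    and S: "C11_submanifold d S"
  obtains \<B> where "countable \<B>" "S \<subseteq> \<Union>\<B>" "\<And>B. B \<in> \<B> \<Longrightarrow> open B"
    "\<And>B. B \<in> \<B> \<Longrightarrow> B \<inter> closure (tangency_set S V \<inter> B) \<subseteq> tangency_set S V"
    "\<And>B (f :: 'c \<Rightarrow> real^'n) Q. B \<in> \<B> \<Longrightarrow> Q-lipschitz_on UNIV f \<Longrightarrow>
       hausdorff_measure DIM('c) (f ` {y. f y \<in> tangency_set S V \<inter> B}) = 0"
proof -
  define good where "good B \<longleftrightarrow> open B \<and> B \<inter> closure (tangency_set S V \<inter> B) \<subseteq> tangency_set S V \<and>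
    (\<forall>(f :: 'c \<Rightarrow> real^'n) Q. Q-lipschitz_on UNIV f \<longrightarrow>
       hausdorff_measure DIM('c) (f ` {y. f y \<in> tangency_set S V \<inter> B}) = 0)" for B
  have "\<exists>B. p \<in> B \<and> good B" if p: "p \<in> S" for p
  proof -
    obtain U U' L \<phi> \<psi> \<phi>' \<psi>' K K' where pU: "p \<in> U" and "C11_chart S U U' L \<phi> \<psi> \<phi>' \<psi>' K K'"
      using C11_submanifold_chart[OF S p] by metis
    then interpret C11_chart S U U' L \<phi> \<psi> \<phi>' \<psi>' K K' by simp
    obtain r where r: "0 < r" "ball p r \<subseteq> U" using open_U pU open_contains_ball by blast
    have "ball p r \<inter> closure (tangency_set S V \<inter> ball p r) \<subseteq> tangency_set S V"
    proof
      fix q assume q: "q \<in> ball p r \<inter> closure (tangency_set S V \<inter> ball p r)"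
      have "closure (tangency_set S V \<inter> ball p r) \<subseteq> closure (tangency_set S V \<inter> U)"
        using r by (intro closure_mono) blast
      then show "q \<in> tangency_set S V" using q r by (intro tangency_set_rel_closed[OF V]) auto
    qed
    then have "good (ball p r)" unfolding good_def
      using tangency_set_null_in_ball[OF V noninv r(2,1)] by blast
    then show ?thesis using r(1) by (intro exI[of _ "ball p r"]) simp
  qed
  then obtain B where B: "\<And>p. p \<in> S \<Longrightarrow> p \<in> B p \<and> good (B p)" by metis
  have "\<And>X. X \<in> B ` S \<Longrightarrow> open X" using B unfolding good_def by blast
  then obtain \<B> where \<B>: "\<B> \<subseteq> B ` S" "countable \<B>" "\<Union>\<B> = \<Union>(B ` S)" by (rule Lindelof)
  show ?thesis
  proof (rule that[OF \<B>(2)])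
    show "S \<subseteq> \<Union>\<B>" unfolding \<B>(3) using B by blast
    have g: "good X" if "X \<in> \<B>" for X using that \<B>(1) B by blast
    show "open X" "X \<inter> closure (tangency_set S V \<inter> X) \<subseteq> tangency_set S V" if "X \<in> \<B>" for X
      using g[OF that] unfolding good_def by blast+
    show "hausdorff_measure DIM('c) (f ` {y. f y \<in> tangency_set S V \<inter> X}) = 0"
      if "X \<in> \<B>" "Q-lipschitz_on UNIV f" for X Q and f :: "'c \<Rightarrow> real^'n"
      using g[OF that(1)] that(2) unfolding good_def by blast
  qed
qed

section \<open>Pure unrectifiability of the tangency set\<close>

theorem theorem1p1p2:
  fixes V :: "real^'n \<Rightarrow> (real^'n) set"
    and S :: "(real^'n) set"
    and h k k' :: nat
  assumes "h = CARD('h::finite)"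
    and "2 \<le> h" and "h \<le> k'" and "k' \<le> k" and "k < CARD('n)"
    and "C1_distribution_on UNIV k V"
    and "h_non_involutive h V"
    and "C11_submanifold k' S"
  shows "purely_unrectifiable TYPE('h) (tangency_set S V)"
proof -
  define E where "E = tangency_set S V"
  have dim: "DIM(real^'h) = CARD('h)" by simp
  have noninv: "h_non_involutive DIM(real^'h) V" using assms(1,7) by simp
  obtain \<B> where \<B>: "countable \<B>" "S \<subseteq> \<Union>\<B>" "\<And>B. B \<in> \<B> \<Longrightarrow> open B"
    "\<And>B. B \<in> \<B> \<Longrightarrow> B \<inter> closure (E \<inter> B) \<subseteq> E"
    "\<And>B (f :: real^'h \<Rightarrow> real^'n) Q. B \<in> \<B> \<Longrightarrow> Q-lipschitz_on UNIV f \<Longrightarrow>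
       hausdorff_measure DIM(real^'h) (f ` {y. f y \<in> E \<inter> B}) = 0"
    unfolding E_def by (rule tangency_set_ball_cover[OF assms(6) noninv assms(8)]) blast
  have ES: "E \<subseteq> S" by (auto simp: E_def tangency_set_def)
  have "E = (\<Union>B\<in>\<B>. B \<inter> closure (E \<inter> B))"
  proof
    show "E \<subseteq> (\<Union>B\<in>\<B>. B \<inter> closure (E \<inter> B))"
    proof
      fix q assume q: "q \<in> E"
      then obtain B where "B \<in> \<B>" "q \<in> B" using ES \<B>(2) by blast
      then show "q \<in> (\<Union>B\<in>\<B>. B \<inter> closure (E \<inter> B))" using q closure_subset[of "E \<inter> B"] by blast
    qed
  qed (use \<B>(4) in blast)
  moreover have "(\<Union>B\<in>\<B>. B \<inter> closure (E \<inter> B)) \<in> sets borel"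
    by (rule sets.countable_UN''[OF \<B>(1)]) (use \<B>(3) in auto)
  ultimately have "E \<in> sets borel" by simp
  then have meas: "hausdorff_measurable CARD('h) E" by (rule hausdorff_measurable_borel)
  have null: "hausdorff_measure CARD('h) (f ` K \<inter> E) = 0" if lip: "L-lipschitz_on K f" for K and f :: "real^'h \<Rightarrow> real^'n" and L
  proof -
    obtain F Q where F: "Q-lipschitz_on UNIV F" "\<And>x. x \<in> K \<Longrightarrow> F x = f x"
      by (rule lipschitz_extension[OF lip]) blast
    have "f ` K \<inter> E \<subseteq> (\<Union>B\<in>\<B>. F ` {y. F y \<in> E \<inter> B})"
    proof
      fix q assume "q \<in> f ` K \<inter> E"
      then obtain y where y: "y \<in> K" "q = F y" "q \<in> E" using F(2) by fastforce
      then obtain B where "B \<in> \<B>" "q \<in> B" using ES \<B>(2) by blast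
      then show "q \<in> (\<Union>B\<in>\<B>. F ` {y. F y \<in> E \<inter> B})" using y by blast
    qed
    moreover have "hausdorff_measure CARD('h) (\<Union>B\<in>\<B>. F ` {y. F y \<in> E \<inter> B}) = 0"
      by (rule hausdorff_measure_null_countable_UN[OF \<B>(1) \<B>(5)[OF _ F(1), unfolded dim]])
    ultimately show ?thesis using hausdorff_measure_mono[of _ _ "CARD('h)"] by (metis le_zero_eq)
  qed
  show ?thesis
    unfolding purely_unrectifiable_def E_def[symmetric] using meas null by blast
qed

end
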